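(* Let $\lambda_1,\lambda_2>0$ and let $W:\mathbb{R}^2\to[0,\infty)$ be continuous and real analytic in a ball $B$ centered at the origin. Suppose that for every $\beta\in(0,\pi)$, $W$ can be expressed as $$W(p)=\left|\nabla g_\beta(p)+\Lambda_\beta(p)\right|^2\quad\text{for all }p\in B,$$ where $\Lambda_\beta$ is the linear vector field $$\Lambda_\beta(p)=\begin{pmatrix}-\lambda_1\sin\beta&-\lambda_2\cos\beta\\ \lambda_1\cos\beta&-\lambda_2\sin\beta\end{pmatrix}\begin{pmatrix}p_1\\ p_2\end{pmatrix}$$ and $g_\beta:B\to\mathbb{R}$ is analytic in $B$ with a Taylor series of the form $g_\beta(p)=\sum_{|\alpha|\ge3}a_\alpha p^\alpha$ (with coefficients depending on $\beta$). Then there exists $R>0$ with $B_R(0)\subset B$ such that for every $\mathbf{p}_0\in B_R(0)\setminus\{0\}$, denoting by $\gamma_0$ the (unique) $E$-minimizing geodesic joining $\mathbf{p}_0$ to $0$, there is an open interval $I(\mathbf{p}_0)$ containing $\mathcal{P}(\gamma_0)$ such that for every $A\in I(\mathbf{p}_0)$ there exists a solution to $$\inf_{\gamma\in\mathcal{S}_{A,\mathbf{p}_0}}E(\gamma).$$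
   Context: Set $F=\sqrt W$. For a Lipschitz curve $\gamma=(\gamma^{(1)},\gamma^{(2)}):[0,1]\to\mathbb{R}^2$: $E(\gamma)=\int_0^1F(\gamma)|\gamma'|\,dt$ and $\mathcal{P}(\gamma)=-\int_0^1\gamma^{(2)}(\gamma^{(1)})'\,dt$. $\mathcal{S}_{A,\mathbf{p}_0}$ is the set of all locally Lipschitz $\gamma:[0,1]\to\mathbb{R}^2$ with $\gamma(0)=\mathbf{p}_0$, $\gamma(1)=(0,0)$, $\mathcal{P}(\gamma)=A$. The minimizing geodesic $\gamma_0$ minimizes $E$ among locally Lipschitz curves from $\mathbf{p}_0$ to $0$ without any constraint on $\mathcal{P}$; uniqueness is up to reparametrization. Multi-index notation: $p^\alpha=p_1^{\alpha_1}p_2^{\alpha_2}$, $|\alpha|=\alpha_1+\alpha_2$. Coordinates are with respect to an orthonormal basis of eigenvectors of $D^2W(0,0)$, in which $W(p)=\lambda_1^2p_1^2+\lambda_2^2p_2^2+O(|p_1|^3+|p_2|^3)$. *)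

theory Defs
  imports "HOL-Analysis.Analysis"
begin

type_synonym plane = "real ^ 2"

section \<open>Real analytic functions of two variables\<close>

text \<open>A multi-index is a pair of natural numbers. Over the reals \<open>has_sum\<close> is unordered, i.e.
  absolute, convergence.\<close>

definition monomial :: "plane \<Rightarrow> nat \<times> nat \<Rightarrow> real" where
  "monomial p \<alpha> = (p $ 1) ^ fst \<alpha> * (p $ 2) ^ snd \<alpha>"

definition multi_order :: "nat \<times> nat \<Rightarrow> nat" where
  "multi_order \<alpha> = fst \<alpha> + snd \<alpha>"

definition has_taylor_series :: "(plane \<Rightarrow> real) \<Rightarrow> plane \<Rightarrow> (nat \<times> nat \<Rightarrow> real) \<Rightarrow> bool" where
  "has_taylor_series f q a \<longleftrightarrow>
     (\<exists>r>0. \<forall>p\<in>ball q r. ((\<lambda>\<alpha>. a \<alpha> * monomial (p - q) \<alpha>) has_sum f p) UNIV)"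

definition real_analytic_on :: "(plane \<Rightarrow> real) \<Rightarrow> plane set \<Rightarrow> bool" where
  "real_analytic_on f S \<longleftrightarrow> (\<forall>q\<in>S. \<exists>a. has_taylor_series f q a)"

definition gradient :: "(plane \<Rightarrow> real) \<Rightarrow> plane \<Rightarrow> plane" where
  "gradient f p = (THE D. GDERIV f p :> D)"

definition Lambda :: "real \<Rightarrow> real \<Rightarrow> real \<Rightarrow> plane \<Rightarrow> plane" where
  "Lambda l1 l2 \<beta> p =
     (vector [vector [- l1 * sin \<beta>, - l2 * cos \<beta>],
              vector [  l1 * cos \<beta>, - l2 * sin \<beta>]] :: real ^ 2 ^ 2) *v p"

section \<open>Curves, energy and area\<close>

text \<open>Curves are total functions on the reals of which only the restriction to \<open>{0..1}\<close> matters.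
  Derivatives of a Lipschitz curve exist almost everywhere; \<open>vector_derivative\<close> is an
  unspecified constant on the remaining null set, which does not affect the integrals.\<close>

definition locally_lipschitz_on :: "'a::metric_space set \<Rightarrow> ('a \<Rightarrow> 'b::metric_space) \<Rightarrow> bool" where
  "locally_lipschitz_on S f \<longleftrightarrow> (\<forall>x\<in>S. \<exists>e>0. \<exists>L. L-lipschitz_on (S \<inter> ball x e) f)"

definition energy :: "(plane \<Rightarrow> real) \<Rightarrow> (real \<Rightarrow> plane) \<Rightarrow> real" where
  "energy W \<gamma> =
     (LINT t:{0..1}|lebesgue. sqrt (W (\<gamma> t)) * norm (vector_derivative \<gamma> (at t within {0..1})))"

definition area :: "(real \<Rightarrow> plane) \<Rightarrow> real" where
  "area \<gamma> =
     - (LINT t:{0..1}|lebesgue. \<gamma> t $ 2 * vector_derivative (\<lambda>s. \<gamma> s $ 1) (at t within {0..1}))"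

definition curves_to_origin :: "plane \<Rightarrow> (real \<Rightarrow> plane) set" where
  "curves_to_origin p0 = {\<gamma>. locally_lipschitz_on {0..1} \<gamma> \<and> \<gamma> 0 = p0 \<and> \<gamma> 1 = 0}"

definition curves_with_area :: "real \<Rightarrow> plane \<Rightarrow> (real \<Rightarrow> plane) set" where
  "curves_with_area A p0 = {\<gamma> \<in> curves_to_origin p0. area \<gamma> = A}"

definition minimizing_geodesic :: "(plane \<Rightarrow> real) \<Rightarrow> plane \<Rightarrow> (real \<Rightarrow> plane) \<Rightarrow> bool" where
  "minimizing_geodesic W p0 \<gamma> \<longleftrightarrow> is_arg_min (energy W) (\<lambda>\<eta>. \<eta> \<in> curves_to_origin p0) \<gamma>"

definition constrained_minimizer :: "(plane \<Rightarrow> real) \<Rightarrow> real \<Rightarrow> plane \<Rightarrow> (real \<Rightarrow> plane) \<Rightarrow> bool" where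
  "constrained_minimizer W A p0 \<gamma> \<longleftrightarrow> is_arg_min (energy W) (\<lambda>\<eta>. \<eta> \<in> curves_with_area A p0) \<gamma>"

definition time_change :: "(real \<Rightarrow> real) \<Rightarrow> bool" where
  "time_change \<sigma> \<longleftrightarrow> continuous_on {0..1} \<sigma> \<and> mono_on {0..1} \<sigma> \<and> \<sigma> 0 = 0 \<and> \<sigma> 1 = 1"

text \<open>Equality up to reparametrization. Time changes may be constant on intervals, since a
  minimizer may pause without changing its energy; two curves that both pause need not be
  reparametrizations of each other, so a common parametrization is required instead.\<close>

definition same_up_to_reparam :: "(real \<Rightarrow> plane) \<Rightarrow> (real \<Rightarrow> plane) \<Rightarrow> bool" where
  "same_up_to_reparam \<gamma> \<eta> \<longleftrightarrow>
     (\<exists>\<Gamma> \<sigma> \<tau>. locally_lipschitz_on {0..1} \<Gamma> \<and> time_change \<sigma> \<and> time_change \<tau> \<and>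
        (\<forall>t\<in>{0..1}. \<gamma> t = \<Gamma> (\<sigma> t) \<and> \<eta> t = \<Gamma> (\<tau> t)))"

end

theory Submission
  imports Defs
begin

text \<open>Write \<open>\<mu> = (\<lambda>\<^sub>1 + \<lambda>\<^sub>2) cos \<beta>\<close>. The field \<open>V\<^sub>\<beta> = \<nabla>g\<^sub>\<beta> + \<Lambda>\<^sub>\<beta>\<close> has length \<open>\<surd>W\<close> and curl \<open>\<mu>\<close>, hence equals
  \<open>\<nabla>G + \<mu> (- p\<^sub>2, 0)\<close>; by Cauchy-Schwarz every curve from \<open>p\<^sub>0\<close> to the origin satisfies
  \<open>E \<ge> - G p\<^sub>0 + \<mu> \<P>\<close>, with equality exactly along the flow of \<open>V\<^sub>\<beta>\<close>. A flow line that reaches the origin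
  therefore minimizes \<open>E\<close> among all curves with its own area, and for \<open>\<beta> = \<pi>/2\<close> among all curves.

  That the flow lines reach the origin on a disc that does not depend on \<open>\<beta>\<close> near \<open>\<pi>/2\<close> follows from a maximum
  principle for the angle between \<open>V\<^sub>\<beta>\<close> and \<open>V\<^sub>\<pi>\<^sub>/\<^sub>2\<close>, which solves a transport equation along \<open>V\<^sub>\<beta>\<close>.
  The area of the flow line from \<open>p\<^sub>0\<close> is continuous in \<open>\<mu>\<close>: along the line of one field the calibration by
  another field has excess \<open>\<bar>V - V'\<bar>\<^sup>2 / 2\<close>, whose integral is at most \<open>\<bar>\<mu> - \<mu>'\<bar>\<close> times the difference
  of the areas, and Gronwall's inequality compares the two lines. The same excess shows that \<open>\<P>(\<gamma>\<^sub>0)\<close> lies strictly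
  between the areas for \<open>- \<mu>\<close> and \<open>\<mu>\<close>, so the intermediate value theorem yields every area near \<open>\<P>(\<gamma>\<^sub>0)\<close>.\<close>

section \<open>Differentiating double power series\<close>

text \<open>The fields are chosen for each \<beta> separately: nothing says that \<open>g\<close>
  varies continuously with \<beta>, so neither a common disc nor the continuity of the area can come
  from continuous dependence on parameters. Everything uniform is extracted from what the fields
  share, their length \<open>sqrt W\<close>. It fixes each field up to an angle, whose transport
  equation involves only the curl and the divergence of the gradient field; it gives all fields the
  same linear bound; and it turns the excess of one calibration along the orbit of another into a
  square. The calibration holds only on a disc of radius \<open>r\<close>, while competitors may
  roam the whole plane. Leaving the disc costs at least
  \<open>k/2 * (r^2 - \<bar>p0\<bar>^2)\<close>, an orbit costs at most
  \<open>C^2 * \<bar>p0\<bar>^2 / k\<close>; this comparison dictates the size of \<open>R\<close>.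
  Uniqueness up to reparametrization uses the potential of the gradient field as a clock shared by
  the minimizer and the orbit. Curves are merely Lipschitz, so the fundamental theorem of calculus
  is proved for Lipschitz functions, together with their differentiability almost
  everywhere.\<close>

lemma double_series_fst_derivative:
  fixes a :: "nat \<times> nat \<Rightarrow> real"
  assumes t: "t > 0"
    and F: "\<And>x y. \<bar>x\<bar> \<le> t \<Longrightarrow> \<bar>y\<bar> \<le> t \<Longrightarrow> ((\<lambda>(i,j). a (i,j) * (x^i * y^j)) has_sum F x y) UNIV"
    and x: "\<bar>x\<bar> < t" and y: "\<bar>y\<bar> \<le> t"
  shows "\<exists>d. ((\<lambda>x. F x y) has_real_derivative d) (at x) \<and>
             ((\<lambda>(i,j). real (Suc i) * a (Suc i, j) * (x^i * y^j)) has_sum d) UNIV"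
proof -
  have "(\<lambda>(i,j). a (i,j) * (t^i * t^j)) summable_on UNIV"
    using F[of t t] t by (auto intro: has_sum_imp_summable)
  then have S: "(\<lambda>(i,j). \<bar>a (i,j)\<bar> * (t^i * t^j)) summable_on UNIV"
    using t by (subst (asm) summable_on_iff_abs_summable_on_real) (simp add: case_prod_unfold abs_mult)
  \<comment> \<open>Summing over \<open>j\<close> first, with \<open>y\<close> fixed, leaves an
    ordinary power series in \<open>x\<close> with coefficients \<open>c i\<close>, to which
    termwise differentiation applies.\<close>
  define c where "c i = (\<Sum>\<^sub>\<infinity>j. a (i,j) * y^j)" for i
  have row: "((\<lambda>j. a (i,j) * y^j) has_sum c i) UNIV" for i
  proof -
    have "(\<lambda>(i,j). \<bar>a (i,j)\<bar> * (t^i * t^j)) summable_on Sigma UNIV (\<lambda>_. UNIV)"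
      using S by simp
    from summable_on_SigmaD1[OF this, of i]
    have "(\<lambda>j. t^i * (\<bar>a (i,j)\<bar> * t^j)) summable_on UNIV" by (simp add: mult_ac)
    then have "(\<lambda>j. \<bar>a (i,j)\<bar> * t^j) summable_on UNIV"
      using t by (subst (asm) summable_on_cmult_right') auto
    then have "(\<lambda>j. \<bar>a (i,j) * y^j\<bar>) summable_on UNIV"
      by (rule summable_on_comparison_test)
         (use y in \<open>auto simp: abs_mult power_abs intro!: mult_left_mono power_mono\<close>)
    then have "(\<lambda>j. a (i,j) * y^j) summable_on UNIV"
      by (subst summable_on_iff_abs_summable_on_real) simp
    then show ?thesis by (simp add: c_def)
  qed
  have sums: "(\<lambda>i. c i * x'^i) sums F x' y" if "\<bar>x'\<bar> \<le> t" for x'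
  proof -
    have 1: "((\<lambda>(i,j). a (i,j) * (x'^i * y^j)) has_sum F x' y) (Sigma UNIV (\<lambda>_. UNIV))"
      using F[OF that y] by simp
    have 2: "((\<lambda>j. (\<lambda>(i,j). a (i,j) * (x'^i * y^j)) (i,j)) has_sum c i * x'^i) UNIV" for i
      using has_sum_cmult_left[OF row[of i], of "x'^i"] by (simp add: mult_ac)
    show ?thesis
      using has_sum_SigmaD[OF 1 2] by (rule has_sum_imp_sums)
  qed
  define d where "d = (\<Sum>n. diffs c n * x^n)"
  have "DERIV (\<lambda>x. \<Sum>n. c n * x^n) x :> d"
    unfolding d_def using sums[of t] t x by (intro termdiffs_strong[of _ t]) (auto simp: sums_iff)
  then have D: "((\<lambda>x. F x y) has_real_derivative d) (at x)"
    by (rule has_field_derivative_transform_within_open[where S="{-t<..<t}"])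
       (use x sums in \<open>auto simp: sums_iff\<close>)
  \<comment> \<open>Since \<open>\<bar>x\<bar> < t\<close>, the factor \<open>i + 1\<close> produced
    by differentiation is absorbed: \<open>(i + 1) * \<bar>x\<bar>^i \<le> B * t^i\<close>. The
    series at the corner \<open>(t, t)\<close> then dominates the differentiated one.\<close>
  have "(\<lambda>n. of_nat n * (\<bar>x\<bar>/t)^n + (\<bar>x\<bar>/t)^n) \<longlonglongrightarrow> 0 + 0"
    using x t by (intro tendsto_add powser_times_n_limit_0 LIMSEQ_realpow_zero) auto
  then have "Bseq (\<lambda>n. real (Suc n) * (\<bar>x\<bar>/t)^n)"
    by (intro convergent_imp_Bseq convergentI) (auto simp: algebra_simps)
  then obtain B where B: "B > 0" "\<And>n. norm (real (Suc n) * (\<bar>x\<bar>/t)^n) \<le> B"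
    by (auto simp: Bseq_def)
  have B': "real (Suc n) * \<bar>x\<bar>^n \<le> B * t^n" for n
    using B(2)[of n] t by (simp add: power_divide field_simps abs_mult)
  have "(\<lambda>(i,j). \<bar>a (i,j)\<bar> * (t^i * t^j)) summable_on (map_prod Suc id ` UNIV)"
    using S by (rule summable_on_subset) auto
  then have "((\<lambda>(i,j). \<bar>a (i,j)\<bar> * (t^i * t^j)) \<circ> map_prod Suc id) summable_on UNIV"
    by (subst (asm) summable_on_reindex) (auto simp: inj_on_def)
  then have "(\<lambda>(i,j). \<bar>a (Suc i,j)\<bar> * (t^i * t^j) * t) summable_on UNIV"
    by (simp add: o_def case_prod_unfold map_prod_def mult_ac)
  then have S': "(\<lambda>(i,j). \<bar>a (Suc i,j)\<bar> * (t^i * t^j) * B) summable_on UNIV"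
    using t B unfolding case_prod_unfold by (subst (asm) summable_on_cmult_left') (auto intro: summable_on_cmult_left)
  have "(\<lambda>(i,j). \<bar>real (Suc i) * a (Suc i, j) * (x^i * y^j)\<bar>) summable_on UNIV"
  proof (rule summable_on_comparison_test[OF S'], safe)
    fix i j
    have "\<bar>real (Suc i) * a (Suc i, j) * (x^i * y^j)\<bar> = (real (Suc i) * \<bar>x\<bar>^i) * \<bar>y\<bar>^j * \<bar>a (Suc i, j)\<bar>"
      by (simp add: abs_mult power_abs del: of_nat_Suc)
    also have "\<dots> \<le> (B * t^i) * t^j * \<bar>a (Suc i, j)\<bar>"
      using y t B(1) by (intro mult_right_mono mult_mono B' power_mono) auto
    finally show "\<bar>real (Suc i) * a (Suc i, j) * (x^i * y^j)\<bar> \<le> \<bar>a (Suc i,j)\<bar> * (t^i * t^j) * B"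
      by (simp add: mult_ac)
  qed auto
  then have "(\<lambda>(i,j). real (Suc i) * a (Suc i, j) * (x^i * y^j)) summable_on UNIV"
    by (subst summable_on_iff_abs_summable_on_real) (simp add: case_prod_unfold)
  then obtain s where s: "((\<lambda>(i,j). real (Suc i) * a (Suc i, j) * (x^i * y^j)) has_sum s) UNIV"
    by (auto simp: summable_on_def)
  have "(\<lambda>i. real (Suc i) * c (Suc i) * x^i) sums s"
  proof (rule has_sum_imp_sums, rule has_sum_SigmaD)
    show "((\<lambda>(i,j). real (Suc i) * a (Suc i, j) * (x^i * y^j)) has_sum s) (Sigma UNIV (\<lambda>_. UNIV))"
      using s by simp
    show "((\<lambda>j. (\<lambda>(i,j). real (Suc i) * a (Suc i, j) * (x^i * y^j)) (i,j)) has_sum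
             real (Suc i) * c (Suc i) * x^i) UNIV" for i
      using has_sum_cmult_left[OF row[of "Suc i"], of "real (Suc i) * x^i"] by (simp add: mult_ac)
  qed
  then have "d = s" by (simp add: d_def diffs_def sums_iff mult_ac)
  with D s show ?thesis by auto
qed

lemma norm_plane_le: "norm (p :: plane) \<le> \<bar>p $ 1\<bar> + \<bar>p $ 2\<bar>"
  using norm_le_l1_cart[of p] by (simp add: sum_2)

lemma norm_plane: "norm (p :: plane) = sqrt ((p $ 1)\<^sup>2 + (p $ 2)\<^sup>2)"
  by (simp add: norm_vec_def L2_set_def sum_2)

lemma inner_plane: "(p :: plane) \<bullet> q = p $ 1 * q $ 1 + p $ 2 * q $ 2"
  by (simp add: inner_vec_def sum_2)

lemma plane_eq_iff: "(p :: plane) = q \<longleftrightarrow> p $ 1 = q $ 1 \<and> p $ 2 = q $ 2"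
  by (simp add: vec_eq_iff forall_2)

section \<open>Partial derivatives of analytic functions of two variables\<close>

definition pd1 :: "(plane \<Rightarrow> real) \<Rightarrow> plane \<Rightarrow> real" where
  "pd1 f p = deriv (\<lambda>x. f (vector [x, p $ 2])) (p $ 1)"

definition pd2 :: "(plane \<Rightarrow> real) \<Rightarrow> plane \<Rightarrow> real" where
  "pd2 f p = deriv (\<lambda>y. f (vector [p $ 1, y])) (p $ 2)"

lemma taylor_box:
  assumes "has_taylor_series f q a"
  shows "\<exists>t>0. \<forall>x y. \<bar>x\<bar> \<le> t \<longrightarrow> \<bar>y\<bar> \<le> t \<longrightarrow>
       ((\<lambda>(i,j). a (i,j) * (x^i * y^j)) has_sum f (vector [q $ 1 + x, q $ 2 + y])) UNIV"
proof -
  obtain r where r: "r > 0" "\<And>p. p \<in> ball q r \<Longrightarrow> ((\<lambda>\<alpha>. a \<alpha> * monomial (p - q) \<alpha>) has_sum f p) UNIV"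
    using assms by (auto simp: has_taylor_series_def)
  \<comment> \<open>The sum of the absolute coordinates is at most \<open>2 * r / 3 < r\<close>, so
    the closed box of half side \<open>r / 3\<close> lies in the open ball.\<close>
  have "((\<lambda>(i,j). a (i,j) * (x^i * y^j)) has_sum f (vector [q $ 1 + x, q $ 2 + y])) UNIV"
    if "\<bar>x\<bar> \<le> r/3" "\<bar>y\<bar> \<le> r/3" for x y
  proof -
    have "dist q (vector [q $ 1 + x, q $ 2 + y]) \<le> \<bar>x\<bar> + \<bar>y\<bar>"
      unfolding dist_norm by (rule order_trans[OF norm_plane_le]) simp
    with that r(1) have "vector [q $ 1 + x, q $ 2 + y] \<in> ball q r" by simp
    from r(2)[OF this] show ?thesis by (simp add: monomial_def case_prod_unfold)
  qed
  with r(1) show ?thesis by (intro exI[of _ "r/3"]) simp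
qed

text \<open>The derivative is computed on a whole ball around \<open>q\<close>, not only at
  \<open>q\<close>; the second claim can therefore be iterated to reach all higher partial
  derivatives.\<close>

lemma taylor_pd1:
  assumes "has_taylor_series f q a"
  shows "\<exists>r>0. \<forall>p\<in>ball q r. ((\<lambda>x. f (vector [x, p $ 2])) has_real_derivative pd1 f p) (at (p $ 1))"
    and "has_taylor_series (pd1 f) q (\<lambda>(i,j). real (Suc i) * a (Suc i, j))"
proof -
  obtain t where t: "t > 0" and F: "\<And>x y. \<bar>x\<bar> \<le> t \<Longrightarrow> \<bar>y\<bar> \<le> t \<Longrightarrow>
       ((\<lambda>(i,j). a (i,j) * (x^i * y^j)) has_sum f (vector [q $ 1 + x, q $ 2 + y])) UNIV"
    using taylor_box[OF assms] by blast
  have *: "((\<lambda>x. f (vector [x, p $ 2])) has_real_derivative pd1 f p) (at (p $ 1)) \<and>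
      ((\<lambda>\<alpha>. (\<lambda>(i,j). real (Suc i) * a (Suc i, j)) \<alpha> * monomial (p - q) \<alpha>) has_sum pd1 f p) UNIV"
    if "p \<in> ball q t" for p
  proof -
    have "\<bar>(p - q) $ 1\<bar> < t" "\<bar>(p - q) $ 2\<bar> < t"
      using that component_le_norm_cart[of "p - q"] by (auto simp: dist_norm norm_minus_commute intro: le_less_trans)
    then obtain d where
      d: "((\<lambda>x. f (vector [q $ 1 + x, q $ 2 + (p - q) $ 2])) has_real_derivative d) (at ((p - q) $ 1))"
         "((\<lambda>(i,j). real (Suc i) * a (Suc i, j) * (((p - q) $ 1)^i * ((p - q) $ 2)^j)) has_sum d) UNIV"
      using double_series_fst_derivative[OF t F, of "(p - q) $ 1" "(p - q) $ 2"] by force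
    from d(1) have "((\<lambda>x. f (vector [q $ 1 + x, q $ 2 + (p - q) $ 2])) has_real_derivative d) (at (p $ 1 + - q $ 1))"
      by simp
    from DERIV_shift[THEN iffD1, OF this]
    have D: "((\<lambda>x. f (vector [x, p $ 2])) has_real_derivative d) (at (p $ 1))" by simp
    then have "pd1 f p = d" unfolding pd1_def by (rule DERIV_imp_deriv)
    with D d(2) show ?thesis by (simp add: monomial_def case_prod_unfold)
  qed
  then show "\<exists>r>0. \<forall>p\<in>ball q r. ((\<lambda>x. f (vector [x, p $ 2])) has_real_derivative pd1 f p) (at (p $ 1))"
    and "has_taylor_series (pd1 f) q (\<lambda>(i,j). real (Suc i) * a (Suc i, j))"
    unfolding has_taylor_series_def using t by blast+
qed

text \<open>The reflection in the diagonal; conjugating with it turns facts on \<open>pd1\<close>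
  into facts on \<open>pd2\<close>.\<close>

definition flip :: "plane \<Rightarrow> plane" where "flip p = vector [p $ 2, p $ 1]"

lemma flip_simps [simp]: "flip p $ 1 = p $ 2" "flip p $ 2 = p $ 1" "flip (flip p) = p"
  by (simp_all add: flip_def plane_eq_iff)

lemma norm_flip: "norm (flip p) = norm p"
  by (simp add: norm_plane add.commute)

lemma flip_diff: "flip (p - q) = flip p - flip q"
  by (simp add: plane_eq_iff)

lemma taylor_flip:
  assumes "has_taylor_series f q a"
  shows "has_taylor_series (f \<circ> flip) (flip q) (a \<circ> prod.swap)"
proof -
  obtain r where r: "r > 0" "\<And>p. p \<in> ball q r \<Longrightarrow> ((\<lambda>\<alpha>. a \<alpha> * monomial (p - q) \<alpha>) has_sum f p) UNIV"
    using assms by (auto simp: has_taylor_series_def)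
  have "((\<lambda>\<alpha>. (a \<circ> prod.swap) \<alpha> * monomial (p - flip q) \<alpha>) has_sum (f \<circ> flip) p) UNIV"
    if "p \<in> ball (flip q) r" for p
  proof -
    have "norm (q - flip p) = norm (flip q - p)"
      by (metis flip_diff flip_simps(3) norm_flip)
    then have "flip p \<in> ball q r" using that by (simp add: dist_norm)
    from r(2)[OF this] have "((\<lambda>\<alpha>. a \<alpha> * monomial (flip p - q) \<alpha>) has_sum f (flip p)) UNIV" .
    then have "((\<lambda>\<alpha>. a \<alpha> * monomial (flip p - q) \<alpha>) \<circ> prod.swap has_sum f (flip p)) UNIV"
      by (subst has_sum_reindex[symmetric]) auto
    then show ?thesis by (simp add: o_def monomial_def mult.commute)
  qed
  with r(1) show ?thesis unfolding has_taylor_series_def by blast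
qed

lemma pd2_flip: "pd2 f p = (pd1 (f \<circ> flip) \<circ> flip) p"
  by (simp add: pd1_def pd2_def flip_def)

lemma taylor_pd2:
  assumes "has_taylor_series f q a"
  shows "\<exists>r>0. \<forall>p\<in>ball q r. ((\<lambda>y. f (vector [p $ 1, y])) has_real_derivative pd2 f p) (at (p $ 2))"
    and "has_taylor_series (pd2 f) q (\<lambda>(i,j). real (Suc j) * a (i, Suc j))"
proof -
  note T = taylor_pd1[OF taylor_flip[OF assms]]
  obtain r where r: "r > 0" "\<And>p. p \<in> ball (flip q) r \<Longrightarrow>
      ((\<lambda>x. (f \<circ> flip) (vector [x, p $ 2])) has_real_derivative pd1 (f \<circ> flip) p) (at (p $ 1))"
    using T(1) by blast
  have "((\<lambda>y. f (vector [p $ 1, y])) has_real_derivative pd2 f p) (at (p $ 2))" if "p \<in> ball q r" for p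
  proof -
    have "flip p \<in> ball (flip q) r" using that by (simp add: dist_norm flip_diff[symmetric] norm_flip)
    from r(2)[OF this] show ?thesis by (simp add: flip_def pd1_def pd2_def)
  qed
  with r(1) show "\<exists>r>0. \<forall>p\<in>ball q r. ((\<lambda>y. f (vector [p $ 1, y])) has_real_derivative pd2 f p) (at (p $ 2))"
    by blast
  have "pd2 f = pd1 (f \<circ> flip) \<circ> flip" by (rule ext) (rule pd2_flip)
  moreover have "(\<lambda>(i,j). real (Suc i) * (a \<circ> prod.swap) (Suc i, j)) \<circ> prod.swap = (\<lambda>(i,j). real (Suc j) * a (i, Suc j))"
    by auto
  ultimately show "has_taylor_series (pd2 f) q (\<lambda>(i,j). real (Suc j) * a (i, Suc j))"
    using taylor_flip[OF T(2)] by simp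
qed

text \<open>Applied to differentiated series, this reads iterated partial derivatives at the centre
  off the coefficients.\<close>

lemma taylor_center:
  assumes "has_taylor_series f q a"
  shows "f q = a (0,0)"
proof -
  have "((\<lambda>\<alpha>. a \<alpha> * monomial (q - q) \<alpha>) has_sum f q) UNIV"
    using assms unfolding has_taylor_series_def by (metis centre_in_ball)
  moreover have "((\<lambda>\<alpha>. a \<alpha> * monomial (q - q) \<alpha>) has_sum a (0,0)) UNIV"
    by (rule has_sum_finite_neutralI[of "{(0,0)}"]) (auto simp: monomial_def power_0_left)
  ultimately show ?thesis by (rule has_sum_unique)
qed

text \<open>Weierstrass M-test: on the ball the terms are dominated by their absolute values at the
  corner \<open>(t, t)\<close>.\<close>

lemma taylor_isCont:
  assumes "has_taylor_series f q a"
  shows "isCont f q"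
proof -
  obtain t where t: "t > 0" and F: "\<And>x y. \<bar>x\<bar> \<le> t \<Longrightarrow> \<bar>y\<bar> \<le> t \<Longrightarrow>
       ((\<lambda>(i,j). a (i,j) * (x^i * y^j)) has_sum f (vector [q $ 1 + x, q $ 2 + y])) UNIV"
    using taylor_box[OF assms] by blast
  have "(\<lambda>(i,j). a (i,j) * (t^i * t^j)) summable_on UNIV"
    using F[of t t] t by (auto intro: has_sum_imp_summable)
  then have S: "(\<lambda>(i,j). \<bar>a (i,j)\<bar> * (t^i * t^j)) summable_on UNIV"
    using t by (subst (asm) summable_on_iff_abs_summable_on_real) (simp add: case_prod_unfold abs_mult)
  have cmp: "\<bar>(p - q) $ 1\<bar> \<le> t" "\<bar>(p - q) $ 2\<bar> \<le> t" if "p \<in> ball q t" for p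
    using that component_le_norm_cart[of "p - q"]
    by (auto simp: dist_norm norm_minus_commute intro: order_trans less_imp_le)
  have "uniform_limit (ball q t)
          (\<lambda>X p. \<Sum>\<alpha>\<in>X. (\<lambda>(i,j). a (i,j) * (((p - q) $ 1)^i * ((p - q) $ 2)^j)) \<alpha>) f
          (finite_subsets_at_top UNIV)"
  proof (rule Weierstrass_m_test_general'[OF _ _ S])
    fix \<alpha> p assume "p \<in> ball q t"
    with cmp[OF this] t show "norm ((\<lambda>(i,j). a (i,j) * (((p - q) $ 1)^i * ((p - q) $ 2)^j)) \<alpha>)
        \<le> (\<lambda>(i,j). \<bar>a (i,j)\<bar> * (t^i * t^j)) \<alpha>"
      by (auto simp: case_prod_unfold abs_mult power_abs simp del: vector_minus_component intro!: mult_left_mono mult_mono power_mono)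
  next
    fix p assume "p \<in> ball q t"
    have "vector [q $ 1 + (p - q) $ 1, q $ 2 + (p - q) $ 2] = p" by (simp add: plane_eq_iff)
    with F[OF cmp[OF \<open>p \<in> ball q t\<close>]]
    show "((\<lambda>\<alpha>. (\<lambda>(i,j). a (i,j) * (((p - q) $ 1)^i * ((p - q) $ 2)^j)) \<alpha>) has_sum f p) UNIV"
      by simp
  qed
  then have "continuous_on (ball q t) f"
    by (rule uniform_limit_theorem[rotated])
       (auto intro!: always_eventually continuous_intros simp: case_prod_unfold)
  then show ?thesis using t by (simp add: continuous_on_eq_continuous_at)
qed

lemma real_analytic_on_pd:
  assumes "real_analytic_on f S"
  shows "real_analytic_on (pd1 f) S" "real_analytic_on (pd2 f) S"
  using assms taylor_pd1(2) taylor_pd2(2) unfolding real_analytic_on_def by blast+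

lemma real_analytic_on_continuous_on:
  "real_analytic_on f S \<Longrightarrow> continuous_on S f"
  unfolding real_analytic_on_def
  by (meson continuous_at_imp_continuous_on taylor_isCont)

text \<open>Both mixed derivatives are the coefficient \<open>a (1,1)\<close> of the series at
  \<open>p\<close>.\<close>

lemma real_analytic_on_pd_commute:
  assumes "real_analytic_on f S" "p \<in> S"
  shows "pd1 (pd2 f) p = pd2 (pd1 f) p"
proof -
  obtain a where a: "has_taylor_series f p a" using assms by (auto simp: real_analytic_on_def)
  show ?thesis
    using taylor_center[OF taylor_pd1(2)[OF taylor_pd2(2)[OF a]]]
          taylor_center[OF taylor_pd2(2)[OF taylor_pd1(2)[OF a]]] by simp
qed

text \<open>The criterion behind this asks for a derivative in the first variable at the point and a
  derivative in the second one that is continuous on a product neighbourhood. Hence the intervals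
  \<open>X\<close> and \<open>Y\<close>, whose product corresponds to a square inside
  \<open>S\<close>.\<close>

lemma real_analytic_on_has_derivative:
  assumes an: "real_analytic_on f S" and S: "open S" "p \<in> S"
  shows "(f has_derivative (\<lambda>h. pd1 f p * h $ 1 + pd2 f p * h $ 2)) (at p)"
proof -
  obtain e' where e': "e' > 0" "ball p e' \<subseteq> S" using S by (rule openE)
  define e where "e = e'/2"
  have e: "e > 0" "ball p (2*e) \<subseteq> S" using e' by (auto simp: e_def)
  define X where "X = ball (p $ 1) e"
  define Y where "Y = ball (p $ 2) e"
  have XY: "vector [x, y] \<in> S" if "x \<in> X" "y \<in> Y" for x y
  proof -
    have "dist p (vector [x, y]) \<le> \<bar>p $ 1 - x\<bar> + \<bar>p $ 2 - y\<bar>"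
      unfolding dist_norm by (rule order_trans[OF norm_plane_le]) simp
    also have "\<dots> < 2*e" using that by (simp add: X_def Y_def dist_real_def)
    finally show ?thesis using e(2) by auto
  qed
  have p12: "vector [u $ 1, u $ 2] = u" for u :: plane by (simp add: plane_eq_iff)
  have d1: "((\<lambda>x. f (vector [x, u $ 2])) has_real_derivative pd1 f u) (at (u $ 1))" if "u \<in> S" for u
    using taylor_pd1(1)[of f u] that an unfolding real_analytic_on_def by (meson centre_in_ball)
  have d2: "((\<lambda>y. f (vector [u $ 1, y])) has_real_derivative pd2 f u) (at (u $ 2))" if "u \<in> S" for u
    using taylor_pd2(1)[of f u] that an unfolding real_analytic_on_def by (meson centre_in_ball)
  have vc: "continuous_on UNIV (\<lambda>(x,y). vector [x,y] :: plane)"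
  proof -
    have "(\<lambda>(x,y). vector [x,y] :: plane) = (\<lambda>z. \<chi> i. if i = 1 then fst z else snd z)"
      by (auto simp: fun_eq_iff plane_eq_iff)
    moreover have "continuous_on UNIV (\<lambda>z :: real \<times> real. (\<chi> i. if i = 1 then fst z else snd z) :: plane)"
    proof (rule continuous_on_vec_lambda)
      show "continuous_on UNIV (\<lambda>z :: real \<times> real. if i = 1 then fst z else snd z)" for i :: 2
        by (cases "i = 1") (auto intro!: continuous_intros)
    qed
    ultimately show ?thesis by simp
  qed
  have c2: "continuous_on (X \<times> Y) (\<lambda>(x,y). pd2 f (vector [x,y]))"
  proof -
    have img: "(\<lambda>z. vector [fst z, snd z]) ` (X \<times> Y) \<subseteq> S" using XY by auto
    have "continuous_on (X \<times> Y) (\<lambda>z. vector [fst z, snd z] :: plane)"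
      using continuous_on_subset[OF vc] by (simp add: case_prod_unfold)
    from continuous_on_compose2[OF real_analytic_on_continuous_on[OF real_analytic_on_pd(2)[OF an]] this img]
    show ?thesis by (simp add: case_prod_unfold)
  qed
  have mem: "(p $ 1, p $ 2) \<in> X \<times> Y" unfolding X_def Y_def using e(1) by (intro SigmaI) (simp_all only: centre_in_ball)
  have mc: "(\<lambda>v. v * c) = (*) c" for c :: real by (simp add: fun_eq_iff)
  have fx: "((\<lambda>x. f (vector [x, p $ 2])) has_derivative (\<lambda>tx. tx * pd1 f p)) (at (p $ 1) within X)"
    using has_derivative_at_withinI[OF d1[OF S(2), unfolded has_field_derivative_def]] unfolding mc .
  have fy: "((\<lambda>y. f (vector [x, y])) has_derivative blinfun_mult_left (pd2 f (vector [x, y]))) (at y within Y)"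
    if "x \<in> X" "y \<in> Y" for x y
    using has_derivative_at_withinI[OF d2[OF XY[OF that], unfolded has_field_derivative_def], of Y]
    by (simp add: mc blinfun_mult_left.rep_eq)
  have "continuous_on (X \<times> Y) (\<lambda>(x, y). blinfun_mult_left (pd2 f (vector [x, y])))"
    using c2 by (auto simp: case_prod_unfold intro!: continuous_intros)
  then have fc: "continuous (at (p $ 1, p $ 2) within X \<times> Y) (\<lambda>(x, y). blinfun_mult_left (pd2 f (vector [x, y])))"
    using mem by (simp add: continuous_on_eq_continuous_within)
  have "p $ 2 \<in> Y" "convex Y" using mem by (auto simp: Y_def)
  note has_derivative_partialsI[where f="\<lambda>x y. f (vector [x,y])" and fx="\<lambda>tx. tx * pd1 f p"
      and fy="\<lambda>x y. blinfun_mult_left (pd2 f (vector [x, y]))", OF fx fy fc this]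
  moreover have "at (p $ 1, p $ 2) within X \<times> Y = at (p $ 1, p $ 2)"
    using mem by (intro at_within_open) (auto simp: X_def Y_def intro!: open_Times)
  ultimately have D: "((\<lambda>(x, y). f (vector [x,y])) has_derivative
      (\<lambda>(tx, ty). tx * pd1 f p + ty * pd2 f p)) (at (p $ 1, p $ 2))"
    by (simp add: p12)
  have "((\<lambda>u :: plane. (u $ 1, u $ 2)) has_derivative (\<lambda>h. (h $ 1, h $ 2))) (at p)"
    by (intro has_derivative_Pair bounded_linear_imp_has_derivative bounded_linear_vec_nth)
  from has_derivative_compose[OF this D]
  show ?thesis by (simp add: p12 mult.commute)
qed

section \<open>The fundamental theorem of calculus for Lipschitz functions\<close>

text \<open>A gauge argument. At tags outside \<open>N\<close> the increment of \<open>f\<close>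
  over a small interval is close to the derivative times the length. At tags in \<open>N\<close> the
  integrand is replaced by 0 and the increment is at most \<open>L\<close> times the length; since
  the indicator of \<open>N\<close> has integral 0, a finer gauge makes these lengths add up to
  little.\<close>

lemma has_integral_lipschitz_derivative:
  fixes f :: "real \<Rightarrow> 'a::banach"
  assumes "a \<le> b" and lip: "L-lipschitz_on {a..b} f" and N: "negligible N"
    and vecd: "\<And>x. x \<in> {a..b} - N \<Longrightarrow> (f has_vector_derivative f' x) (at x within {a..b})"
  shows "(f' has_integral (f b - f a)) {a..b}"
proof -
  define g where "g x = (if x \<in> N then 0 else f' x)" for x
  have L: "L \<ge> 0" using lip by (rule lipschitz_on_nonneg)
  have ind: "(indicat_real N has_integral 0) (cbox a b)" using N by (simp add: negligible_def)
  have "(g has_integral (f b - f a)) {a..b}"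
    unfolding has_integral_factor_content box_real[symmetric]
  proof safe
    fix e :: real
    assume "e > 0"
    define e1 where "e1 = e/2"
    \<comment> \<open>\<open>L + 1\<close> in place of \<open>L\<close> allows \<open>L = 0\<close>;
      the choice gives \<open>e1 + L * e2 \<le> e\<close>.\<close>
    define e2 where "e2 = e/(2*(L+1))"
    have e12: "e1 > 0" "e2 > 0" "e1 + L*e2 \<le> e"
      using \<open>e > 0\<close> L by (auto simp: e1_def e2_def field_simps)
    have "\<forall>x. \<exists>d>0. x \<in> {a..b} - N \<longrightarrow>
         (\<forall>y\<in>{a..b}. norm (y-x) < d \<longrightarrow> norm (f y - f x - (y-x) *\<^sub>R f' x) \<le> e1 * norm (y-x))"
      using vecd[unfolded has_vector_derivative_def has_derivative_within_alt] e12(1) by blast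
    then obtain d where d: "\<And>x. 0 < d x"
      "\<And>x y. \<lbrakk>x \<in> {a..b} - N; y \<in> {a..b}; norm (y-x) < d x\<rbrakk>
                        \<Longrightarrow> norm (f y - f x - (y-x) *\<^sub>R f' x) \<le> e1 * norm (y-x)"
      by metis
    from ind[unfolded has_integral_factor_content, rule_format, OF e12(2)]
    obtain \<gamma> where \<gamma>: "gauge \<gamma>" "\<forall>p. p tagged_division_of cbox a b \<and> \<gamma> fine p \<longrightarrow>
        norm ((\<Sum>(x,k)\<in>p. measure lborel k *\<^sub>R indicat_real N x) - 0) \<le> e2 * measure lborel (cbox a b)"
      by (elim exE conjE)
    show "\<exists>d. gauge d \<and> (\<forall>p. p tagged_division_of (cbox a b) \<and> d fine p \<longrightarrow>
      norm ((\<Sum>(x, k)\<in>p. measure lborel k *\<^sub>R g x) - (f b - f a)) \<le> e * measure lborel (cbox a b))"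
    proof (rule exI[of _ "\<lambda>x. \<gamma> x \<inter> ball x (d x)"], safe)
      show "gauge (\<lambda>x. \<gamma> x \<inter> ball x (d x))"
        using d(1) \<gamma>(1) gauge_ball_dependent by (intro gauge_Int) auto
    next
      fix p
      assume ptag: "p tagged_division_of cbox a b" and fin: "(\<lambda>x. \<gamma> x \<inter> ball x (d x)) fine p"
      have fine1: "\<gamma> fine p" and finep: "(\<lambda>x. ball x (d x)) fine p"
        using fin by (simp_all add: fine_Int)
      have ba: "b - a = (\<Sum>(x,K)\<in>p. Sup K - Inf K)" "f b - f a = (\<Sum>(x,K)\<in>p. f(Sup K) - f(Inf K))"
        using additive_tagged_division_1[where f= "\<lambda>x. x"] additive_tagged_division_1[where f= f]
              \<open>a \<le> b\<close> ptag by auto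
      have "norm (\<Sum>(x, K) \<in> p. (measure lborel K *\<^sub>R g x) - (f (Sup K) - f (Inf K)))
            \<le> (\<Sum>n\<in>p. e1 * (case n of (x, k) \<Rightarrow> Sup k - Inf k)
                 + L * (case n of (x, k) \<Rightarrow> measure lborel k *\<^sub>R indicat_real N x))"
      proof (rule sum_norm_le)
        fix n assume "n \<in> p"
        then obtain x K where n: "n = (x, K)" and xK: "(x, K) \<in> p" by (cases n) auto
        then obtain u v where k: "K = cbox u v" and "x \<in> K" and kab: "K \<subseteq> cbox a b"
          using ptag tagged_division_ofD(2-4) by metis
        then have "u \<le> v" by auto
        then have uv: "u \<in> K" "v \<in> K" by (simp_all add: k)
        have "norm (measure lborel K *\<^sub>R g x - (f (Sup K) - f (Inf K)))
            \<le> e1 * (Sup K - Inf K) + L * (measure lborel K *\<^sub>R indicat_real N x)"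
        proof (cases "x \<in> N")
          case True
          have "dist (f v) (f u) \<le> L * dist v u"
            using uv kab by (intro lipschitz_onD[OF lip]) auto
          moreover have "0 \<le> e1 * (v - u)" using e12(1) \<open>u \<le> v\<close> by simp
          ultimately show ?thesis using True \<open>u \<le> v\<close>
            by (simp add: g_def k dist_norm norm_minus_commute)
        next
          case False
          have ball: "y \<in> ball x (d x)" if "y \<in> K" for y
            using finep xK that by blast
          have bound: "norm (f y - f x - (y-x) *\<^sub>R f' x) \<le> e1 * norm (y-x)" if "y \<in> K" for y
            using False \<open>x \<in> K\<close> that kab ball[OF that] by (intro d(2)) (auto simp: dist_real_def)
          have "norm ((v - u) *\<^sub>R f' x - (f v - f u))
              = norm (f u - f x - (u - x) *\<^sub>R f' x - (f v - f x - (v - x) *\<^sub>R f' x))"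
            by (auto simp: algebra_simps)
          also have "\<dots> \<le> e1 * norm (u-x) + e1 * norm (v-x)"
            using norm_triangle_ineq4 add_mono[OF bound[OF uv(1)] bound[OF uv(2)]] order_trans by blast
          also have "\<dots> = e1 * (v - u)"
            using \<open>x \<in> K\<close> by (auto simp: k algebra_simps)
          finally show ?thesis using False \<open>u \<le> v\<close> by (simp add: g_def k)
        qed
        then show "norm (case n of (x, K) \<Rightarrow> measure lborel K *\<^sub>R g x - (f (Sup K) - f (Inf K)))
            \<le> e1 * (case n of (x, k) \<Rightarrow> Sup k - Inf k)
               + L * (case n of (x, k) \<Rightarrow> measure lborel k *\<^sub>R indicat_real N x)" by (simp add: n)
      qed
      also have "\<dots> = e1 * (b - a) + L * (\<Sum>(x,k)\<in>p. measure lborel k *\<^sub>R indicat_real N x)"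
        by (simp add: ba(1) sum.distrib sum_distrib_left)
      also have "\<dots> \<le> e1 * (b - a) + L * (e2 * (b - a))"
        using \<gamma>(2)[rule_format, OF conjI, OF ptag fine1] L \<open>a \<le> b\<close> by (intro add_left_mono mult_left_mono) auto
      also have "\<dots> = (e1 + L*e2) * (b - a)" by (simp add: algebra_simps)
      also have "\<dots> \<le> e * measure lborel (cbox a b)"
        using e12 \<open>a \<le> b\<close> by (simp add: mult_right_mono)
      finally show "norm ((\<Sum>(x, k)\<in>p. measure lborel k *\<^sub>R g x) - (f b - f a)) \<le> e * measure lborel (cbox a b)"
        by (simp add: ba(2) sum_subtractf[symmetric] split_def)
    qed
  qed
  then show ?thesis
    by (rule has_integral_spike[OF N, rotated]) (auto simp: g_def)
qed

text \<open>A bi-Lipschitz \<open>F\<close> with \<open>F y - F x \<ge> y - x\<close> pushes Lebesgue measure forward (along its inverse)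
  to an absolutely continuous measure; its density is the derivative of \<open>F\<close>.\<close>

lemma bilipschitz_has_density:
  fixes F :: "real \<Rightarrow> real"
  assumes lip: "L-lipschitz_on UNIV F" and exp: "\<And>x y. x \<le> y \<Longrightarrow> y - x \<le> F y - F x"
  obtains h where "\<And>x y. x \<le> y \<Longrightarrow> (h has_integral (F y - F x)) {x..y}"
proof -
  have cont: "continuous_on UNIV F" using lip by (rule lipschitz_on_continuous_on)
  have mono: "strict_mono F" using exp by (intro strict_monoI) (smt (verit))
  have inj: "inj F" using mono by (rule strict_mono_imp_inj_on)
  have surj: "\<exists>x. F x = c" for c
  proof -
    define m where "m = \<bar>c - F 0\<bar>"
    have m: "0 \<le> m" "F 0 - m \<le> c" "c \<le> F 0 + m" by (auto simp: m_def)
    have "F (-m) \<le> c" "c \<le> F m" using exp[of 0 m] exp[of "-m" 0] m by auto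
    then show ?thesis using IVT'[of F "-m" c m] m(1) continuous_on_subset[OF cont] by auto
  qed
  define G where "G = inv F"
  have GF [simp]: "G (F x) = x" for x using inj by (simp add: G_def)
  have FG [simp]: "F (G x) = x" for x using surj by (metis G_def f_inv_into_f rangeI)
  have vim: "G -` A = F ` A" for A by (auto simp: image_iff) (metis FG)
  \<comment> \<open>Monotonicity makes \<open>G\<close> Borel measurable, so images of Borel sets
    under \<open>F\<close>, being preimages under \<open>G\<close>, are Borel as well.\<close>
  have "mono G"
    by (rule monoI) (metis FG mono not_le strict_monoD)
  then have G: "G \<in> borel_measurable borel" by (rule borel_measurable_mono)
  define \<mu> where "\<mu> = distr lborel borel G"
  have \<mu>: "emeasure \<mu> A = emeasure lborel (F ` A)" if "A \<in> sets borel" for A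
    using that G by (simp add: \<mu>_def emeasure_distr vim)
  \<comment> \<open>Lipschitz maps send null sets to null sets, so \<mu> vanishes on null sets and
    has a Radon-Nikodym density.\<close>
  have "absolutely_continuous lborel \<mu>"
    unfolding absolutely_continuous_def
  proof
    fix A :: "real set" assume A: "A \<in> null_sets lborel"
    then have Ab: "A \<in> sets borel" by auto
    have "A \<in> null_sets lebesgue" using A by (rule null_sets_completionI)
    then have "negligible A" by (simp add: negligible_iff_null_sets)
    then have "negligible (F ` A)"
    proof (rule negligible_locally_Lipschitz_image[rotated])
      show "\<exists>T B. open T \<and> x \<in> T \<and> (\<forall>y\<in>A \<inter> T. norm (F y - F x) \<le> B * norm (y - x))" for x
        using lipschitz_onD[OF lip] by (intro exI[of _ UNIV] exI[of _ L]) (auto simp: dist_norm)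
    qed simp
    then have "F ` A \<in> null_sets lebesgue" by (simp add: negligible_iff_null_sets)
    moreover have "F ` A \<in> sets borel" using measurable_sets_borel[OF G Ab] by (simp add: vim)
    ultimately have "emeasure lborel (F ` A) = 0"
      by (simp add: null_sets_completion_iff null_setsD1)
    then show "A \<in> null_sets \<mu>" using Ab \<mu>[OF Ab] by (auto simp: null_sets_def \<mu>_def)
  qed
  then have dens: "density lborel (RN_deriv lborel \<mu>) = \<mu>"
    by (intro sigma_finite_measure.density_RN_deriv[OF sigma_finite_lborel]) (auto simp: \<mu>_def)
  define h where "h = RN_deriv lborel \<mu>"
  have hm: "h \<in> borel_measurable borel" by (simp add: h_def)
  have "((\<lambda>x. enn2real (h x)) has_integral (F y - F x)) {x..y}" if xy: "x \<le> y" for x y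
  proof -
    have "F ` {x..y} = {F x..F y}"
    proof (intro equalityI subsetI)
      fix z assume "z \<in> {F x..F y}"
      then have "G z \<in> {x..y}" using \<open>mono G\<close> by (metis GF atLeastAtMost_iff monoD)
      then show "z \<in> F ` {x..y}" by (metis FG imageI)
    qed (use mono in \<open>auto simp: strict_mono_less_eq\<close>)
    moreover have Fxy: "F x \<le> F y" using exp[OF xy] xy by simp
    ultimately have "emeasure (density lborel h) {x..y} = ennreal (F y - F x)"
      using \<mu>[of "{x..y}"] dens by (simp add: h_def)
    then have I: "(\<integral>\<^sup>+t. h t * indicator {x..y} t \<partial>lborel) = ennreal (F y - F x)"
      using hm by (subst (asm) emeasure_density) auto
    \<comment> \<open>The density takes extended real values; its finite integral over the interval
      makes it finite almost everywhere there, so passing to \<open>enn2real\<close> keeps the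
      integral.\<close>
    then have "AE t in lborel. h t * indicator {x..y} t \<noteq> \<infinity>"
      using hm by (intro nn_integral_noteq_infinite) auto
    then have "AE t in lborel. h t * indicator {x..y} t = ennreal (indicator {x..y} t * enn2real (h t))"
      by eventually_elim (auto simp: indicator_def top.not_eq_extremum)
    then have "(\<integral>\<^sup>+t. ennreal (indicator {x..y} t * enn2real (h t)) \<partial>lborel) = ennreal (F y - F x)"
      using I nn_integral_cong_AE by metis
    then have "((\<lambda>t. indicator {x..y} t * enn2real (h t)) has_integral (F y - F x)) UNIV"
      using hm Fxy by (intro nn_integral_has_integral) auto
    then have "((\<lambda>t. if t \<in> {x..y} then enn2real (h t) else 0) has_integral (F y - F x)) UNIV"
      by (rule has_integral_eq[rotated]) (simp add: indicator_def)
    then show ?thesis by (simp only: has_integral_restrict_UNIV)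
  qed
  then show thesis by (rule that)
qed

text \<open>Lebesgue differentiation for averages over boxes with lower corner \<open>x\<close>,
  that is over \<open>{x..x+r}\<close>. They see only the right of \<open>x\<close>; left
  derivatives are obtained from this by reflection.\<close>

lemma right_derivative_of_integral:
  fixes F h :: "real \<Rightarrow> real"
  assumes "\<And>x y. x \<le> y \<Longrightarrow> (h has_integral (F y - F x)) {x..y}"
  obtains N where "negligible N" "\<And>x. x \<notin> N \<Longrightarrow> (F has_real_derivative h x) (at_right x)"
proof -
  have "h integrable_on cbox a b" for a b
    using assms[of a b] by (cases "a \<le> b") (auto simp: integrable_on_def)
  then obtain N where N: "negligible N" "\<And>x e. \<lbrakk>x \<notin> N; 0 < e\<rbrakk> \<Longrightarrow>
               \<exists>d>0. \<forall>r. 0 < r \<and> r < d \<longrightarrow>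
                         norm(integral (cbox x (x + r *\<^sub>R One)) h /\<^sub>R r ^ DIM(real) - h x) < e"
    using integrable_ccontinuous_explicit[of h] by blast
  have "(F has_real_derivative h x) (at_right x)" if "x \<notin> N" for x
    unfolding has_field_derivative_iff tendsto_iff
  proof (intro allI impI)
    fix e :: real assume "e > 0"
    from N(2)[OF that this] obtain d where d: "d > 0" "\<And>r. 0 < r \<Longrightarrow> r < d \<Longrightarrow>
        norm(integral {x..x+r} h /\<^sub>R r - h x) < e" by auto
    have "dist ((F y - F x) / (y - x)) (h x) < e" if "x < y" "y < x + d" for y
      using d(2)[of "y - x"] that integral_unique[OF assms[of x y]]
      by (simp add: dist_real_def divide_inverse mult.commute)
    then show "\<forall>\<^sub>F y in at_right x. dist ((F y - F x) / (y - x)) (h x) < e"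
      using d(1) unfolding eventually_at_right_field by (intro exI[of _ "x + d"]) auto
  qed
  with N(1) that show thesis by blast
qed

text \<open>Adding \<open>(L + 1) * x\<close> makes \<open>f\<close> expanding and hence an integral
  of a density \<open>h\<close>. Right derivatives of \<open>F\<close> and of its reflection exist
  almost everywhere and are given by the same \<open>h\<close>, so the two one-sided derivatives of
  \<open>F\<close> agree.\<close>

lemma lipschitz_differentiable_ae_UNIV:
  fixes f :: "real \<Rightarrow> real"
  assumes lip: "L-lipschitz_on UNIV f"
  obtains N where "negligible N" "\<And>x. x \<notin> N \<Longrightarrow> f differentiable (at x)"
proof -
  have L: "L \<ge> 0" using lip by (rule lipschitz_on_nonneg)
  define F where "F x = f x + (L + 1) * x" for x
  have "(L + (L+1))-lipschitz_on UNIV F"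
    unfolding F_def using L by (intro lipschitz_intros lip) (auto intro!: lipschitz_onI simp: dist_real_def abs_mult simp flip: right_diff_distrib)
  moreover have "y - x \<le> F y - F x" if "x \<le> y" for x y
    using lipschitz_onD[OF lip, of x y] that by (auto simp: F_def dist_real_def algebra_simps)
  ultimately obtain h where h: "\<And>x y. x \<le> y \<Longrightarrow> (h has_integral (F y - F x)) {x..y}"
    by (rule bilipschitz_has_density) blast+
  obtain N1 where N1: "negligible N1" "\<And>x. x \<notin> N1 \<Longrightarrow> (F has_real_derivative h x) (at_right x)"
    using right_derivative_of_integral[OF h] by blast
  have h': "((\<lambda>t. h (- t)) has_integral (- F (- y) - - F (- x))) {x..y}" if "x \<le> y" for x y
    using h[of "-y" "-x"] that has_integral_reflect_real[where a="-y" and b="-x" and f=h] by simp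
  obtain N2 where N2: "negligible N2" "\<And>x. x \<notin> N2 \<Longrightarrow> ((\<lambda>t. - F (- t)) has_real_derivative h (- x)) (at_right x)"
    using right_derivative_of_integral[OF h'] by blast
  define N where "N = N1 \<union> uminus ` N2"
  have "negligible (uminus ` N2)"
    by (rule negligible_locally_Lipschitz_image[OF _ N2(1)])
       (auto intro!: exI[of _ "UNIV :: real set"] exI[of _ "1 :: real"] simp: dist_norm norm_minus_commute)
  then have "negligible N" using N1(1) by (simp add: N_def)
  moreover have "f differentiable (at x)" if "x \<notin> N" for x
  proof -
    have 1: "(F has_real_derivative h x) (at_right x)" using that by (simp add: N_def N1(2))
    have "- x \<notin> N2" using that unfolding N_def by (metis UnI2 image_eqI minus_minus)
    from N2(2)[OF this] have "((\<lambda>t. - F (- t)) has_real_derivative h x) (at_right (- x))" by simp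
    then have "((\<lambda>y. (- F (- y) - - F x) / (y - - x)) \<longlongrightarrow> h x) (at_right (- x))"
      by (simp add: has_field_derivative_iff)
    then have "((\<lambda>y. (F y - F x) / (y - x)) \<longlongrightarrow> h x) (at_left x)"
      unfolding at_left_minus[of x] filterlim_filtermap
      by (rule Lim_transform_eventually)
         (auto simp: divide_simps intro!: always_eventually, simp add: algebra_simps)
    then have 2: "(F has_real_derivative h x) (at_left x)" by (simp add: has_field_derivative_iff)
    have "(F has_real_derivative h x) (at x)"
      using 1 2 unfolding has_field_derivative_iff by (rule filterlim_split_at[rotated])
    then have "((\<lambda>x. F x - (L+1) * x) has_real_derivative h x - (L + 1)) (at x)"
      by (auto intro!: derivative_eq_intros)
    then show ?thesis by (auto simp: F_def real_differentiable_def)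
  qed
  ultimately show thesis by (rule that)
qed

lemma lipschitz_differentiable_ae:
  fixes f :: "real \<Rightarrow> real"
  assumes lip: "L-lipschitz_on {a..b} f"
  obtains N where "negligible N" "\<And>x. x \<in> {a..b} - N \<Longrightarrow> f differentiable (at x within {a..b})"
proof (cases "a < b")
  case True
  \<comment> \<open>Clamping the argument to the interval extends \<open>f\<close> to the line with
    the same Lipschitz constant.\<close>
  define g where "g x = f (max a (min b x))" for x
  have "L-lipschitz_on UNIV g"
  proof (rule lipschitz_onI)
    fix x y :: real
    have "dist (g x) (g y) \<le> L * dist (max a (min b x)) (max a (min b y))"
      unfolding g_def using True by (intro lipschitz_onD[OF lip]) auto
    also have "\<dots> \<le> L * dist x y"
      using lipschitz_on_nonneg[OF lip] by (intro mult_left_mono) (auto simp: dist_real_def)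
    finally show "dist (g x) (g y) \<le> L * dist x y" .
  qed (rule lipschitz_on_nonneg[OF lip])
  then obtain N where N: "negligible N" "\<And>x. x \<notin> N \<Longrightarrow> g differentiable (at x)"
    using lipschitz_differentiable_ae_UNIV by blast
  have "f differentiable (at x within {a..b})" if "x \<in> {a..b} - N" for x
  proof -
    have "g differentiable (at x within {a..b})" using N(2) that by (auto intro: differentiable_at_withinI)
    then show ?thesis
      by (rule differentiable_transform_within[where d=1]) (use that in \<open>auto simp: g_def\<close>)
  qed
  with N(1) that show thesis by blast
next
  case False
  then have "{a..b} \<subseteq> {a}" by auto
  then have "negligible {a..b}" using negligible_subset negligible_sing by blast
  then show thesis using that[of "{a..b}"] by blast
qed

section \<open>The calibrating vector fields\<close>

lemma gradient_eqI:
  assumes "(f has_derivative (\<lambda>h. h \<bullet> D)) (at p)"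
  shows "gradient f p = D"
  unfolding gradient_def gderiv_def
proof (rule the_equality)
  fix D' assume "(f has_derivative (\<lambda>h. h \<bullet> D')) (at p)"
  from has_derivative_unique[OF this assms] have "h \<bullet> D' = h \<bullet> D" for h by (simp add: fun_eq_iff)
  then show "D' = D" by (metis inner_commute vector_eq_rdot)
qed (rule assms)

text \<open>Records the derivative by the columns of its matrix, which are the partial derivatives
  of the field.\<close>

lemma has_derivative_plane:
  fixes f :: "plane \<Rightarrow> plane"
  assumes "((\<lambda>p. f p $ 1) has_derivative (\<lambda>h. a1 * h $ 1 + b1 * h $ 2)) F"
    and "((\<lambda>p. f p $ 2) has_derivative (\<lambda>h. a2 * h $ 1 + b2 * h $ 2)) F"
  shows "(f has_derivative (\<lambda>h. h $ 1 *\<^sub>R vector [a1, a2] + h $ 2 *\<^sub>R vector [b1, b2])) F"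
proof -
  have e: "v = v $ 1 *\<^sub>R axis 1 1 + v $ 2 *\<^sub>R axis 2 1" for v :: plane
    by (simp add: plane_eq_iff axis_def)
  have "((\<lambda>p. f p $ 1 *\<^sub>R axis 1 1 + f p $ 2 *\<^sub>R axis 2 1 :: plane) has_derivative
     (\<lambda>h. (a1 * h $ 1 + b1 * h $ 2) *\<^sub>R axis 1 1 + (a2 * h $ 1 + b2 * h $ 2) *\<^sub>R axis 2 1)) F"
    by (intro has_derivative_add has_derivative_scaleR_left assms)
  moreover have "(\<lambda>h :: plane. (a1 * h $ 1 + b1 * h $ 2) *\<^sub>R axis 1 1 + (a2 * h $ 1 + b2 * h $ 2) *\<^sub>R axis 2 1)
     = (\<lambda>h. h $ 1 *\<^sub>R vector [a1, a2] + h $ 2 *\<^sub>R vector [b1, b2] :: plane)"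
    by (auto simp: plane_eq_iff axis_def algebra_simps)
  ultimately show ?thesis by (simp flip: e)
qed

lemma continuous_on_plane:
  assumes "continuous_on S f" "continuous_on S g"
  shows "continuous_on S (\<lambda>p. vector [f p, g p] :: plane)"
proof -
  have e: "(\<lambda>p. vector [f p, g p] :: plane) = (\<lambda>p. f p *\<^sub>R axis 1 1 + g p *\<^sub>R axis 2 1)"
    by (auto simp: plane_eq_iff axis_def)
  show ?thesis unfolding e using assms by (intro continuous_intros)
qed

lemma Lambda_components:
  "Lambda l1 l2 \<beta> p $ 1 = - l1 * sin \<beta> * p $ 1 - l2 * cos \<beta> * p $ 2"
  "Lambda l1 l2 \<beta> p $ 2 = l1 * cos \<beta> * p $ 1 - l2 * sin \<beta> * p $ 2"
  by (simp_all add: Lambda_def matrix_vector_mult_def sum_2)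

text \<open>The linear field \<open>Lambda\<close> is a gradient up to the term \<open>\<mu> (- p\<^sub>2, 0)\<close>, whose line
  integral along a curve is \<open>\<mu>\<close> times its area.\<close>

definition field_data ::
  "(plane \<Rightarrow> real) \<Rightarrow> real \<Rightarrow> real \<Rightarrow> real \<Rightarrow> real \<Rightarrow>
   (plane \<Rightarrow> real) \<Rightarrow> (plane \<Rightarrow> plane) \<Rightarrow> (plane \<Rightarrow> plane) \<Rightarrow> (plane \<Rightarrow> plane) \<Rightarrow> bool" where
  "field_data W \<rho> l1 l2 \<beta> G V Vx Vy \<longleftrightarrow>
     G 0 = 0 \<and> V 0 = 0 \<and>
     Vx 0 = vector [- l1 * sin \<beta>, l1 * cos \<beta>] \<and> Vy 0 = vector [- l2 * cos \<beta>, - l2 * sin \<beta>] \<and>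
     continuous_on (ball 0 \<rho>) Vx \<and> continuous_on (ball 0 \<rho>) Vy \<and>
     (\<forall>p\<in>ball 0 \<rho>.
        (G has_derivative (\<lambda>h. V p \<bullet> h + (l1 + l2) * cos \<beta> * (p $ 2 * h $ 1))) (at p) \<and>
        (V has_derivative (\<lambda>h. h $ 1 *\<^sub>R Vx p + h $ 2 *\<^sub>R Vy p)) (at p) \<and>
        Vx p $ 2 - Vy p $ 1 = (l1 + l2) * cos \<beta> \<and> (norm (V p))\<^sup>2 = W p)"

lemma field_data_exists:
  assumes \<rho>: "\<rho> > 0"
    and an: "real_analytic_on g (ball 0 \<rho>)"
    and a: "has_taylor_series g 0 a" "\<forall>\<alpha>. multi_order \<alpha> < 3 \<longrightarrow> a \<alpha> = 0"
    and W: "\<forall>p\<in>ball 0 \<rho>. W p = (norm (gradient g p + Lambda l1 l2 \<beta> p))\<^sup>2"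
  shows "\<exists>G V Vx Vy. field_data W \<rho> l1 l2 \<beta> G V Vx Vy"
proof -
  define \<mu> where "\<mu> = (l1 + l2) * cos \<beta>"
  define V :: "plane \<Rightarrow> plane" where "V p = vector [pd1 g p, pd2 g p] + Lambda l1 l2 \<beta> p" for p
  \<comment> \<open>The quadratic part is a potential of \<open>Lambda l1 l2 \<beta> p\<close> plus
    \<mu> times the vector \<open>(p $ 2, 0)\<close>, that is of the linear field made curl-free by
    a change of its first component.\<close>
  define G where "G p = g p - l1 * sin \<beta> / 2 * (p $ 1)\<^sup>2 + l1 * cos \<beta> * (p $ 1 * p $ 2)
                        - l2 * sin \<beta> / 2 * (p $ 2)\<^sup>2" for p
  define Vx :: "plane \<Rightarrow> plane" where "Vx p = vector [pd1 (pd1 g) p - l1 * sin \<beta>, pd1 (pd2 g) p + l1 * cos \<beta>]" for p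
  define Vy :: "plane \<Rightarrow> plane" where "Vy p = vector [pd2 (pd1 g) p - l2 * cos \<beta>, pd2 (pd2 g) p - l2 * sin \<beta>]" for p
  note an1 = real_analytic_on_pd[OF an]
  note an11 = real_analytic_on_pd[OF an1(1)] and an12 = real_analytic_on_pd[OF an1(2)]
  note T1 = taylor_pd1(2)[OF a(1)] and T2 = taylor_pd2(2)[OF a(1)]
  \<comment> \<open>There are no terms below order 3, so value, gradient and Hessian of
    \<open>g\<close> vanish at 0 and \<open>V\<close> has there the Jacobian of
    \<open>Lambda\<close>.\<close>
  have z: "g 0 = 0" "pd1 g 0 = 0" "pd2 g 0 = 0" "pd1 (pd1 g) 0 = 0" "pd2 (pd1 g) 0 = 0"
    "pd1 (pd2 g) 0 = 0" "pd2 (pd2 g) 0 = 0"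
    using taylor_center[OF a(1)] taylor_center[OF T1] taylor_center[OF T2]
      taylor_center[OF taylor_pd1(2)[OF T1]] taylor_center[OF taylor_pd2(2)[OF T1]]
      taylor_center[OF taylor_pd1(2)[OF T2]] taylor_center[OF taylor_pd2(2)[OF T2]] a(2)
    by (auto simp: multi_order_def)
  have comp: "((\<lambda>p :: plane. p $ i) has_derivative (\<lambda>h. h $ i)) F" for i F
    by (rule bounded_linear_imp_has_derivative) (rule bounded_linear_vec_nth)
  have vz: "vector [0, 0] = (0 :: plane)" by (simp add: plane_eq_iff)
  have "(G has_derivative (\<lambda>h. V p \<bullet> h + \<mu> * (p $ 2 * h $ 1))) (at p)"
    and "(V has_derivative (\<lambda>h. h $ 1 *\<^sub>R Vx p + h $ 2 *\<^sub>R Vy p)) (at p)"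
    and "Vx p $ 2 - Vy p $ 1 = \<mu>" and "(norm (V p))\<^sup>2 = W p" if p: "p \<in> ball 0 \<rho>" for p
  proof -
    have dg: "(f has_derivative (\<lambda>h. pd1 f p * h $ 1 + pd2 f p * h $ 2)) (at p)"
      if "real_analytic_on f (ball 0 \<rho>)" for f
      using real_analytic_on_has_derivative[OF that _ p] by simp
    have "(G has_derivative (\<lambda>h. (pd1 g p * h $ 1 + pd2 g p * h $ 2) - l1 * sin \<beta> / 2 * (2 * (p $ 1 * h $ 1))
        + l1 * cos \<beta> * (p $ 1 * h $ 2 + h $ 1 * p $ 2) - l2 * sin \<beta> / 2 * (2 * (p $ 2 * h $ 2)))) (at p)"
      unfolding G_def
      by (rule derivative_eq_intros dg an comp refl | (simp; fail))+ (auto simp: fun_eq_iff algebra_simps)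
    moreover have "(pd1 g p * h $ 1 + pd2 g p * h $ 2) - l1 * sin \<beta> / 2 * (2 * (p $ 1 * h $ 1))
        + l1 * cos \<beta> * (p $ 1 * h $ 2 + h $ 1 * p $ 2) - l2 * sin \<beta> / 2 * (2 * (p $ 2 * h $ 2))
        = V p \<bullet> h + \<mu> * (p $ 2 * h $ 1)" for h
      by (simp add: V_def inner_plane Lambda_components \<mu>_def algebra_simps)
    ultimately show "(G has_derivative (\<lambda>h. V p \<bullet> h + \<mu> * (p $ 2 * h $ 1))) (at p)" by simp
    show "(V has_derivative (\<lambda>h. h $ 1 *\<^sub>R Vx p + h $ 2 *\<^sub>R Vy p)) (at p)"
      unfolding Vx_def Vy_def
    proof (rule has_derivative_plane)
      show "((\<lambda>p. V p $ 1) has_derivative (\<lambda>h. (pd1 (pd1 g) p - l1 * sin \<beta>) * h $ 1 + (pd2 (pd1 g) p - l2 * cos \<beta>) * h $ 2)) (at p)"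
        unfolding V_def vector_add_component vector_2 Lambda_components
        by (rule derivative_eq_intros dg an1 comp refl | (simp; fail))+ (auto simp: fun_eq_iff algebra_simps)
      show "((\<lambda>p. V p $ 2) has_derivative (\<lambda>h. (pd1 (pd2 g) p + l1 * cos \<beta>) * h $ 1 + (pd2 (pd2 g) p - l2 * sin \<beta>) * h $ 2)) (at p)"
        unfolding V_def vector_add_component vector_2 Lambda_components
        by (rule derivative_eq_intros dg an1 comp refl | (simp; fail))+ (auto simp: fun_eq_iff algebra_simps)
    qed
    show "Vx p $ 2 - Vy p $ 1 = \<mu>"
      using real_analytic_on_pd_commute[OF an p] by (simp add: Vx_def Vy_def \<mu>_def algebra_simps)
    have "gradient g p = vector [pd1 g p, pd2 g p]"
      using dg[OF an] by (intro gradient_eqI) (simp add: inner_plane mult.commute)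
    then show "(norm (V p))\<^sup>2 = W p" using W p by (simp add: V_def)
  qed
  moreover have "continuous_on (ball 0 \<rho>) Vx" "continuous_on (ball 0 \<rho>) Vy"
    unfolding Vx_def Vy_def
    by (intro continuous_on_plane continuous_intros an11[THEN real_analytic_on_continuous_on]
        an12[THEN real_analytic_on_continuous_on])+
  ultimately have "field_data W \<rho> l1 l2 \<beta> G V Vx Vy"
    unfolding field_data_def \<mu>_def[symmetric]
    by (simp add: z G_def V_def Vx_def Vy_def plane_eq_iff Lambda_components)
  then show ?thesis by blast
qed

text \<open>Write \<open>X Y - A B = (X - A) (Y - B) + (X - A) B + A (Y - B)\<close>. The
  differences are small compared with \<open>norm p\<close> and the linear parts are bounded by a
  multiple of it, so quadratic expressions in two fields behave at the origin like those in their
  linear parts.\<close>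

lemma field_quadratic_limit:
  fixes X Y :: "plane \<Rightarrow> plane"
  assumes X: "(X has_derivative A) (at 0)" "X 0 = 0" and Y: "(Y has_derivative B) (at 0)" "Y 0 = 0"
  shows "((\<lambda>p. (X p $ i * Y p $ j - A p $ i * B p $ j) / (norm p)\<^sup>2) \<longlongrightarrow> 0) (at 0)"
proof -
  have rem: "((\<lambda>p. (f p $ k - L p $ k) / norm p) \<longlongrightarrow> 0) (at 0)"
    and bdd: "Bfun (\<lambda>p. L p $ k / norm p) (at 0)"
    if f: "(f has_derivative L) (at 0)" "f 0 = 0" for f L :: "plane \<Rightarrow> plane" and k
  proof -
    have bl: "bounded_linear L" using f(1) by (rule has_derivative_bounded_linear)
    have "((\<lambda>p. norm (f p - L p) / norm p) \<longlongrightarrow> 0) (at 0)"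
      using f unfolding has_derivative_at by simp
    then show "((\<lambda>p. (f p $ k - L p $ k) / norm p) \<longlongrightarrow> 0) (at 0)"
      by (rule Lim_null_comparison[rotated])
         (auto intro!: always_eventually divide_right_mono component_le_norm_cart[of "f _ - L _", simplified])
    obtain K where K: "\<And>p. norm (L p) \<le> norm p * K" using bounded_linear.bounded[OF bl] by blast
    have "norm (L p $ k / norm p) \<le> \<bar>K\<bar>" for p
    proof (cases "p = 0")
      case False
      have "\<bar>L p $ k\<bar> \<le> norm p * \<bar>K\<bar>"
        using component_le_norm_cart[of "L p" k] K[of p] mult_left_mono[OF abs_ge_self[of K] norm_ge_zero[of p]] by linarith
      then show ?thesis using False by (simp add: field_simps)
    qed simp
    then show "Bfun (\<lambda>p. L p $ k / norm p) (at 0)" by (intro BfunI always_eventually allI)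
  qed
  have r1: "Zfun (\<lambda>p. (X p $ i - A p $ i) / norm p) (at 0)" and r2: "Zfun (\<lambda>p. (Y p $ j - B p $ j) / norm p) (at 0)"
    using rem[OF X] rem[OF Y] by (simp_all add: tendsto_Zfun_iff)
  have "Zfun (\<lambda>p. (X p $ i - A p $ i) / norm p * ((Y p $ j - B p $ j) / norm p)
     + (X p $ i - A p $ i) / norm p * (B p $ j / norm p) + A p $ i / norm p * ((Y p $ j - B p $ j) / norm p)) (at 0)"
    by (intro Zfun_add bounded_bilinear.Zfun[OF bounded_bilinear_mult r1 r2]
        bounded_bilinear.Zfun_prod_Bfun[OF bounded_bilinear_mult r1 bdd[OF Y]]
        bounded_bilinear.Bfun_prod_Zfun[OF bounded_bilinear_mult bdd[OF X] r2])
  moreover have "(X p $ i - A p $ i) / norm p * ((Y p $ j - B p $ j) / norm p)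
     + (X p $ i - A p $ i) / norm p * (B p $ j / norm p) + A p $ i / norm p * ((Y p $ j - B p $ j) / norm p)
     = (X p $ i * Y p $ j - A p $ i * B p $ j) / (norm p)\<^sup>2" for p
    by (cases "p = 0") (auto simp: power2_eq_square field_simps)
  ultimately show ?thesis by (simp add: tendsto_Zfun_iff)
qed

lemma has_real_derivative_along:
  fixes V :: "plane \<Rightarrow> plane"
  assumes "(V has_derivative (\<lambda>h. h $ 1 *\<^sub>R Vx + h $ 2 *\<^sub>R Vy)) (at p)"
  shows "((\<lambda>t. V (p + t *\<^sub>R v) $ i) has_real_derivative v $ 1 * Vx $ i + v $ 2 * Vy $ i) (at 0)"
proof -
  have line: "((\<lambda>t. p + t *\<^sub>R v) has_derivative (\<lambda>t. t *\<^sub>R v)) (at (0::real))"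
    by (auto intro!: derivative_eq_intros)
  have "(V has_derivative (\<lambda>h. h $ 1 *\<^sub>R Vx + h $ 2 *\<^sub>R Vy)) (at (p + 0 *\<^sub>R v))" using assms by simp
  from has_derivative_compose[OF line this]
  have "((\<lambda>t. V (p + t *\<^sub>R v)) has_derivative (\<lambda>t. (t *\<^sub>R v) $ 1 *\<^sub>R Vx + (t *\<^sub>R v) $ 2 *\<^sub>R Vy)) (at 0)" .
  from bounded_linear.has_derivative[OF bounded_linear_vec_nth this]
  show ?thesis unfolding has_field_derivative_def
    by (rule has_derivative_eq_rhs) (auto simp: fun_eq_iff algebra_simps)
qed


text \<open>The angle from a gradient field \<open>X\<close> to a field \<open>Y\<close> of the same length with curl \<open>\<mu>\<close> solves
  a transport equation along \<open>Y\<close>: with \<open>sin = N/W\<close> and \<open>cos = D/W\<close> the derivative of the sine is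
  \<open>cos * (\<mu> - sin * div X)\<close>. In this lemma \<open>a\<close> and \<open>b\<close> are the partial derivatives of \<open>X\<close>, \<open>c\<close> and
  \<open>d\<close> those of \<open>Y\<close>.\<close>

lemma angle_transport:
  fixes x1 x2 y1 y2 a1 a2 b1 b2 c1 c2 d1 d2 \<mu> :: real
  defines "N \<equiv> x1*y2 - x2*y1" and "D \<equiv> x1*y1 + x2*y2" and "W \<equiv> x1^2 + x2^2"
    and "dx1 \<equiv> y1*a1 + y2*b1" and "dx2 \<equiv> y1*a2 + y2*b2"
    and "dy1 \<equiv> y1*c1 + y2*d1" and "dy2 \<equiv> y1*c2 + y2*d2"
  assumes W: "y1^2 + y2^2 = x1^2 + x2^2" and "a2 = b1" and "c2 - d1 = \<mu>"
    and e1: "x1*a1 + x2*a2 = y1*c1 + y2*c2" and e2: "x1*b1 + x2*b2 = y1*d1 + y2*d2"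
  shows "(dx1*y2 + x1*dy2 - dx2*y1 - x2*dy1) * W - N * (2 * (x1*dx1 + x2*dx2))
         = D * (\<mu> * W - N * (a1 + b2))"
proof -
  \<comment> \<open>In complex notation \<open>W y = (D + i N) x\<close>: \<open>y\<close> is
    \<open>x\<close> turned by the angle in question, and \<open>x\<close> is \<open>y\<close>
    turned back.\<close>
  have wy1: "W*y1 = D*x1 - N*x2" and wy2: "W*y2 = D*x2 + N*x1"
    by (simp_all add: W_def D_def N_def power2_eq_square algebra_simps)
  have W': "W = y1^2 + y2^2" using W by (simp add: W_def)
  have wx1: "W*x1 = D*y1 + N*y2" and wx2: "W*x2 = D*y2 - N*y1"
    by (simp_all add: W' D_def N_def power2_eq_square algebra_simps)
  \<comment> \<open>Half the derivative of \<open>W\<close> along \<open>Y\<close>. It can be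
    computed from either field because both have squared length \<open>W\<close>; \<open>e1\<close>
    and \<open>e2\<close> state the equality of the two gradients.\<close>
  define h where "h = x1*dx1 + x2*dx2"
  have h: "h = y1*dy1 + y2*dy2"
  proof -
    have "h = y1*(x1*a1 + x2*a2) + y2*(x1*b1 + x2*b2)" by (simp add: h_def dx1_def dx2_def algebra_simps)
    also have "\<dots> = y1*dy1 + y2*dy2" unfolding e1 e2 by (simp add: dy1_def dy2_def algebra_simps)
    finally show ?thesis .
  qed
  have "(dx1*y2 - dx2*y1) * W = dx1*(W*y2) - dx2*(W*y1)" by (simp add: algebra_simps)
  also have "\<dots> = D*(dx1*x2 - dx2*x1) + N*h" unfolding wy1 wy2 h_def by (simp add: algebra_simps)
  finally have A: "(dx1*y2 - dx2*y1) * W = D*(dx1*x2 - dx2*x1) + N*h" .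
  have "(x1*dy2 - x2*dy1) * W = (W*x1)*dy2 - (W*x2)*dy1" by (simp add: algebra_simps)
  also have "\<dots> = D*(y1*dy2 - y2*dy1) + N*h" unfolding wx1 wx2 h by (simp add: algebra_simps)
  finally have B: "(x1*dy2 - x2*dy1) * W = D*(y1*dy2 - y2*dy1) + N*h" .
  \<comment> \<open>The curl of \<open>Y\<close> enters here; that of \<open>X\<close> enters as the
    symmetry \<open>a2 = b1\<close> in the formula \<open>D\<close> below.\<close>
  have "y1*dy2 - y2*dy1 = y1*(y1*d1 + y2*d2) - y2*(y1*c1 + y2*c2) + (c2 - d1)*W"
    by (simp add: dy1_def dy2_def W' power2_eq_square algebra_simps)
  also have "\<dots> = y1*(x1*b1 + x2*b2) - y2*(x1*a1 + x2*a2) + \<mu>*W"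
    using e1 e2 \<open>c2 - d1 = \<mu>\<close> by simp
  finally have C: "y1*dy2 - y2*dy1 = y1*(x1*b1 + x2*b2) - y2*(x1*a1 + x2*a2) + \<mu>*W" .
  have D: "dx1*x2 - dx2*x1 = - N*(a1 + b2) - (y1*(x1*b1 + x2*b2) - y2*(x1*a1 + x2*a2))"
    by (simp add: dx1_def dx2_def N_def \<open>a2 = b1\<close> algebra_simps)
  have "(dx1*y2 + x1*dy2 - dx2*y1 - x2*dy1) * W - N * (2*h)
      = (dx1*y2 - dx2*y1) * W + (x1*dy2 - x2*dy1) * W - N * (2*h)" by (simp add: algebra_simps)
  also have "\<dots> = D * (\<mu> * W - N * (a1 + b2))" unfolding A B C D by (simp add: algebra_simps)
  finally show ?thesis by (simp add: h_def)
qed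

text \<open>For two fields of length \<open>sqrt W\<close>, \<open>cross (X p) (Y p) / W p\<close>
  is the sine of the angle from \<open>X\<close> to \<open>Y\<close>, and
  \<open>X p \<bullet> Y p / W p\<close> is its cosine.\<close>

definition cross :: "plane \<Rightarrow> plane \<Rightarrow> real" where
  "cross p q = p $ 1 * q $ 2 - p $ 2 * q $ 1"

lemma cross_inner_sq: "(cross p q)\<^sup>2 + (p \<bullet> q)\<^sup>2 = (norm p)\<^sup>2 * (norm q)\<^sup>2"
  by (simp add: cross_def inner_plane norm_plane power2_eq_square algebra_simps)

text \<open>Both \<open>y\<close> and \<open>p\<close> are decomposed along \<open>x\<close> and its
  quarter turn. This carries the inward direction of one field over to a field at a small angle from
  it.\<close>

lemma inner_via_cross: "(norm x)\<^sup>2 * (y \<bullet> p) = (x \<bullet> y) * (x \<bullet> p) + cross x y * cross x p"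
  by (simp add: cross_def inner_plane norm_plane power2_eq_square algebra_simps)

lemma cross_le: "\<bar>cross p q\<bar> \<le> norm p * norm q"
proof (rule power2_le_imp_le)
  show "\<bar>cross p q\<bar>\<^sup>2 \<le> (norm p * norm q)\<^sup>2"
    using cross_inner_sq[of p q] by (simp add: power_mult_distrib) (smt (verit) zero_le_power2)
qed simp

text \<open>Maximum principle: at a maximum of the sine on a disc that \<open>Y\<close> enters, the transport equation
  bounds the sine by \<open>\<bar>\<mu>\<bar> / \<bar>div X\<bar>\<close>.\<close>

lemma angle_max_principle:
  fixes W :: "plane \<Rightarrow> real"
  assumes X: "field_data W \<rho> l1 l2 (pi/2) G X Xx Xy" and Y: "field_data W \<rho> l1 l2 \<beta> G' Y Yx Yy"
    and r: "0 < r" "r < \<rho>"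
    and div: "\<And>p. p \<in> cball 0 r \<Longrightarrow> Xx p $ 1 + Xy p $ 2 \<le> - m" and m: "m > 0"
    and pos: "\<And>p. p \<in> cball 0 r \<Longrightarrow> p \<noteq> 0 \<Longrightarrow> W p > 0 \<and> X p \<bullet> Y p > 0 \<and> Y p \<bullet> p < 0"
    and lim: "((\<lambda>p. cross (X p) (Y p) / W p) \<longlongrightarrow> - cos \<beta>) (at 0)"
    and \<sigma>: "\<bar>\<sigma>\<bar> = 1" and c0: "\<bar>cos \<beta>\<bar> \<le> c" "\<bar>(l1 + l2) * cos \<beta>\<bar> \<le> m * c"
    and q: "q \<in> cball 0 r" "q \<noteq> 0"
  shows "\<sigma> * (cross (X q) (Y q) / W q) \<le> c"
proof -
  define s where "s p = cross (X p) (Y p) / W p" for p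
  \<comment> \<open>The sine, times a sign \<sigma> so that one argument bounds it from above and
    from below. Its limit fills the singular point 0, and the continuous extension attains its
    maximum on the disc.\<close>
  define f where "f p = \<sigma> * (if p = 0 then - cos \<beta> else s p)" for p
  define \<mu> where "\<mu> = (l1 + l2) * cos \<beta>"
  note FX = X[unfolded field_data_def] and FY = Y[unfolded field_data_def]
  have sub: "cball 0 r \<subseteq> ball (0 :: plane) \<rho>" using r by auto
  have WX: "(norm (X p))\<^sup>2 = W p" and WY: "(norm (Y p))\<^sup>2 = W p"
    and dX: "(X has_derivative (\<lambda>h. h $ 1 *\<^sub>R Xx p + h $ 2 *\<^sub>R Xy p)) (at p)"
    and dY: "(Y has_derivative (\<lambda>h. h $ 1 *\<^sub>R Yx p + h $ 2 *\<^sub>R Yy p)) (at p)"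
    if "p \<in> ball 0 \<rho>" for p
    using FX FY that by blast+
  have cX: "isCont X p" and cY: "isCont Y p" if "p \<in> ball 0 \<rho>" for p
    using dX dY that has_derivative_continuous by blast+
  have cf: "continuous_on (cball 0 r) f"
  proof (rule continuous_at_imp_continuous_on, rule ballI)
    fix p :: plane assume p: "p \<in> cball 0 r"
    show "isCont f p"
    proof (cases "p = 0")
      case True
      have "((\<lambda>p. \<sigma> * s p) \<longlongrightarrow> \<sigma> * - cos \<beta>) (at 0)"
        using lim unfolding s_def by (intro tendsto_intros)
      then have "((\<lambda>p. \<sigma> * s p) \<longlongrightarrow> f 0) (at 0)" by (simp add: f_def)
      then have "(f \<longlongrightarrow> f 0) (at 0)"
        by (rule Lim_transform_eventually) (auto simp: f_def eventually_at_filter)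
      then show ?thesis using True by (simp add: isCont_def)
    next
      case False
      have c: "isCont X p" "isCont Y p" using p sub cX cY by blast+
      have "norm (X p) \<noteq> 0" using pos[OF p False] WX[of p] p sub by auto
      then have "isCont (\<lambda>p. \<sigma> * (cross (X p) (Y p) / (norm (X p))\<^sup>2)) p"
        unfolding cross_def using c by (auto intro!: continuous_intros)
      then have "((\<lambda>p. \<sigma> * (cross (X p) (Y p) / (norm (X p))\<^sup>2)) \<longlongrightarrow> f p) (at p)"
        using False WX[of p] p sub by (auto simp: isCont_def f_def s_def)
      moreover have "\<forall>\<^sub>F x in at p. \<sigma> * (cross (X x) (Y x) / (norm (X x))\<^sup>2) = f x"
      proof -
        have "\<forall>\<^sub>F x in nhds p. x \<in> ball 0 \<rho> - {0}"
          using False p sub by (intro eventually_nhds_in_open open_delete) auto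
        then have "\<forall>\<^sub>F x in at p. x \<in> ball 0 \<rho> - {0}" by (simp add: eventually_at_filter eventually_mono)
        then show ?thesis by eventually_elim (auto simp: f_def s_def WX)
      qed
      ultimately show ?thesis unfolding isCont_def by (rule Lim_transform_eventually)
    qed
  qed
  obtain p where p: "p \<in> cball 0 r" and max: "\<And>x. x \<in> cball 0 r \<Longrightarrow> f x \<le> f p"
    using continuous_attains_sup[OF compact_cball _ cf] r(1) by auto
  have "f p \<le> c"
  proof (cases "p = 0")
    case True
    have "f p \<le> \<bar>\<sigma> * - cos \<beta>\<bar>" using True by (simp add: f_def)
    then show ?thesis using \<sigma> c0(1) by (simp add: abs_mult)
  next
    case False
    have pb: "p \<in> ball 0 \<rho>" using p sub by blast
    note P = pos[OF p False]
    define v where "v = Y p"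
    define x where "x = (\<lambda>i t. X (p + t *\<^sub>R v) $ i)"
    define y where "y = (\<lambda>i t. Y (p + t *\<^sub>R v) $ i)"
    have dx: "(x i has_real_derivative v $ 1 * Xx p $ i + v $ 2 * Xy p $ i) (at 0)" for i
      unfolding x_def by (rule has_real_derivative_along[OF dX[OF pb]])
    have dy: "(y i has_real_derivative v $ 1 * Yx p $ i + v $ 2 * Yy p $ i) (at 0)" for i
      unfolding y_def by (rule has_real_derivative_along[OF dY[OF pb]])
    \<comment> \<open>The two expressions for \<open>W\<close> are differentiated in a direction
      \<open>w\<close>; the coordinate directions give the last two hypotheses of
      \<open>angle_transport\<close>.\<close>
    have sq: "X p $ 1 * (w $ 1 * Xx p $ 1 + w $ 2 * Xy p $ 1) + X p $ 2 * (w $ 1 * Xx p $ 2 + w $ 2 * Xy p $ 2)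
       = Y p $ 1 * (w $ 1 * Yx p $ 1 + w $ 2 * Yy p $ 1) + Y p $ 2 * (w $ 1 * Yx p $ 2 + w $ 2 * Yy p $ 2)" for w :: plane
    proof -
      have 1: "((\<lambda>t. (X (p + t *\<^sub>R w) $ 1)\<^sup>2 + (X (p + t *\<^sub>R w) $ 2)\<^sup>2) has_real_derivative
         2 * (X p $ 1 * (w $ 1 * Xx p $ 1 + w $ 2 * Xy p $ 1) + X p $ 2 * (w $ 1 * Xx p $ 2 + w $ 2 * Xy p $ 2))) (at 0)"
        by (rule derivative_eq_intros has_real_derivative_along[OF dX[OF pb]] refl)+ (simp add: algebra_simps)
      have 2: "((\<lambda>t. (Y (p + t *\<^sub>R w) $ 1)\<^sup>2 + (Y (p + t *\<^sub>R w) $ 2)\<^sup>2) has_real_derivative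
         2 * (Y p $ 1 * (w $ 1 * Yx p $ 1 + w $ 2 * Yy p $ 1) + Y p $ 2 * (w $ 1 * Yx p $ 2 + w $ 2 * Yy p $ 2))) (at 0)"
        by (rule derivative_eq_intros has_real_derivative_along[OF dY[OF pb]] refl)+ (simp add: algebra_simps)
      have opn: "open ((\<lambda>t. p + t *\<^sub>R w) -` ball 0 \<rho>)"
        by (intro open_vimage continuous_intros) auto
      have eq: "(X z $ 1)\<^sup>2 + (X z $ 2)\<^sup>2 = (Y z $ 1)\<^sup>2 + (Y z $ 2)\<^sup>2" if "z \<in> ball 0 \<rho>" for z
        using WX[OF that] WY[OF that] by (simp add: norm_plane)
      have "((\<lambda>t. (Y (p + t *\<^sub>R w) $ 1)\<^sup>2 + (Y (p + t *\<^sub>R w) $ 2)\<^sup>2) has_real_derivative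
         2 * (X p $ 1 * (w $ 1 * Xx p $ 1 + w $ 2 * Xy p $ 1) + X p $ 2 * (w $ 1 * Xx p $ 2 + w $ 2 * Xy p $ 2))) (at 0)"
        by (rule has_field_derivative_transform_within_open[OF 1 opn]) (use pb eq in auto)
      from DERIV_unique[OF this 2] show ?thesis by simp
    qed
    have sq1: "X p $ 1 * Xx p $ 1 + X p $ 2 * Xx p $ 2 = Y p $ 1 * Yx p $ 1 + Y p $ 2 * Yx p $ 2"
      using sq[of "axis 1 1"] by (simp add: axis_def)
    have sq2: "X p $ 1 * Xy p $ 1 + X p $ 2 * Xy p $ 2 = Y p $ 1 * Yy p $ 1 + Y p $ 2 * Yy p $ 2"
      using sq[of "axis 2 1"] by (simp add: axis_def)
    have Wp: "(X p $ 1)\<^sup>2 + (X p $ 2)\<^sup>2 = W p" "(Y p $ 1)\<^sup>2 + (Y p $ 2)\<^sup>2 = W p"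
      using WX[OF pb] WY[OF pb] by (simp_all add: norm_plane)
    have curl: "Xx p $ 2 = Xy p $ 1" "Yx p $ 2 - Yy p $ 1 = \<mu>"
      using FX FY pb unfolding \<mu>_def by (auto simp: cos_pi_half)
    define \<tau> where "\<tau> = Xx p $ 1 + Xy p $ 2"
    define d where "d = X p \<bullet> Y p / W p * (\<mu> - s p * \<tau>)"
    define n where "n t = x 1 t * y 2 t - x 2 t * y 1 t" for t
    define w where "w t = (x 1 t)\<^sup>2 + (x 2 t)\<^sup>2" for t
    have w0: "w 0 = W p" "n 0 = cross (X p) (Y p)"
      using Wp by (simp_all add: w_def n_def x_def y_def cross_def)
    let ?d = "\<lambda>u v' i. v $ 1 * u $ i + v $ 2 * v' $ i"
    have dn: "(n has_real_derivative
        ?d (Xx p) (Xy p) 1 * y 2 0 + x 1 0 * ?d (Yx p) (Yy p) 2 - ?d (Xx p) (Xy p) 2 * y 1 0 - x 2 0 * ?d (Yx p) (Yy p) 1) (at 0)"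
      unfolding n_def
      by (rule DERIV_cong[OF DERIV_diff[OF DERIV_mult[OF dx[of 1] dy[of 2]] DERIV_mult[OF dx[of 2] dy[of 1]]]]) (simp add: algebra_simps)
    have dw: "(w has_real_derivative 2 * (x 1 0 * ?d (Xx p) (Xy p) 1 + x 2 0 * ?d (Xx p) (Xy p) 2)) (at 0)"
      unfolding w_def power2_eq_square
      by (rule DERIV_cong[OF DERIV_add[OF DERIV_mult[OF dx[of 1] dx[of 1]] DERIV_mult[OF dx[of 2] dx[of 2]]]]) (simp add: algebra_simps)
    have "w 0 \<noteq> 0" using P by (simp add: w0)
    from DERIV_divide[OF dn dw this]
    have "((\<lambda>t. n t / w t) has_real_derivative
        ((?d (Xx p) (Xy p) 1 * y 2 0 + x 1 0 * ?d (Yx p) (Yy p) 2 - ?d (Xx p) (Xy p) 2 * y 1 0 - x 2 0 * ?d (Yx p) (Yy p) 1) * w 0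
          - n 0 * (2 * (x 1 0 * ?d (Xx p) (Xy p) 1 + x 2 0 * ?d (Xx p) (Xy p) 2))) / (w 0 * w 0)) (at 0)" .
    also have "(?d (Xx p) (Xy p) 1 * y 2 0 + x 1 0 * ?d (Yx p) (Yy p) 2 - ?d (Xx p) (Xy p) 2 * y 1 0 - x 2 0 * ?d (Yx p) (Yy p) 1) * w 0
          - n 0 * (2 * (x 1 0 * ?d (Xx p) (Xy p) 1 + x 2 0 * ?d (Xx p) (Xy p) 2))
       = X p \<bullet> Y p * (\<mu> * W p - cross (X p) (Y p) * \<tau>)"
      using angle_transport[OF _ curl sq1 sq2] Wp
      by (simp add: w0 x_def y_def v_def \<tau>_def cross_def inner_plane)
    also have "\<dots> / (w 0 * w 0) = d" using P by (simp add: d_def w0 s_def field_simps)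
    finally have "((\<lambda>t. \<sigma> * (n t / w t)) has_real_derivative \<sigma> * d) (at 0)"
      by (rule DERIV_cmult)
    \<comment> \<open>Because \<open>Y p \<bullet> p < 0\<close>, a short step along
      \<open>Y p\<close> stays in the disc even if \<open>p\<close> lies on the boundary circle, so
      boundary maxima pass the same derivative test.\<close>
    moreover have "\<forall>\<^sub>F t in at_right 0. \<sigma> * (n t / w t) \<le> \<sigma> * (n 0 / w 0)"
    proof -
      have "((\<lambda>t. 2 * (v \<bullet> p) + t * (norm v)\<^sup>2) \<longlongrightarrow> 2 * (v \<bullet> p) + 0 * (norm v)\<^sup>2) (at_right 0)"
        by (intro tendsto_intros)
      then have "\<forall>\<^sub>F t in at_right 0. 2 * (v \<bullet> p) + t * (norm v)\<^sup>2 < 0"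
        using P by (intro order_tendstoD(2)) (auto simp: v_def)
      moreover have "((\<lambda>t. p + t *\<^sub>R v) \<longlongrightarrow> p + 0 *\<^sub>R v) (at_right 0)" by (intro tendsto_intros)
      then have "\<forall>\<^sub>F t in at_right 0. p + t *\<^sub>R v \<in> - {0}"
        using False by (intro topological_tendstoD) auto
      moreover have "\<forall>\<^sub>F t in at_right (0::real). t > 0" by (simp add: eventually_at_right_less)
      ultimately show ?thesis
      proof eventually_elim
        case (elim t)
        have "(norm (p + t *\<^sub>R v))\<^sup>2 = (norm p)\<^sup>2 + t * (2 * (v \<bullet> p) + t * (norm v)\<^sup>2)"
          unfolding power2_norm_eq_inner by (simp add: inner_simps inner_commute power2_eq_square algebra_simps)
        also have "\<dots> \<le> (norm p)\<^sup>2" using elim by (simp add: mult_le_0_iff)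
        finally have "p + t *\<^sub>R v \<in> cball 0 r" using p by (auto dest: power2_le_imp_le)
        then have "f (p + t *\<^sub>R v) \<le> f p" and "p + t *\<^sub>R v \<in> ball 0 \<rho>" using max sub by blast+
        then show ?case using elim False WX[of "p + t *\<^sub>R v"] pb WX[of p]
          by (simp add: f_def s_def n_def w_def x_def y_def cross_def norm_plane)
      qed
    qed
    ultimately have "\<sigma> * d \<le> 0"
    proof -
      assume D: "((\<lambda>t. \<sigma> * (n t / w t)) has_real_derivative \<sigma> * d) (at 0)"
        and E: "\<forall>\<^sub>F t in at_right 0. \<sigma> * (n t / w t) \<le> \<sigma> * (n 0 / w 0)"
      show ?thesis
      proof (rule ccontr)
        assume "\<not> ?thesis"
        then obtain e where e: "e > 0" "\<And>t. 0 < t \<Longrightarrow> t < e \<Longrightarrow> \<sigma> * (n 0 / w 0) < \<sigma> * (n (0 + t) / w (0 + t))"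
          using DERIV_pos_inc_right[OF D] by auto
        obtain e' where e': "e' > 0" "\<And>t. 0 < t \<Longrightarrow> t < e' \<Longrightarrow> \<sigma> * (n t / w t) \<le> \<sigma> * (n 0 / w 0)"
          using E unfolding eventually_at_right_field by auto
        define t where "t = min e e' / 2"
        have "0 < t" "t < e" "t < e'" using e(1) e'(1) by (auto simp: t_def min_def)
        then show False using e(2)[of t] e'(2)[of t] by simp
      qed
    qed
    \<comment> \<open>The positive cosine cancels, which leaves
      \<open>\<sigma> * s p * (- \<tau>) \<le> - \<sigma> * \<mu>\<close>. As the divergence \<tau>
      is at most \<open>- m\<close>, a signed sine above \<open>c\<close> would contradict
      \<open>\<bar>\<mu>\<bar> \<le> m * c\<close>.\<close>
    then have "X p \<bullet> Y p / W p * (\<sigma> * (\<mu> - s p * \<tau>)) \<le> 0" by (simp add: d_def mult_ac)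
    moreover have "0 < X p \<bullet> Y p / W p" using P by simp
    ultimately have "\<sigma> * (\<mu> - s p * \<tau>) \<le> 0" by (meson mult_pos_pos not_le)
    then have 1: "(\<sigma> * s p) * (- \<tau>) \<le> - \<sigma> * \<mu>" by (simp add: algebra_simps)
    also have "\<dots> \<le> \<bar>\<sigma> * \<mu>\<bar>" by simp
    also have "\<dots> \<le> m * c" using \<sigma> c0(2) by (simp add: abs_mult \<mu>_def)
    finally have 2: "(\<sigma> * s p) * (- \<tau>) \<le> m * c" .
    have \<tau>: "m \<le> - \<tau>" using div[OF p] by (simp add: \<tau>_def)
    have "\<sigma> * s p \<le> c"
    proof (rule ccontr)
      assume "\<not> ?thesis"
      then have "c < \<sigma> * s p" by simp
      moreover have "c \<ge> 0" using c0(1) by linarith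
      ultimately have "m * c < (- \<tau>) * (\<sigma> * s p)"
        using \<tau> m by (intro mult_le_less_imp_less) auto
      then show False using 2 by (simp add: mult.commute)
    qed
    then show ?thesis using False by (simp add: f_def)
  qed
  then show ?thesis using max[OF q(1)] q(2) by (simp add: f_def s_def)
qed

section \<open>The angle near the origin and on a disc independent of \<beta>\<close>

lemma field_dataD:
  assumes "field_data W \<rho> l1 l2 \<beta> G V Vx Vy"
  shows "G 0 = 0" "V 0 = 0"
    "Vx 0 = vector [- l1 * sin \<beta>, l1 * cos \<beta>]" "Vy 0 = vector [- l2 * cos \<beta>, - l2 * sin \<beta>]"
    "continuous_on (ball 0 \<rho>) Vx" "continuous_on (ball 0 \<rho>) Vy"
    "p \<in> ball 0 \<rho> \<Longrightarrow> (G has_derivative (\<lambda>h. V p \<bullet> h + (l1 + l2) * cos \<beta> * (p $ 2 * h $ 1))) (at p)"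
    "p \<in> ball 0 \<rho> \<Longrightarrow> (V has_derivative (\<lambda>h. h $ 1 *\<^sub>R Vx p + h $ 2 *\<^sub>R Vy p)) (at p)"
    "p \<in> ball 0 \<rho> \<Longrightarrow> Vx p $ 2 - Vy p $ 1 = (l1 + l2) * cos \<beta>"
    "p \<in> ball 0 \<rho> \<Longrightarrow> (norm (V p))\<^sup>2 = W p"
  using assms unfolding field_data_def by blast+

text \<open>The linear part of \<open>Y\<close> at the origin is that of \<open>X\<close> turned by
  \<open>\<beta> - pi/2\<close>, which has sine \<open>- cos \<beta>\<close> and cosine
  \<open>sin \<beta>\<close>. The inward bound makes \<open>W\<close> at least \<open>a^2\<close>
  times the squared norm, so the errors from linearization vanish in the quotient.\<close>

lemma field_angle_limits:
  assumes X: "field_data W \<rho> l1 l2 (pi/2) G X Xx Xy" and Y: "field_data W \<rho> l1 l2 \<beta> G' Y Yx Yy"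
    and \<rho>: "\<rho> > 0" and a: "a > 0" and d: "d > 0" "\<And>p. norm p < d \<Longrightarrow> X p \<bullet> p \<le> - a * (norm p)\<^sup>2"
  shows "((\<lambda>p. cross (X p) (Y p) / W p) \<longlongrightarrow> - cos \<beta>) (at 0)"
    and "((\<lambda>p. X p \<bullet> Y p / W p) \<longlongrightarrow> sin \<beta>) (at 0)"
proof -
  note FX = field_dataD[OF X] and FY = field_dataD[OF Y]
  have 0: "(0::plane) \<in> ball 0 \<rho>" using \<rho> by simp
  define A where "A = (\<lambda>h :: plane. h $ 1 *\<^sub>R Xx 0 + h $ 2 *\<^sub>R Xy 0)"
  define B where "B = (\<lambda>h :: plane. h $ 1 *\<^sub>R Yx 0 + h $ 2 *\<^sub>R Yy 0)"
  have dX: "(X has_derivative A) (at 0)" "X 0 = 0" and dY: "(Y has_derivative B) (at 0)" "Y 0 = 0"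
    unfolding A_def B_def by (rule FX(8)[OF 0] FX(2) FY(8)[OF 0] FY(2))+
  have W: "W p = X p $ 1 * X p $ 1 + X p $ 2 * X p $ 2" if "p \<in> ball 0 \<rho>" for p
  proof -
    have "W p = (norm (X p))\<^sup>2" using FX(10)[OF that] by simp
    then show ?thesis by (simp add: norm_plane power2_eq_square)
  qed
  have A: "A p $ 1 = - l1 * p $ 1" "A p $ 2 = - l2 * p $ 2" for p
    by (simp_all add: A_def FX(3,4) cos_pi_half)
  have B: "B p $ 1 = - l1 * sin \<beta> * p $ 1 - l2 * cos \<beta> * p $ 2"
    "B p $ 2 = l1 * cos \<beta> * p $ 1 - l2 * sin \<beta> * p $ 2" for p
    by (simp_all add: B_def FY(3,4) algebra_simps)
  have near: "\<forall>\<^sub>F p in at 0. p \<in> ball 0 \<rho> \<and> norm p < d \<and> p \<noteq> (0::plane)"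
    unfolding eventually_at using \<rho> d(1) by (intro exI[of _ "min \<rho> d"]) (auto simp: dist_norm)
  have bdd: "Bfun (\<lambda>p. (norm p)\<^sup>2 / W p) (at 0)"
  proof (rule BfunI)
    show "\<forall>\<^sub>F p in at 0. norm ((norm p)\<^sup>2 / W p) \<le> 1 / a\<^sup>2"
      using near
    proof eventually_elim
      case (elim p)
      have "a * (norm p)\<^sup>2 \<le> \<bar>X p \<bullet> p\<bar>" using d(2)[of p] elim by simp
      also have "\<dots> \<le> norm (X p) * norm p" by (rule Cauchy_Schwarz_ineq2)
      finally have "a * norm p \<le> norm (X p)" using elim by (simp add: power2_eq_square)
      then have "(a * norm p)\<^sup>2 \<le> (norm (X p))\<^sup>2" using a by (intro power_mono) auto
      then have "a\<^sup>2 * (norm p)\<^sup>2 \<le> W p" using FX(10)[of p] elim by (simp add: power_mult_distrib)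
      moreover have "0 < a\<^sup>2 * (norm p)\<^sup>2" using a elim by simp
      ultimately have "0 < W p" "a\<^sup>2 * (norm p)\<^sup>2 \<le> W p" by linarith+
      then show ?case using a by (simp add: field_simps)
    qed
  qed
  note Q = field_quadratic_limit
  have ratio: "((\<lambda>p. N p / W p) \<longlongrightarrow> c) (at 0)"
    if "((\<lambda>p. (N p - c * W p) / (norm p)\<^sup>2) \<longlongrightarrow> 0) (at 0)" for N :: "plane \<Rightarrow> real" and c
  proof -
    have "Zfun (\<lambda>p. (N p - c * W p) / (norm p)\<^sup>2 * ((norm p)\<^sup>2 / W p)) (at 0)"
      using that by (intro bounded_bilinear.Zfun_prod_Bfun[OF bounded_bilinear_mult _ bdd]) (simp add: tendsto_Zfun_iff)
    then have "((\<lambda>p. (N p - c * W p) / (norm p)\<^sup>2 * ((norm p)\<^sup>2 / W p)) \<longlongrightarrow> 0) (at 0)"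
      by (simp add: tendsto_Zfun_iff)
    moreover have "\<forall>\<^sub>F p in at 0. (N p - c * W p) / (norm p)\<^sup>2 * ((norm p)\<^sup>2 / W p) = N p / W p - c"
      using near
    proof eventually_elim
      case (elim p)
      have "X p \<noteq> 0"
      proof
        assume "X p = 0"
        then have "a * (norm p)\<^sup>2 \<le> 0" using d(2)[of p] elim by simp
        then show False using a elim by (simp add: mult_le_0_iff)
      qed
      then have "W p \<noteq> 0" using FX(10)[of p] elim by auto
      then show ?case using elim by (simp add: field_simps)
    qed
    ultimately have "((\<lambda>p. N p / W p - c) \<longlongrightarrow> 0) (at 0)" by (rule Lim_transform_eventually)
    then show ?thesis by (simp add: LIM_zero_iff)
  qed
  show "((\<lambda>p. cross (X p) (Y p) / W p) \<longlongrightarrow> - cos \<beta>) (at 0)"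
  proof (rule ratio)
    have "((\<lambda>p. (X p $ 1 * Y p $ 2 - A p $ 1 * B p $ 2) / (norm p)\<^sup>2
           - (X p $ 2 * Y p $ 1 - A p $ 2 * B p $ 1) / (norm p)\<^sup>2
           + cos \<beta> * ((X p $ 1 * X p $ 1 - A p $ 1 * A p $ 1) / (norm p)\<^sup>2
                    + (X p $ 2 * X p $ 2 - A p $ 2 * A p $ 2) / (norm p)\<^sup>2)) \<longlongrightarrow> 0 - 0 + cos \<beta> * (0 + 0)) (at 0)"
      by (intro tendsto_intros Q dX dY)
    then have lim: "((\<lambda>p. (X p $ 1 * Y p $ 2 - A p $ 1 * B p $ 2) / (norm p)\<^sup>2
           - (X p $ 2 * Y p $ 1 - A p $ 2 * B p $ 1) / (norm p)\<^sup>2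
           + cos \<beta> * ((X p $ 1 * X p $ 1 - A p $ 1 * A p $ 1) / (norm p)\<^sup>2
                    + (X p $ 2 * X p $ 2 - A p $ 2 * A p $ 2) / (norm p)\<^sup>2)) \<longlongrightarrow> 0) (at 0)" by simp
    show "((\<lambda>p. (cross (X p) (Y p) - - cos \<beta> * W p) / (norm p)\<^sup>2) \<longlongrightarrow> 0) (at 0)"
    proof (rule Lim_transform_eventually[OF lim eventually_mono[OF near]])
      fix p assume "p \<in> ball 0 \<rho> \<and> norm p < d \<and> p \<noteq> (0::plane)"
      then have W: "W p = X p $ 1 * X p $ 1 + X p $ 2 * X p $ 2" and p: "p \<noteq> 0" using W by auto
      show "(X p $ 1 * Y p $ 2 - A p $ 1 * B p $ 2) / (norm p)\<^sup>2
           - (X p $ 2 * Y p $ 1 - A p $ 2 * B p $ 1) / (norm p)\<^sup>2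
           + cos \<beta> * ((X p $ 1 * X p $ 1 - A p $ 1 * A p $ 1) / (norm p)\<^sup>2
                    + (X p $ 2 * X p $ 2 - A p $ 2 * A p $ 2) / (norm p)\<^sup>2)
          = (cross (X p) (Y p) - - cos \<beta> * W p) / (norm p)\<^sup>2"
        unfolding W cross_def A B using p by (simp add: field_simps)
    qed
  qed
  show "((\<lambda>p. X p \<bullet> Y p / W p) \<longlongrightarrow> sin \<beta>) (at 0)"
  proof (rule ratio)
    have "((\<lambda>p. (X p $ 1 * Y p $ 1 - A p $ 1 * B p $ 1) / (norm p)\<^sup>2
           + (X p $ 2 * Y p $ 2 - A p $ 2 * B p $ 2) / (norm p)\<^sup>2
           - sin \<beta> * ((X p $ 1 * X p $ 1 - A p $ 1 * A p $ 1) / (norm p)\<^sup>2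
                    + (X p $ 2 * X p $ 2 - A p $ 2 * A p $ 2) / (norm p)\<^sup>2)) \<longlongrightarrow> 0 + 0 - sin \<beta> * (0 + 0)) (at 0)"
      by (intro tendsto_intros Q dX dY)
    then have lim: "((\<lambda>p. (X p $ 1 * Y p $ 1 - A p $ 1 * B p $ 1) / (norm p)\<^sup>2
           + (X p $ 2 * Y p $ 2 - A p $ 2 * B p $ 2) / (norm p)\<^sup>2
           - sin \<beta> * ((X p $ 1 * X p $ 1 - A p $ 1 * A p $ 1) / (norm p)\<^sup>2
                    + (X p $ 2 * X p $ 2 - A p $ 2 * A p $ 2) / (norm p)\<^sup>2)) \<longlongrightarrow> 0) (at 0)" by simp
    show "((\<lambda>p. (X p \<bullet> Y p - sin \<beta> * W p) / (norm p)\<^sup>2) \<longlongrightarrow> 0) (at 0)"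
    proof (rule Lim_transform_eventually[OF lim eventually_mono[OF near]])
      fix p assume "p \<in> ball 0 \<rho> \<and> norm p < d \<and> p \<noteq> (0::plane)"
      then have W: "W p = X p $ 1 * X p $ 1 + X p $ 2 * X p $ 2" and p: "p \<noteq> 0" using W by auto
      show "(X p $ 1 * Y p $ 1 - A p $ 1 * B p $ 1) / (norm p)\<^sup>2
           + (X p $ 2 * Y p $ 2 - A p $ 2 * B p $ 2) / (norm p)\<^sup>2
           - sin \<beta> * ((X p $ 1 * X p $ 1 - A p $ 1 * A p $ 1) / (norm p)\<^sup>2
                    + (X p $ 2 * X p $ 2 - A p $ 2 * A p $ 2) / (norm p)\<^sup>2)
          = (X p \<bullet> Y p - sin \<beta> * W p) / (norm p)\<^sup>2"
        unfolding W inner_plane A B using p by (simp add: field_simps)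
    qed
  qed
qed

text \<open>At the origin \<open>X\<close> has the diagonal Jacobian with entries
  \<open>- l1\<close> and \<open>- l2\<close>: its quadratic form is at most \<open>- 2 * a\<close>
  times the squared norm, and its trace is \<open>- (l1 + l2)\<close>. Half of each constant is
  given up to extend the bounds to a small disc.\<close>

lemma gradient_field_near_0:
  assumes l: "l1 > 0" "l2 > 0" and \<rho>: "\<rho> > 0" and X: "field_data W \<rho> l1 l2 (pi/2) G X Xx Xy"
  shows "\<exists>r a b. 0 < r \<and> r < \<rho> \<and> 0 < a \<and> 0 < b \<and>
     (\<forall>p\<in>cball 0 r. X p \<bullet> p \<le> - a * (norm p)\<^sup>2 \<and> norm (X p) \<le> b * norm p \<and>
        Xx p $ 1 + Xy p $ 2 \<le> - ((l1 + l2) / 2))"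
proof -
  note FX = X[unfolded field_data_def]
  have 0: "(0::plane) \<in> ball 0 \<rho>" using \<rho> by simp
  define a where "a = min l1 l2 / 2"
  define b where "b = l1 + l2 + a"
  have a: "a > 0" "2 * a \<le> l1" "2 * a \<le> l2" and b: "b > 0" using l by (auto simp: a_def b_def)
  define A where "A = (\<lambda>h :: plane. h $ 1 *\<^sub>R Xx 0 + h $ 2 *\<^sub>R Xy 0)"
  have "(X has_derivative A) (at 0)" using FX 0 unfolding A_def by blast
  then obtain d where d: "d > 0" "\<And>p. norm (p - 0) < d \<Longrightarrow> norm (X p - X 0 - A (p - 0)) \<le> a * norm (p - 0)"
    unfolding has_derivative_at_alt using a(1) by blast
  have A: "A p $ 1 = - l1 * p $ 1" "A p $ 2 = - l2 * p $ 2" for p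
    using FX by (auto simp: A_def cos_pi_half)
  have rem: "norm (X p - A p) \<le> a * norm p" if "norm p < d" for p
    using d(2)[of p] that FX by simp
  have "continuous_on (ball 0 \<rho>) (\<lambda>p. Xx p $ 1 + Xy p $ 2)"
    using FX by (intro continuous_intros) auto
  then have "isCont (\<lambda>p. Xx p $ 1 + Xy p $ 2) 0"
    using 0 by (simp add: continuous_on_eq_continuous_at)
  then have "((\<lambda>p. Xx p $ 1 + Xy p $ 2) \<longlongrightarrow> - l1 - l2) (at 0)"
    using FX by (auto simp: isCont_def)
  then have "\<forall>\<^sub>F p in at 0. Xx p $ 1 + Xy p $ 2 < - ((l1 + l2) / 2)"
    by (rule order_tendstoD(2)) (use l in \<open>simp add: field_simps\<close>)
  then obtain e where e: "e > 0" "\<And>p. p \<noteq> 0 \<Longrightarrow> norm p < e \<Longrightarrow> Xx p $ 1 + Xy p $ 2 < - ((l1 + l2) / 2)"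
    unfolding eventually_at by (auto simp: dist_norm)
  define r where "r = min \<rho> (min d e) / 2"
  have r: "0 < r" "r < \<rho>" "r < d" "r < e" using \<rho> d(1) e(1) by (auto simp: r_def)
  have "X p \<bullet> p \<le> - a * (norm p)\<^sup>2 \<and> norm (X p) \<le> b * norm p \<and>
        Xx p $ 1 + Xy p $ 2 \<le> - ((l1 + l2) / 2)" if "p \<in> cball 0 r" for p
  proof (intro conjI)
    have p: "norm p < d" "norm p < e" using that r by auto
    have "X p \<bullet> p = A p \<bullet> p + (X p - A p) \<bullet> p" by (simp add: inner_simps)
    also have "(X p - A p) \<bullet> p \<le> norm (X p - A p) * norm p" by (rule norm_cauchy_schwarz)
    also have "\<dots> \<le> a * norm p * norm p" using rem[OF p(1)] by (rule mult_right_mono) simp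
    also have "A p \<bullet> p \<le> - (2 * a) * (norm p)\<^sup>2"
    proof -
      have "2 * a * (p $ 1)\<^sup>2 \<le> l1 * (p $ 1)\<^sup>2" "2 * a * (p $ 2)\<^sup>2 \<le> l2 * (p $ 2)\<^sup>2"
        using a by (intro mult_right_mono; simp)+
      then show ?thesis by (simp add: inner_plane A norm_plane power2_eq_square algebra_simps)
    qed
    finally show "X p \<bullet> p \<le> - a * (norm p)\<^sup>2" by (simp add: power2_eq_square)
    have "norm (X p) \<le> norm (X p - A p) + norm (A p)" by (metis norm_triangle_sub add.commute)
    also have "norm (A p) \<le> l1 * \<bar>p $ 1\<bar> + l2 * \<bar>p $ 2\<bar>"
      using norm_plane_le[of "A p"] l by (simp add: A abs_mult)
    also have "\<dots> \<le> l1 * norm p + l2 * norm p"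
      using l by (intro add_mono mult_left_mono component_le_norm_cart) auto
    also have "norm (X p - A p) \<le> a * norm p" using rem[OF p(1)] .
    finally show "norm (X p) \<le> b * norm p" by (simp add: b_def algebra_simps)
    show "Xx p $ 1 + Xy p $ 2 \<le> - ((l1 + l2) / 2)"
    proof (cases "p = 0")
      case True
      have "Xx 0 $ 1 + Xy 0 $ 2 = - l1 - l2" using FX by simp
      then show ?thesis using True l by (simp add: field_simps)
    qed (use e(2)[OF _ p(2)] in auto)
  qed
  with r a(1) b show ?thesis by blast
qed

lemma uniform_inward:
  assumes l: "l1 > 0" "l2 > 0" and \<rho>: "\<rho> > 0" and X: "field_data W \<rho> l1 l2 (pi/2) G X Xx Xy"
  shows "\<exists>r k \<kappa>. 0 < r \<and> r < \<rho> \<and> 0 < k \<and> 0 < \<kappa> \<and> \<kappa> < 1 \<and>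
    (\<forall>\<beta>\<in>{0<..<pi}. \<bar>cos \<beta>\<bar> \<le> \<kappa> \<longrightarrow> (\<forall>G' Y Yx Yy. field_data W \<rho> l1 l2 \<beta> G' Y Yx Yy \<longrightarrow>
       (\<forall>p\<in>cball 0 r. Y p \<bullet> p \<le> - k * (norm p)\<^sup>2) \<and>
       (cos \<beta> \<noteq> 0 \<longrightarrow> (\<exists>d>0. \<forall>p. 0 < norm p \<and> norm p < d \<longrightarrow> Y p \<noteq> X p))))"
proof -
  note FX = X[unfolded field_data_def]
  obtain r a b where r: "0 < r" "r < \<rho>" and a: "0 < a" and b: "0 < b"
    and Xr: "\<And>p. p \<in> cball 0 r \<Longrightarrow> X p \<bullet> p \<le> - a * (norm p)\<^sup>2 \<and> norm (X p) \<le> b * norm p \<and>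
        Xx p $ 1 + Xy p $ 2 \<le> - ((l1 + l2) / 2)"
    using gradient_field_near_0[OF l \<rho> X] by blast
  \<comment> \<open>\<open>s0 \<le> 1/2\<close> forces a cosine of at least 3/4, so 3/4 of the
    inward rate \<open>a\<close> is kept; \<open>s0 * b \<le> a / 4\<close> limits what the
    orthogonal component can take away. The rate \<open>a / 2\<close> remains.\<close>
  define s0 where "s0 = min (1/2) (a / (4 * b))"
  have s0: "0 < s0" "s0 \<le> 1/2" "s0 * b \<le> a / 4" using a b by (auto simp: s0_def min_def field_simps)
  have sub: "cball 0 r \<subseteq> ball (0 :: plane) \<rho>" using r by auto
  have *: "(\<forall>p\<in>cball 0 r. Y p \<bullet> p \<le> - (a/2) * (norm p)\<^sup>2) \<and>
       (cos \<beta> \<noteq> 0 \<longrightarrow> (\<exists>d>0. \<forall>p. 0 < norm p \<and> norm p < d \<longrightarrow> Y p \<noteq> X p))"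
    if \<beta>: "\<beta> \<in> {0<..<pi}" "\<bar>cos \<beta>\<bar> \<le> s0 / 4" and Y: "field_data W \<rho> l1 l2 \<beta> G' Y Yx Yy" for \<beta> G' Y Yx Yy
  proof -
    note FY = Y[unfolded field_data_def]
    have WX: "(norm (X p))\<^sup>2 = W p" and WY: "(norm (Y p))\<^sup>2 = W p" if "p \<in> cball 0 r" for p
      using FX FY that sub by blast+
    have cX: "continuous_on (cball 0 r) X" and cY: "continuous_on (cball 0 r) Y"
      using FX FY sub has_derivative_continuous
      by (meson continuous_at_imp_continuous_on subsetD)+
    have Wpos: "W p > 0" if "p \<in> cball 0 r" "p \<noteq> 0" for p
    proof -
      have "X p \<noteq> 0"
      proof
        assume "X p = 0"
        then have "a * (norm p)\<^sup>2 \<le> 0" using Xr[OF that(1)] by simp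
        then show False using a that by (simp add: mult_le_0_iff)
      qed
      then show ?thesis using WX[OF that(1)] by (metis zero_less_norm_iff zero_less_power)
    qed
    note lim = field_angle_limits[OF X Y \<rho> a r(1)]
    have lim1: "((\<lambda>p. cross (X p) (Y p) / W p) \<longlongrightarrow> - cos \<beta>) (at 0)"
      and lim2: "((\<lambda>p. X p \<bullet> Y p / W p) \<longlongrightarrow> sin \<beta>) (at 0)"
      by (rule lim; use Xr in simp)+
    \<comment> \<open>The strict bounds are to be proved; the weak ones of \<open>wgood\<close>
      survive limits and already imply the inward estimate.\<close>
    define good where "good p \<longleftrightarrow> \<bar>cross (X p) (Y p)\<bar> < s0 * W p \<and> X p \<bullet> Y p > 0" for p
    define wgood where "wgood p \<longleftrightarrow> \<bar>cross (X p) (Y p)\<bar> \<le> s0 * W p \<and> X p \<bullet> Y p \<ge> 0" for p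
    have wg: "X p \<bullet> Y p > 0" "Y p \<bullet> p \<le> - (a/2) * (norm p)\<^sup>2"
      if p: "p \<in> cball 0 r" "p \<noteq> 0" "wgood p" for p
    proof -
      have W: "W p > 0" using Wpos p by blast
      have "(cross (X p) (Y p))\<^sup>2 \<le> (1/2 * W p)\<^sup>2"
      proof -
        have "\<bar>cross (X p) (Y p)\<bar> \<le> s0 * W p" using p by (simp add: wgood_def)
        also have "\<dots> \<le> 1/2 * W p" using s0 W by (intro mult_right_mono) auto
        finally show ?thesis using W by (simp add: abs_le_square_iff[symmetric])
      qed
      then have "(3/4 * W p)\<^sup>2 \<le> (X p \<bullet> Y p)\<^sup>2"
        using cross_inner_sq[of "X p" "Y p"] WX[OF p(1)] WY[OF p(1)]
        by (simp add: power2_eq_square) (smt (verit) W mult_pos_pos)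
      then have i: "3/4 * W p \<le> X p \<bullet> Y p" using p(3) by (auto simp: wgood_def dest: power2_le_imp_le)
      then show "X p \<bullet> Y p > 0" using W by simp
      have Xp: "X p \<bullet> p \<le> - a * (norm p)\<^sup>2" "norm (X p) \<le> b * norm p" using Xr[OF p(1)] by auto
      have "W p * (Y p \<bullet> p) = (X p \<bullet> Y p) * (X p \<bullet> p) + cross (X p) (Y p) * cross (X p) p"
        using inner_via_cross[of "X p" "Y p" p] WX[OF p(1)] by simp
      also have "(X p \<bullet> Y p) * (X p \<bullet> p) \<le> (3/4 * W p) * (- a * (norm p)\<^sup>2)"
      proof -
        have "(3/4 * W p) * (a * (norm p)\<^sup>2) \<le> (X p \<bullet> Y p) * (- (X p \<bullet> p))"
          using i Xp(1) W a by (intro mult_mono) auto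
        then show ?thesis by simp
      qed
      also have "cross (X p) (Y p) * cross (X p) p \<le> (s0 * W p) * (b * norm p * norm p)"
      proof -
        have "cross (X p) (Y p) * cross (X p) p \<le> \<bar>cross (X p) (Y p)\<bar> * \<bar>cross (X p) p\<bar>"
          by (simp flip: abs_mult)
        also have "\<dots> \<le> (s0 * W p) * (norm (X p) * norm p)"
          using p(3) s0 W by (intro mult_mono cross_le) (auto simp: wgood_def)
        also have "\<dots> \<le> (s0 * W p) * (b * norm p * norm p)"
          using Xp(2) s0 W by (intro mult_left_mono mult_right_mono) auto
        finally show ?thesis .
      qed
      also have "(s0 * W p) * (b * norm p * norm p) = (s0 * b) * (W p * (norm p)\<^sup>2)"
        by (simp add: power2_eq_square)
      also have "\<dots> \<le> a/4 * (W p * (norm p)\<^sup>2)" using s0(3) W by (intro mult_right_mono) auto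
      finally have "W p * (Y p \<bullet> p) \<le> W p * (- (a/2) * (norm p)\<^sup>2)" by (simp add: algebra_simps)
      then show "Y p \<bullet> p \<le> - (a/2) * (norm p)\<^sup>2" using mult_le_cancel_left_pos[OF W] by blast
    qed
    have good: "good p" if p0: "p \<in> cball 0 r" "p \<noteq> 0" for p
    proof (rule ccontr)
      assume np: "\<not> good p"
      have "\<forall>\<^sub>F p in at 0. \<bar>cross (X p) (Y p) / W p\<bar> < s0 \<and> X p \<bullet> Y p / W p > 0"
      proof (rule eventually_conj)
        have "((\<lambda>p. \<bar>cross (X p) (Y p) / W p\<bar>) \<longlongrightarrow> \<bar>- cos \<beta>\<bar>) (at 0)" by (intro tendsto_intros lim1)
        then show "\<forall>\<^sub>F p in at 0. \<bar>cross (X p) (Y p) / W p\<bar> < s0"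
          by (rule order_tendstoD(2)) (use \<beta> s0 in auto)
        show "\<forall>\<^sub>F p in at 0. X p \<bullet> Y p / W p > 0"
          using lim2 by (rule order_tendstoD(1)) (use \<beta> sin_gt_zero in auto)
      qed
      then obtain d where d: "d > 0" "\<And>p. p \<noteq> 0 \<Longrightarrow> norm p < d \<Longrightarrow>
          \<bar>cross (X p) (Y p) / W p\<bar> < s0 \<and> X p \<bullet> Y p / W p > 0"
        unfolding eventually_at by (auto simp: dist_norm)
      have gd: "good p" if "p \<in> cball 0 r" "p \<noteq> 0" "norm p < d" for p
        using d(2)[OF that(2,3)] Wpos[OF that(1,2)] by (auto simp: good_def abs_div zero_less_divide_iff divide_less_eq)
      \<comment> \<open>The bad points, with \<open>(norm (X p))^2\<close> in place of
        \<open>W p\<close> so that continuity of the fields makes the set closed. By the choice of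
        \<open>d\<close> no bad point is lost by keeping \<open>d\<close> away from the origin, and
        0 itself is excluded.\<close>
      define B where "B = ({p \<in> cball 0 r. s0 * (norm (X p))\<^sup>2 \<le> \<bar>cross (X p) (Y p)\<bar>} \<union> {p \<in> cball 0 r. X p \<bullet> Y p \<le> 0})
          \<inter> {p \<in> cball 0 r. d \<le> norm p}"
      have Bbad: "q \<in> B \<longleftrightarrow> q \<in> cball 0 r \<and> q \<noteq> 0 \<and> \<not> good q" for q
      proof
        assume "q \<in> B"
        then have q: "q \<in> cball 0 r" "d \<le> norm q" "s0 * (norm (X q))\<^sup>2 \<le> \<bar>cross (X q) (Y q)\<bar> \<or> X q \<bullet> Y q \<le> 0"
          by (auto simp: B_def)
        then have "\<not> good q" using WX[OF q(1)] by (auto simp: good_def)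
        then show "q \<in> cball 0 r \<and> q \<noteq> 0 \<and> \<not> good q" using q d(1) by auto
      next
        assume q: "q \<in> cball 0 r \<and> q \<noteq> 0 \<and> \<not> good q"
        then have "d \<le> norm q" using gd[of q] by linarith
        moreover have "s0 * (norm (X q))\<^sup>2 \<le> \<bar>cross (X q) (Y q)\<bar> \<or> X q \<bullet> Y q \<le> 0"
          using q WX[of q] by (auto simp: good_def not_less)
        ultimately show "q \<in> B" using q by (auto simp: B_def)
      qed
      have "closed B"
        unfolding B_def cross_def using cX cY
        by (intro closed_Un closed_Int continuous_on_closed_Collect_le closed_cball continuous_intros)
      moreover have "B \<subseteq> cball 0 r" by (auto simp: B_def)
      ultimately have "compact B" using compact_Int_closed[OF compact_cball] by (metis inf.absorb_iff2)
      moreover have "B \<noteq> {}" using Bbad[of p] p0 np by blast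
      moreover have "continuous_on B norm" by (intro continuous_on_norm continuous_on_id)
      ultimately have "\<exists>p\<in>B. \<forall>q\<in>B. norm p \<le> norm q" by (intro continuous_attains_inf)
      then obtain p where p: "p \<in> B" "\<forall>q\<in>B. norm p \<le> norm q" by blast
      have pr: "p \<in> cball 0 r" "p \<noteq> 0" "\<not> good p" using p(1) Bbad by auto
      have below: "good q" if "norm q < norm p" "q \<noteq> 0" for q
      proof (rule ccontr)
        assume "\<not> good q"
        then have "q \<in> B" using Bbad[of q] that pr(1) by simp
        then show False using p(2) that(1) by fastforce
      qed
      \<comment> \<open>Points on the circle through \<open>p\<close> are approached along their
        rays from inside, where \<open>good\<close> holds; in the limit the weak bounds
        remain.\<close>
      have upto: "wgood q" if q: "q \<in> cball 0 (norm p)" "q \<noteq> 0" for q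
      proof -
        have qr: "q \<in> cball 0 r" using q pr by auto
        have "((\<lambda>t. t *\<^sub>R q) \<longlongrightarrow> 1 *\<^sub>R q) (at_left (1::real))" by (intro tendsto_intros)
        then have t: "((\<lambda>t. t *\<^sub>R q) \<longlongrightarrow> q) (at_left (1::real))" by simp
        have ev: "\<forall>\<^sub>F t in at_left (1::real). t \<in> {0<..<1}"
          by (rule eventually_at_leftI[of 0]) auto
        have in_cb: "t *\<^sub>R q \<in> cball 0 r" if "t \<in> {0<..<1}" for t
        proof -
          have "norm (t *\<^sub>R q) \<le> norm q" using that by (simp add: mult_left_le_one_le)
          then show ?thesis using qr by simp
        qed
        have ec: "\<forall>\<^sub>F t in at_left (1::real). t *\<^sub>R q \<in> cball 0 r"
          using ev by eventually_elim (rule in_cb)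
        have tX: "((\<lambda>t. X (t *\<^sub>R q)) \<longlongrightarrow> X q) (at_left 1)"
          by (rule continuous_on_tendsto_compose[OF cX t qr ec])
        have tY: "((\<lambda>t. Y (t *\<^sub>R q)) \<longlongrightarrow> Y q) (at_left 1)"
          by (rule continuous_on_tendsto_compose[OF cY t qr ec])
        have g: "\<forall>\<^sub>F t in at_left 1. good (t *\<^sub>R q) \<and> t *\<^sub>R q \<in> cball 0 r"
          using ev
        proof eventually_elim
          case (elim t)
          have "norm (t *\<^sub>R q) < norm q" using elim q(2) by simp
          then have "norm (t *\<^sub>R q) < norm p" using q(1) by simp
          then have "good (t *\<^sub>R q)" using q(2) elim by (intro below) auto
          then show ?case using in_cb[OF elim] by simp
        qed
        have gX: "\<forall>\<^sub>F t in at_left 1. \<bar>cross (X (t *\<^sub>R q)) (Y (t *\<^sub>R q))\<bar> \<le> s0 * (norm (X (t *\<^sub>R q)))\<^sup>2"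
          using g by eventually_elim (metis WX good_def less_imp_le)
        have gY: "\<forall>\<^sub>F t in at_left 1. 0 \<le> X (t *\<^sub>R q) \<bullet> Y (t *\<^sub>R q)"
          using g by eventually_elim (metis good_def less_imp_le)
        have "((\<lambda>t. s0 * (norm (X (t *\<^sub>R q)))\<^sup>2) \<longlongrightarrow> s0 * (norm (X q))\<^sup>2) (at_left 1)"
          by (intro tendsto_mult tendsto_power tendsto_norm tX tendsto_const)
        moreover have "((\<lambda>t. \<bar>cross (X (t *\<^sub>R q)) (Y (t *\<^sub>R q))\<bar>) \<longlongrightarrow> \<bar>cross (X q) (Y q)\<bar>) (at_left 1)"
          unfolding cross_def by (intro tendsto_rabs tendsto_diff tendsto_mult tendsto_vec_nth tX tY)
        ultimately have "\<bar>cross (X q) (Y q)\<bar> \<le> s0 * (norm (X q))\<^sup>2"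
          by (rule tendsto_le[OF trivial_limit_at_left_real _ _ gX])
        moreover have "0 \<le> X q \<bullet> Y q"
          by (rule tendsto_le[OF trivial_limit_at_left_real tendsto_inner[OF tX tY] tendsto_const gY])
        ultimately show ?thesis using WX[OF qr] by (simp add: wgood_def)
      qed
      have np: "0 < norm p" "norm p < \<rho>" "norm p \<le> r" using pr r by auto
      have m: "(l1 + l2) / 2 > 0" using l by simp
      \<comment> \<open>The bound \<open>\<bar>cos \<beta>\<bar> \<le> s0 / 4\<close> is tuned to
        this use: the curl is at most \<open>(l1 + l2) / 2 * (s0 / 2)\<close>, and
        \<open>(l1 + l2) / 2\<close> is the lower bound for minus the divergence of
        \<open>X\<close>.\<close>
      have "\<sigma> * (cross (X p) (Y p) / W p) \<le> s0 / 2" if \<sigma>: "\<bar>\<sigma>\<bar> = 1" for \<sigma>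
      proof (rule angle_max_principle[OF X Y np(1,2) _ m _ lim1 \<sigma>])
        show "Xx q $ 1 + Xy q $ 2 \<le> - ((l1 + l2) / 2)" if "q \<in> cball 0 (norm p)" for q
          using Xr[of q] that np by auto
        show "0 < W q \<and> 0 < X q \<bullet> Y q \<and> Y q \<bullet> q < 0" if "q \<in> cball 0 (norm p)" "q \<noteq> 0" for q
        proof -
          have qr: "q \<in> cball 0 r" using that np by auto
          have "0 < a / 2 * (norm q)\<^sup>2" using a that by simp
          then show ?thesis using wg[OF qr that(2) upto[OF that]] Wpos[OF qr that(2)] by auto
        qed
        show "\<bar>(l1 + l2) * cos \<beta>\<bar> \<le> (l1 + l2) / 2 * (s0 / 2)"
          using \<beta>(2) l mult_left_mono[OF \<beta>(2), of "l1 + l2"] by (simp add: abs_mult)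
      qed (use \<beta> s0 pr in auto)
      from this[of 1] this[of "-1"] have "\<bar>cross (X p) (Y p) / W p\<bar> \<le> s0 / 2" by (simp add: abs_le_iff)
      then have "\<bar>cross (X p) (Y p)\<bar> \<le> s0 / 2 * W p"
        using Wpos[OF pr(1,2)] by (simp add: abs_div divide_le_eq)
      also have "\<dots> < s0 * W p" using s0 Wpos[OF pr(1,2)] by simp
      finally have "good p" using wg(1)[OF pr(1,2)] upto[of p] pr by (simp add: good_def)
      then show False using pr by simp
    qed
    have "Y p \<bullet> p \<le> - (a/2) * (norm p)\<^sup>2" if "p \<in> cball 0 r" for p
    proof (cases "p = 0")
      case False
      have "wgood p" using good[OF that False] by (simp add: good_def wgood_def)
      from wg(2)[OF that False this] show ?thesis .
    qed simp
    moreover have "\<exists>d>0. \<forall>p. 0 < norm p \<and> norm p < d \<longrightarrow> Y p \<noteq> X p" if "cos \<beta> \<noteq> 0"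
    proof -
      have "\<forall>\<^sub>F p in at 0. cross (X p) (Y p) / W p \<noteq> 0"
        using lim1 that by (intro tendsto_imp_eventually_ne[OF lim1]) simp
      then obtain d where d: "d > 0" "\<And>p. p \<noteq> 0 \<Longrightarrow> norm p < d \<Longrightarrow> cross (X p) (Y p) / W p \<noteq> 0"
        unfolding eventually_at by (auto simp: dist_norm)
      have "Y p \<noteq> X p" if "0 < norm p" "norm p < d" for p
        using d(2)[of p] that by (auto simp: cross_def)
      with d(1) show ?thesis by blast
    qed
    ultimately show ?thesis by blast
  qed
  have pos: "0 < a/2" "0 < s0/4" "s0/4 < 1" using a s0 by auto
  show ?thesis
    by (rule exI[of _ r], rule exI[of _ "a/2"], rule exI[of _ "s0/4"])
       (intro conjI r pos ballI impI allI; use * in blast)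
qed

text \<open>What is kept of a field once its angle is under control. The index is the curl \<mu>
  rather than \<beta>, and \<open>r\<close> and \<open>k\<close> are meant to be common to a whole
  family.\<close>

definition calibrates ::
  "(plane \<Rightarrow> real) \<Rightarrow> real \<Rightarrow> real \<Rightarrow> real \<Rightarrow> (plane \<Rightarrow> real) \<Rightarrow> (plane \<Rightarrow> plane) \<Rightarrow> bool" where
  "calibrates W r k \<mu> G V \<longleftrightarrow>
     G 0 = 0 \<and> V 0 = 0 \<and> (\<exists>L. L-lipschitz_on (cball 0 r) V) \<and>
     (\<forall>p\<in>cball 0 r.
        (G has_derivative (\<lambda>h. V p \<bullet> h + \<mu> * (p $ 2 * h $ 1))) (at p) \<and>
        (norm (V p))\<^sup>2 = W p \<and> V p \<bullet> p \<le> - k * (norm p)\<^sup>2)"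

lemma field_data_lipschitz:
  assumes "field_data W \<rho> l1 l2 \<beta> G V Vx Vy" and r: "r < \<rho>"
  shows "\<exists>L. L-lipschitz_on (cball 0 r) V"
proof -
  note F = field_dataD[OF assms(1)]
  have sub: "cball 0 r \<subseteq> ball (0::plane) \<rho>" using r by auto
  have "bounded (Vx ` cball 0 r)" "bounded (Vy ` cball 0 r)"
    using F(5,6) sub by (meson compact_continuous_image compact_cball compact_imp_bounded continuous_on_subset)+
  then obtain B1 B2 where B: "\<And>p. p \<in> cball 0 r \<Longrightarrow> norm (Vx p) \<le> B1" "\<And>p. p \<in> cball 0 r \<Longrightarrow> norm (Vy p) \<le> B2"
    unfolding bounded_iff by (metis imageI)
  have "norm (V x - V y) \<le> (\<bar>B1\<bar> + \<bar>B2\<bar>) * norm (x - y)" if "x \<in> cball 0 r" "y \<in> cball 0 r" for x y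
  proof (rule differentiable_bound[OF convex_cball, where f'="\<lambda>p h. h $ 1 *\<^sub>R Vx p + h $ 2 *\<^sub>R Vy p"])
    fix p :: plane assume p: "p \<in> cball 0 r"
    show "(V has_derivative (\<lambda>h. h $ 1 *\<^sub>R Vx p + h $ 2 *\<^sub>R Vy p)) (at p within cball 0 r)"
      using F(8)[of p] p sub by (blast intro: has_derivative_at_withinI)
    show "onorm (\<lambda>h :: plane. h $ 1 *\<^sub>R Vx p + h $ 2 *\<^sub>R Vy p) \<le> \<bar>B1\<bar> + \<bar>B2\<bar>"
    proof (rule onorm_le)
      fix h :: plane
      have "norm (h $ 1 *\<^sub>R Vx p + h $ 2 *\<^sub>R Vy p) \<le> \<bar>h $ 1\<bar> * norm (Vx p) + \<bar>h $ 2\<bar> * norm (Vy p)"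
        by (rule order_trans[OF norm_triangle_ineq]) simp
      also have "\<dots> \<le> norm h * \<bar>B1\<bar> + norm h * \<bar>B2\<bar>"
        using B[OF p] by (intro add_mono mult_mono component_le_norm_cart) auto
      finally show "norm (h $ 1 *\<^sub>R Vx p + h $ 2 *\<^sub>R Vy p) \<le> (\<bar>B1\<bar> + \<bar>B2\<bar>) * norm h"
        by (simp add: algebra_simps)
    qed
  qed (use that in auto)
  then have "(\<bar>B1\<bar> + \<bar>B2\<bar>)-lipschitz_on (cball 0 r) V"
    by (intro lipschitz_onI) (auto simp: dist_norm)
  then show ?thesis by blast
qed

lemma calibration_family:
  fixes W :: "plane \<Rightarrow> real"
  assumes l: "l1 > 0" "l2 > 0" and \<rho>: "\<rho> > 0"
    and W: "\<forall>\<beta>\<in>{0<..<pi}. \<exists>g.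
           real_analytic_on g (ball 0 \<rho>) \<and>
           (\<exists>a. has_taylor_series g 0 a \<and> (\<forall>\<alpha>. multi_order \<alpha> < 3 \<longrightarrow> a \<alpha> = 0)) \<and>
           (\<forall>p\<in>ball 0 \<rho>. W p = (norm (gradient g p + Lambda l1 l2 \<beta> p))\<^sup>2)"
  shows "\<exists>r k m G V. 0 < r \<and> r < \<rho> \<and> 0 < k \<and> 0 < m \<and>
     (\<forall>\<mu>. \<bar>\<mu>\<bar> \<le> m \<longrightarrow> calibrates W r k \<mu> (G \<mu>) (V \<mu>)) \<and>
     (\<forall>\<mu>. \<bar>\<mu>\<bar> \<le> m \<longrightarrow> \<mu> \<noteq> 0 \<longrightarrow> (\<exists>d>0. \<forall>p. 0 < norm p \<and> norm p < d \<longrightarrow> V \<mu> p \<noteq> V 0 p))"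
proof -
  have "\<forall>\<beta>\<in>{0<..<pi}. \<exists>G V Vx Vy. field_data W \<rho> l1 l2 \<beta> G V Vx Vy"
  proof
    fix \<beta> assume "\<beta> \<in> {0<..<pi}"
    from W[rule_format, OF this] obtain g a where "real_analytic_on g (ball 0 \<rho>)"
      "has_taylor_series g 0 a" "\<forall>\<alpha>. multi_order \<alpha> < 3 \<longrightarrow> a \<alpha> = 0"
      "\<forall>p\<in>ball 0 \<rho>. W p = (norm (gradient g p + Lambda l1 l2 \<beta> p))\<^sup>2"
      by (elim exE conjE)
    from field_data_exists[OF \<rho> this] show "\<exists>G V Vx Vy. field_data W \<rho> l1 l2 \<beta> G V Vx Vy" .
  qed
  then obtain G V Vx Vy where F': "\<forall>\<beta>\<in>{0<..<pi}. field_data W \<rho> l1 l2 \<beta> (G \<beta>) (V \<beta>) (Vx \<beta>) (Vy \<beta>)"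
    unfolding bchoice_iff by (elim exE)
  note F = bspec[OF F']
  have p2: "pi / 2 \<in> {0<..<pi}" by simp
  from uniform_inward[OF l \<rho> F[OF p2]]
  obtain r k \<kappa> where r: "0 < r" "r < \<rho>" and k: "0 < k" and \<kappa>: "0 < \<kappa>" "\<kappa> < 1" and
    U': "\<forall>\<beta>\<in>{0<..<pi}. \<bar>cos \<beta>\<bar> \<le> \<kappa> \<longrightarrow> (\<forall>G' Y Yx Yy. field_data W \<rho> l1 l2 \<beta> G' Y Yx Yy \<longrightarrow>
       (\<forall>p\<in>cball 0 r. Y p \<bullet> p \<le> - k * (norm p)\<^sup>2) \<and>
       (cos \<beta> \<noteq> 0 \<longrightarrow> (\<exists>d>0. \<forall>p. 0 < norm p \<and> norm p < d \<longrightarrow> Y p \<noteq> V (pi/2) p)))"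
    by (elim exE conjE)
  note U = U'[rule_format]
  define m where "m = (l1 + l2) * \<kappa>"
  \<comment> \<open>Inverts \<open>\<mu> = (l1 + l2) * cos \<beta>\<close>:
    \<open>b 0 = pi/2\<close> is the gradient field, and \<open>\<bar>\<mu>\<bar> \<le> m\<close>
    means \<open>\<bar>cos (b \<mu>)\<bar> \<le> \<kappa>\<close>.\<close>
  define b where "b \<mu> = arccos (\<mu> / (l1 + l2))" for \<mu>
  have m: "0 < m" using l \<kappa> by (simp add: m_def)
  have b: "b \<mu> \<in> {0<..<pi}" "\<bar>cos (b \<mu>)\<bar> \<le> \<kappa>" "(l1 + l2) * cos (b \<mu>) = \<mu>" if "\<bar>\<mu>\<bar> \<le> m" for \<mu>
  proof -
    have z: "\<bar>\<mu> / (l1 + l2)\<bar> \<le> \<kappa>" using that l by (simp add: m_def field_simps)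
    then show "b \<mu> \<in> {0<..<pi}" unfolding b_def greaterThanLessThan_iff
      using \<kappa> by (intro arccos_lt_bounded) (simp_all only: abs_le_iff; linarith)+
    have c: "cos (b \<mu>) = \<mu> / (l1 + l2)" using z \<kappa> by (simp add: b_def cos_arccos_abs)
    show "\<bar>cos (b \<mu>)\<bar> \<le> \<kappa>" "(l1 + l2) * cos (b \<mu>) = \<mu>" using z l by (simp_all add: c)
  qed
  have b0: "b 0 = pi/2" by (simp add: b_def)
  have "calibrates W r k \<mu> (G (b \<mu>)) (V (b \<mu>))" if "\<bar>\<mu>\<bar> \<le> m" for \<mu>
  proof -
    note Fb = F[OF b(1)[OF that]]
    have sub: "p \<in> ball 0 \<rho>" if "p \<in> cball 0 r" for p :: plane using that r by auto
    have d: "(G (b \<mu>) has_derivative (\<lambda>h. V (b \<mu>) p \<bullet> h + \<mu> * (p $ 2 * h $ 1))) (at p)"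
      and n: "(norm (V (b \<mu>) p))\<^sup>2 = W p" if p: "p \<in> cball 0 r" for p
      using field_dataD(7)[OF Fb sub[OF p]] field_dataD(10)[OF Fb sub[OF p]]
      unfolding b(3)[OF \<open>\<bar>\<mu>\<bar> \<le> m\<close>] .
    have i: "V (b \<mu>) p \<bullet> p \<le> - k * (norm p)\<^sup>2" if p: "p \<in> cball 0 r" for p
      using U[OF b(1,2)[OF \<open>\<bar>\<mu>\<bar> \<le> m\<close>] Fb, THEN conjunct1] p by (rule bspec)
    show ?thesis
      unfolding calibrates_def
      by (intro conjI ballI d n i field_dataD(1,2)[OF Fb] field_data_lipschitz[OF Fb r(2)])
  qed
  moreover have "\<exists>d>0. \<forall>p. 0 < norm p \<and> norm p < d \<longrightarrow> V (b \<mu>) p \<noteq> V (b 0) p"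
    if "\<bar>\<mu>\<bar> \<le> m" "\<mu> \<noteq> 0" for \<mu>
  proof -
    have "cos (b \<mu>) \<noteq> 0" using b(3)[OF that(1)] that(2) by auto
    with U[OF b(1,2)[OF that(1)] F[OF b(1)[OF that(1)]], THEN conjunct2] show ?thesis
      unfolding b0 by (rule mp)
  qed
  ultimately have "(\<forall>\<mu>. \<bar>\<mu>\<bar> \<le> m \<longrightarrow> calibrates W r k \<mu> ((G \<circ> b) \<mu>) ((V \<circ> b) \<mu>)) \<and>
     (\<forall>\<mu>. \<bar>\<mu>\<bar> \<le> m \<longrightarrow> \<mu> \<noteq> 0 \<longrightarrow> (\<exists>d>0. \<forall>p. 0 < norm p \<and> norm p < d \<longrightarrow> (V \<circ> b) \<mu> p \<noteq> (V \<circ> b) 0 p))"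
    by simp
  with r k m show ?thesis
    by - (rule exI[of _ r], rule exI[of _ k], rule exI[of _ m], rule exI[of _ "G \<circ> b"],
        rule exI[of _ "V \<circ> b"], elim conjE, intro conjI; assumption)
qed

section \<open>Flows of Lipschitz vector fields\<close>

lemma has_integral_exp_mult:
  assumes "c \<noteq> 0" "0 \<le> s"
  shows "((\<lambda>u. exp (c * u)) has_integral (exp (c * s) - 1) / c) {0..s :: real}"
proof -
  have "((\<lambda>u. exp (c * u)) has_integral exp (c * s) / c - exp (c * 0) / c) {0..s}"
    using assms by (intro fundamental_theorem_of_calculus)
      (auto intro!: derivative_eq_intros simp flip: has_real_derivative_iff_has_vector_derivative)
  then show ?thesis by (simp add: diff_divide_distrib)
qed

text \<open>The fixed point argument runs in the sup norm of the curve damped by \<open>exp (- 2 K s)\<close>, which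
  makes the Picard operator a contraction on the whole half line at once.\<close>

lemma lipschitz_flow_exists:
  fixes V :: "'a::euclidean_space \<Rightarrow> 'a"
  assumes lip: "L-lipschitz_on UNIV V" and bdd: "\<And>y. norm (V y) \<le> M"
  obtains x where "x 0 = p" "\<And>s. s \<ge> 0 \<Longrightarrow> (x has_vector_derivative V (x s)) (at s within {0..})"
proof -
  \<comment> \<open>The contraction factor is \<open>L / (2 * K) \<le> 1/2\<close>, and
    \<open>K \<ge> 1\<close> bounds \<open>t * exp (- 2 * K * t)\<close> by 1.\<close>
  define K where "K = L + 1"
  have L: "0 \<le> L" using lip by (rule lipschitz_on_nonneg)
  then have K: "0 < K" "L \<le> K" "1 \<le> K" by (simp_all add: K_def)
  have M: "0 \<le> M" using bdd[of 0] norm_ge_zero[of "V 0"] by linarith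
  have cV: "continuous_on UNIV V" using lip by (rule lipschitz_on_continuous_on)
  \<comment> \<open>\<open>z\<close> is the damped unknown, the curve being
    \<open>exp (2 * K * s)\<close> times \<open>z\<close>. \<open>R\<close> damps the Picard
    integral \<open>Q z\<close> again and is constant for negative times, which yields a bounded
    continuous function on the line.\<close>
  define Q where "Q z s = p + integral {0..s} (\<lambda>u. V (exp (2*K*u) *\<^sub>R apply_bcontfun z u))" for z s
  define R where "R z s = exp (- 2*K*max 0 s) *\<^sub>R Q z (max 0 s)" for z s
  have ci: "continuous_on A (\<lambda>u. V (exp (2*K*u) *\<^sub>R apply_bcontfun z u))" for z A
    by (intro continuous_on_compose2[OF cV] continuous_intros) auto
  have ii: "(\<lambda>u. V (exp (2*K*u) *\<^sub>R apply_bcontfun z u)) integrable_on {0..s}" for z s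
    using integrable_continuous_interval[OF ci] .
  have R: "R z \<in> bcontfun" for z
  proof (rule bcontfun_normI)
    have cQ: "continuous_on {0..} (Q z)"
    proof -
      have cb: "continuous_on {0..b} (Q z)" for b
        unfolding Q_def by (intro continuous_intros indefinite_integral_continuous_1 ii)
      have "continuous (at s within {0..}) (Q z)" if "s \<ge> 0" for s
      proof -
        have "at s within {0..s+1} = at s within {0..}"
          by (rule at_within_nhd[of _ "{..<s+1}"]) (use that in auto)
        moreover have "continuous (at s within {0..s+1}) (Q z)"
          using cb[of "s+1"] that unfolding continuous_on_eq_continuous_within by simp
        ultimately show ?thesis by (simp only:)
      qed
      then show ?thesis by (simp add: continuous_on_eq_continuous_within)
    qed
    have "continuous_on UNIV (\<lambda>s. Q z (max 0 s))"
      by (rule continuous_on_compose2[OF cQ]) (auto intro!: continuous_intros)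
    then show "continuous_on UNIV (R z)" unfolding R_def by (intro continuous_intros)
    show "norm (R z s) \<le> norm p + M" for s
    proof -
      define t where "t = max 0 s"
      have t: "0 \<le> t" by (simp add: t_def)
      have "norm (integral {0..t} (\<lambda>u. V (exp (2*K*u) *\<^sub>R apply_bcontfun z u))) \<le> M * (t - 0)"
        using t by (intro integral_bound ci) (auto simp: bdd)
      then have "norm (Q z t) \<le> norm p + M * t"
        unfolding Q_def by (intro order_trans[OF norm_triangle_ineq]) simp
      then have "norm (R z s) \<le> exp (- 2*K*t) * (norm p + M * t)"
        by (simp add: R_def t_def)
      also have "\<dots> = exp (- 2*K*t) * norm p + M * (exp (- 2*K*t) * t)" by (simp add: algebra_simps)
      also have "\<dots> \<le> 1 * norm p + M * 1"
      proof (intro add_mono mult_right_mono mult_left_mono M)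
        show e: "exp (- 2*K*t) \<le> 1" using K t by simp
        have "t \<le> 2*K*t" using K t by (simp add: mult_le_cancel_right1)
        also have "\<dots> \<le> exp (2*K*t)" using exp_ge_add_one_self[of "2*K*t"] by linarith
        finally have "t * exp (- (2*K*t)) \<le> 1" by (simp add: exp_minus field_simps)
        then show "exp (- 2*K*t) * t \<le> 1" by (simp add: mult.commute)
      qed simp
      finally show ?thesis by simp
    qed
  qed
  define T where "T z = Bcontfun (R z)" for z
  have T: "apply_bcontfun (T z) = R z" for z using R by (simp add: T_def Bcontfun_inverse)
  have contr: "dist (T z) (T w) \<le> 1/2 * dist z w" for z w
  proof (rule dist_bound)
    fix s :: real
    define t where "t = max 0 s"
    have t: "0 \<le> t" by (simp add: t_def)
    define D where "D = dist z w"
    have D: "dist (apply_bcontfun z u) (apply_bcontfun w u) \<le> D" for u unfolding D_def by (rule dist_bounded)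
    have "dist (Q z t) (Q w t) = norm (integral {0..t} (\<lambda>u. V (exp (2*K*u) *\<^sub>R apply_bcontfun z u) - V (exp (2*K*u) *\<^sub>R apply_bcontfun w u)))"
      unfolding Q_def by (subst integral_diff[OF ii ii]) (simp add: dist_norm)
    also have "\<dots> \<le> integral {0..t} (\<lambda>u. L * D * exp (2*K*u))"
    proof (rule integral_norm_bound_integral)
      fix u
      have "norm (V (exp (2*K*u) *\<^sub>R apply_bcontfun z u) - V (exp (2*K*u) *\<^sub>R apply_bcontfun w u))
          \<le> L * norm (exp (2*K*u) *\<^sub>R apply_bcontfun z u - exp (2*K*u) *\<^sub>R apply_bcontfun w u)"
        using lipschitz_onD[OF lip] by (simp add: dist_norm)
      also have "\<dots> = L * (exp (2*K*u) * dist (apply_bcontfun z u) (apply_bcontfun w u))"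
        by (simp add: dist_norm flip: scaleR_diff_right)
      also have "\<dots> \<le> L * (exp (2*K*u) * D)" using L D by (intro mult_left_mono) auto
      finally show "norm (V (exp (2*K*u) *\<^sub>R apply_bcontfun z u) - V (exp (2*K*u) *\<^sub>R apply_bcontfun w u))
          \<le> L * D * exp (2*K*u)" by (simp add: mult_ac)
    qed (intro integrable_diff ii integrable_continuous_interval continuous_intros)+
    also have "\<dots> = L * D * ((exp (2*K*t) - 1) / (2*K))"
      using has_integral_mult_right[OF has_integral_exp_mult[of "2*K" t], of "L * D"] K t by (intro integral_unique) auto
    also have "\<dots> \<le> K * D * (exp (2*K*t) / (2*K))"
      using K L t by (intro mult_mono divide_right_mono) (auto simp: D_def)
    also have "\<dots> = exp (2*K*t) * (D / 2)" using K by simp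
    finally have *: "dist (Q z t) (Q w t) \<le> exp (2*K*t) * (D / 2)" .
    have "dist (R z s) (R w s) = exp (- (2*K*t)) * dist (Q z t) (Q w t)"
      by (simp add: R_def t_def dist_norm flip: scaleR_diff_right)
    also have "\<dots> \<le> exp (- (2*K*t)) * (exp (2*K*t) * (D / 2))" using * by (rule mult_left_mono) simp
    also have "\<dots> = D / 2" by (simp add: exp_minus)
    finally show "dist (apply_bcontfun (T z) s) (apply_bcontfun (T w) s) \<le> 1/2 * dist z w"
      by (simp add: T D_def)
  qed
  have "\<exists>!z. T z = z"
    by (rule banach_fix_type[of "1/2"]) (use contr in auto)
  then obtain z where z: "T z = z" by blast
  define x where "x s = exp (2*K * s) *\<^sub>R apply_bcontfun z s" for s
  have x: "x s = p + integral {0..s} (\<lambda>u. V (x u))" if "s \<ge> 0" for s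
  proof -
    have "x s = exp (2*K * s) *\<^sub>R R z s" using z T[of z] by (simp add: x_def)
    also have "\<dots> = Q z s" using that by (simp add: R_def flip: exp_add)
    finally show ?thesis by (simp add: Q_def x_def)
  qed
  have cx: "continuous_on A (\<lambda>u. V (x u))" for A unfolding x_def by (rule ci)
  show thesis
  proof
    show "x 0 = p" using x[of 0] by simp
    fix s :: real assume s: "s \<ge> 0"
    have "((\<lambda>s. p + integral {0..s} (\<lambda>u. V (x u))) has_vector_derivative 0 + V (x s)) (at s within {0..s+1})"
      using s by (intro has_vector_derivative_add has_vector_derivative_const integral_has_vector_derivative cx) auto
    then have "(x has_vector_derivative V (x s)) (at s within {0..s+1})"
      using s by (auto intro: has_vector_derivative_transform[of s "{0..s+1}"] simp: x)
    moreover have "at s within {0..s+1} = at s within {0..}"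
      by (rule at_within_nhd[of _ "{..<s+1}"]) (use s in auto)
    ultimately show "(x has_vector_derivative V (x s)) (at s within {0..})" by simp
  qed
qed

section \<open>Differential inequalities and flows that stay in a ball\<close>

lemma nonincreasing_from_derivative:
  fixes f f' :: "real \<Rightarrow> real"
  assumes "\<And>s. s \<ge> a \<Longrightarrow> (f has_real_derivative f' s) (at s within {a..})"
    and "\<And>s. s \<ge> a \<Longrightarrow> f' s \<le> 0" and "a \<le> s" "s \<le> t"
  shows "f t \<le> f s"
proof -
  have "(f' has_integral f t - f s) {s..t}"
    using assms(1,3,4) by (intro fundamental_theorem_of_calculus)
      (auto intro!: has_field_derivative_subset[OF assms(1)] simp flip: has_real_derivative_iff_has_vector_derivative)
  from has_integral_neg[OF this] have "0 \<le> - (f t - f s)"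
    by (rule has_integral_nonneg) (use assms in auto)
  then show ?thesis by simp
qed

definition flows :: "('a::real_normed_vector \<Rightarrow> 'a) \<Rightarrow> 'a \<Rightarrow> (real \<Rightarrow> 'a) \<Rightarrow> bool" where
  "flows V p x \<longleftrightarrow> x 0 = p \<and> (\<forall>s\<ge>0. (x has_vector_derivative V (x s)) (at s within {0..}))"

lemma has_real_derivative_inner_self:
  fixes x :: "real \<Rightarrow> 'a::real_inner"
  assumes "(x has_vector_derivative v) (at s within S)"
  shows "((\<lambda>s. (norm (x s))\<^sup>2) has_real_derivative 2 * (v \<bullet> x s)) (at s within S)"
proof -
  have "((\<lambda>s. x s \<bullet> x s) has_vector_derivative x s \<bullet> v + v \<bullet> x s) (at s within S)"
    using bounded_bilinear.has_vector_derivative[OF bounded_bilinear_inner assms assms] .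
  then show ?thesis
    by (simp add: power2_norm_eq_inner has_real_derivative_iff_has_vector_derivative inner_commute)
qed

text \<open>\<open>exp (c * s) * u s\<close> does not increase. \<open>u\<close> may be negative:
  for minus a squared norm the lemma bounds the decay from below.\<close>

lemma exp_decay:
  fixes u :: "real \<Rightarrow> real"
  assumes "\<And>s. s \<ge> 0 \<Longrightarrow> (u has_real_derivative u' s) (at s within {0..})"
    and "\<And>s. s \<ge> 0 \<Longrightarrow> u' s \<le> - c * u s" and "s \<ge> 0"
  shows "u s \<le> u 0 * exp (- c * s)"
proof -
  have "exp (c * s) * u s \<le> exp (c * 0) * u 0"
  proof (rule nonincreasing_from_derivative[where a=0 and f="\<lambda>s. exp (c * s) * u s"
        and f'="\<lambda>s. exp (c * s) * (c * u s + u' s)"])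
    show "((\<lambda>s. exp (c * s) * u s) has_real_derivative exp (c * s) * (c * u s + u' s)) (at s within {0..})"
      if "s \<ge> 0" for s
      by (rule derivative_eq_intros assms(1)[OF that] refl)+ (simp add: algebra_simps)
    show "exp (c * s) * (c * u s + u' s) \<le> 0" if "s \<ge> 0" for s
      using assms(2)[OF that] by (intro mult_nonneg_nonpos) auto
  qed (use assms(3) in auto)
  then show ?thesis by (simp add: exp_minus field_simps)
qed

lemma tendsto_exp_decay:
  fixes a b :: real
  assumes "b > 0"
  shows "((\<lambda>s. a * exp (- b * s)) \<longlongrightarrow> 0) at_top"
proof -
  have "filterlim (\<lambda>s. - b * s) at_bot at_top"
    using assms by (intro filterlim_tendsto_neg_mult_at_bot[OF tendsto_const]) (auto intro: filterlim_ident)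
  then have "((\<lambda>s. exp (- b * s)) \<longlongrightarrow> 0) at_top" by (rule filterlim_compose[OF exp_at_bot])
  from tendsto_mult_right_zero[OF this] show ?thesis .
qed

text \<open>Composing \<open>V\<close> with the projection onto the ball gives a bounded, globally
  Lipschitz field, which has a flow for all times. This flow cannot leave the ball, since
  \<open>V\<close> points inward on the sphere, so it is a flow of \<open>V\<close> itself; the
  inward bound makes the squared norm decay at rate \<open>2 * k\<close>.\<close>

lemma inward_flow_exists:
  fixes V :: "'a::euclidean_space \<Rightarrow> 'a"
  assumes r: "r > 0" and lip: "L-lipschitz_on (cball 0 r) V" and k: "k > 0"
    and inw: "\<And>p. p \<in> cball 0 r \<Longrightarrow> V p \<bullet> p \<le> - k * (norm p)\<^sup>2"
    and p: "p \<in> cball 0 r"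
  obtains x where "flows V p x" "\<And>s. s \<ge> 0 \<Longrightarrow> norm (x s) \<le> norm p * exp (- k * s)"
proof -
  define \<pi> where "\<pi> = closest_point (cball (0::'a) r)"
  have \<pi>: "\<pi> y \<in> cball 0 r" for y unfolding \<pi>_def using r by (intro closest_point_in_set) auto
  have \<pi>_id: "\<pi> y = y" if "y \<in> cball 0 r" for y unfolding \<pi>_def using that by (rule closest_point_self)
  have "dist (\<pi> x) (\<pi> y) \<le> dist x y" for x y
    unfolding \<pi>_def using r by (intro closest_point_lipschitz) auto
  then have "1-lipschitz_on UNIV \<pi>" by (intro lipschitz_onI) auto
  then have "(L * 1)-lipschitz_on UNIV (\<lambda>y. V (\<pi> y))"
    using \<pi> by (intro lipschitz_on_compose2) (auto intro: lipschitz_on_subset[OF lip])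
  moreover have "norm (V (\<pi> y)) \<le> norm (V 0) + L * r" for y
  proof -
    have "norm (V (\<pi> y) - V 0) \<le> L * norm (\<pi> y)"
      using lipschitz_onD[OF lip \<pi>, of 0 y] r by (simp add: dist_norm)
    also have "\<dots> \<le> L * r" using \<pi>[of y] lipschitz_on_nonneg[OF lip] by (intro mult_left_mono) auto
    finally show ?thesis using norm_triangle_sub[of "V (\<pi> y)" "V 0"] by linarith
  qed
  ultimately obtain x where x: "x 0 = p"
    "\<And>s. s \<ge> 0 \<Longrightarrow> (x has_vector_derivative V (\<pi> (x s))) (at s within {0..})"
    using lipschitz_flow_exists[of "L * 1" "\<lambda>y. V (\<pi> y)"] by metis
  have cx: "continuous_on {0..} x"
    using x(2) by (auto simp: continuous_on_eq_continuous_within intro: has_vector_derivative_continuous)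
  have inball: "norm (x s) \<le> r" if s: "s \<ge> 0" for s
  proof (rule ccontr)
    assume out: "\<not> ?thesis"
    \<comment> \<open>Its supremum is the last time up to \<open>s\<close> spent in the ball. The
      curve is then on the sphere by continuity, yet the negative derivative of the squared norm
      puts it inside right afterwards.\<close>
    define S where "S = {t \<in> {0..s}. norm (x t) \<le> r}"
    have cxs: "continuous_on {0..s} (\<lambda>t. norm (x t))"
      using cx by (intro continuous_intros) (auto intro: continuous_on_subset)
    have "0 \<in> S" using x(1) p s by (simp add: S_def)
    moreover have "closed S" unfolding S_def
      by (intro continuous_on_closed_Collect_le cxs continuous_intros)
    moreover have bS: "bdd_above S" unfolding S_def by (auto intro: bdd_aboveI[of _ s])
    ultimately have t: "Sup S \<in> S" by (intro closed_contains_Sup) auto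
    define t where "t = Sup S"
    have ts: "0 \<le> t" "t < s" "norm (x t) \<le> r" using t out by (auto simp: t_def S_def order.order_iff_strict)
    have above: "norm (x u) > r" if "t < u" "u \<le> s" for u
    proof (rule ccontr)
      assume "\<not> ?thesis"
      then have "u \<in> S" using that ts by (auto simp: S_def)
      then have "u \<le> t" unfolding t_def using bS by (rule cSup_upper)
      then show False using that by simp
    qed
    have "r \<le> norm (x t)"
    proof (rule ccontr)
      assume lt: "\<not> ?thesis"
      have "continuous (at t within {0..s}) (\<lambda>u. norm (x u))"
        using cxs ts by (simp add: continuous_on_eq_continuous_within)
      then obtain d where d: "d > 0" "\<And>u. u \<in> {0..s} \<Longrightarrow> dist u t < d \<Longrightarrow> dist (norm (x u)) (norm (x t)) < r - norm (x t)"
        using lt unfolding continuous_within_eps_delta by (metis diff_gt_0_iff_gt not_le)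
      define u where "u = t + min d (s - t) / 2"
      have u: "t < u" "u \<le> s" "dist u t < d" using d(1) ts by (auto simp: u_def dist_real_def min_def field_simps)
      have "dist (norm (x u)) (norm (x t)) < r - norm (x t)" using d(2)[of u] u ts by simp
      then show False using above[OF u(1,2)] by (simp add: dist_real_def)
    qed
    with ts have nt: "norm (x t) = r" by simp
    then have \<pi>t: "\<pi> (x t) = x t" by (intro \<pi>_id) simp
    have "((\<lambda>s. (norm (x s))\<^sup>2) has_real_derivative 2 * (V (\<pi> (x t)) \<bullet> x t)) (at t within {0..})"
      using has_real_derivative_inner_self[OF x(2)] ts by blast
    then have D: "((\<lambda>s. (norm (x s))\<^sup>2) has_real_derivative 2 * (V (x t) \<bullet> x t)) (at t within {0..})"
      by (simp add: \<pi>t)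
    have "V (x t) \<bullet> x t \<le> - k * r\<^sup>2" using inw[of "x t"] nt by simp
    also have "\<dots> < 0" using k r by simp
    finally have neg: "2 * (V (x t) \<bullet> x t) < 0" by simp
    obtain d where d: "d > 0" "\<And>h. h > 0 \<Longrightarrow> t + h \<in> {0..} \<Longrightarrow> h < d \<Longrightarrow> (norm (x (t + h)))\<^sup>2 < (norm (x t))\<^sup>2"
      using has_real_derivative_neg_dec_right[OF D neg] by blast
    define h where "h = min d (s - t) / 2"
    have h: "0 < h" "h < d" "h < s - t" using d(1) ts unfolding h_def by (auto simp: min_def field_simps)
    have "(norm (x (t + h)))\<^sup>2 < (norm (x t))\<^sup>2" using d(2)[of h] h ts by simp
    then have "norm (x (t + h)) < norm (x t)" by (rule power2_less_imp_less) simp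
    then show False using above[of "t + h"] h nt by simp
  qed
  have flow: "(x has_vector_derivative V (x s)) (at s within {0..})" if "s \<ge> 0" for s
    using x(2)[OF that] \<pi>_id[of "x s"] inball[OF that] by simp
  show thesis
  proof
    show "flows V p x" using x(1) flow by (simp add: flows_def)
    fix s :: real assume s: "s \<ge> 0"
    have "(norm (x s))\<^sup>2 \<le> (norm (x 0))\<^sup>2 * exp (- (2 * k) * s)"
    proof (rule exp_decay[OF _ _ s])
      fix s :: real assume s: "s \<ge> 0"
      show "((\<lambda>s. (norm (x s))\<^sup>2) has_real_derivative 2 * (V (x s) \<bullet> x s)) (at s within {0..})"
        using has_real_derivative_inner_self[OF flow[OF s]] .
      show "2 * (V (x s) \<bullet> x s) \<le> - (2 * k) * (norm (x s))\<^sup>2"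
        using inw[of "x s"] inball[OF s] by simp
    qed
    also have "\<dots> = (norm p * exp (- k * s))\<^sup>2"
      by (simp add: x(1) power_mult_distrib flip: exp_double)
    finally show "norm (x s) \<le> norm p * exp (- k * s)" by (rule power2_le_imp_le) simp
  qed
qed

lemma calibratesD:
  assumes "calibrates W r k \<mu> G V"
  shows "G 0 = 0" "V 0 = 0" "\<exists>L. L-lipschitz_on (cball 0 r) V"
    "p \<in> cball 0 r \<Longrightarrow> (G has_derivative (\<lambda>h. V p \<bullet> h + \<mu> * (p $ 2 * h $ 1))) (at p)"
    "p \<in> cball 0 r \<Longrightarrow> (norm (V p))\<^sup>2 = W p"
    "p \<in> cball 0 r \<Longrightarrow> V p \<bullet> p \<le> - k * (norm p)\<^sup>2"
  using assms unfolding calibrates_def by blast+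

section \<open>Orbits and their areas\<close>

text \<open>\<open>\<alpha> s\<close> is the area collected up to time \<open>s\<close> and
  \<open>A\<close> its limit. The constant \<open>c\<close> of the tail bound is a parameter because
  continuity in \<mu> needs one that serves all fields of the family.\<close>

definition orbit :: "real \<Rightarrow> real \<Rightarrow> (plane \<Rightarrow> plane) \<Rightarrow> plane \<Rightarrow> (real \<Rightarrow> plane) \<Rightarrow> (real \<Rightarrow> real) \<Rightarrow> real \<Rightarrow> bool" where
  "orbit k c V p x \<alpha> A \<longleftrightarrow> flows V p x \<and> \<alpha> 0 = 0 \<and>
     (\<forall>s\<ge>0. norm (x s) \<le> norm p * exp (- k * s) \<and>
        (\<alpha> has_real_derivative - (x s $ 2 * V (x s) $ 1)) (at s within {0..}) \<and>
        \<bar>\<alpha> s - A\<bar> \<le> c * exp (- (2 * k) * s))"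

lemma orbitD:
  assumes "orbit k c V p x \<alpha> A"
  shows "x 0 = p" "\<alpha> 0 = 0"
    "s \<ge> 0 \<Longrightarrow> (x has_vector_derivative V (x s)) (at s within {0..})"
    "s \<ge> 0 \<Longrightarrow> norm (x s) \<le> norm p * exp (- k * s)"
    "s \<ge> 0 \<Longrightarrow> (\<alpha> has_real_derivative - (x s $ 2 * V (x s) $ 1)) (at s within {0..})"
    "s \<ge> 0 \<Longrightarrow> \<bar>\<alpha> s - A\<bar> \<le> c * exp (- (2 * k) * s)"
  using assms unfolding orbit_def flows_def by blast+

lemma orbit_in_cball:
  assumes "orbit k c V p x \<alpha> A" and "k > 0" "p \<in> cball 0 r" "s \<ge> 0"
  shows "x s \<in> cball 0 r"
proof -
  have "norm (x s) \<le> norm p * exp (- k * s)" by (rule orbitD(4)[OF assms(1,4)])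
  also have "\<dots> \<le> norm p * 1" using assms by (intro mult_left_mono) auto
  finally show ?thesis using assms(3) by simp
qed

lemma orbit_area_bound:
  assumes "orbit k c V p x \<alpha> A"
  shows "\<bar>A\<bar> \<le> c"
  using orbitD(6)[OF assms, of 0] orbitD(2)[OF assms] by simp

lemma orbit_exists:
  assumes cal: "calibrates W r k \<mu> G V" and r: "r > 0" and k: "k > 0" and p: "p \<in> cball 0 r"
    and C: "C \<ge> 0" "\<And>q. q \<in> cball 0 r \<Longrightarrow> norm (V q) \<le> C * norm q"
  obtains x \<alpha> A where "orbit k (C * (norm p)\<^sup>2 / (2 * k)) V p x \<alpha> A"
proof -
  obtain L where L: "L-lipschitz_on (cball 0 r) V" using calibratesD(3)[OF cal] by blast
  obtain x where x: "flows V p x" and dec: "\<And>s. s \<ge> 0 \<Longrightarrow> norm (x s) \<le> norm p * exp (- k * s)"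
    using inward_flow_exists[OF r L k calibratesD(6)[OF cal] p] by blast
  have xin: "x s \<in> cball 0 r" if "s \<ge> 0" for s
  proof -
    have "norm (x s) \<le> norm p * exp (- k * s)" by (rule dec[OF that])
    also have "\<dots> \<le> norm p * 1" using k that by (intro mult_left_mono) auto
    finally show ?thesis using p by simp
  qed
  have cx: "continuous_on {0..} x"
    using x by (auto simp: flows_def continuous_on_eq_continuous_within intro: has_vector_derivative_continuous)
  have cV: "continuous_on (cball 0 r) V" using L by (rule lipschitz_on_continuous_on)
  have "continuous_on {0..} (\<lambda>s. V (x s))"
    by (rule continuous_on_compose2[OF cV cx]) (use xin in blast)
  then have cf: "continuous_on {0..} (\<lambda>s. - (x s $ 2 * V (x s) $ 1))"
    using cx by (intro continuous_intros)
  define \<alpha> where "\<alpha> s = integral {0..s} (\<lambda>s. - (x s $ 2 * V (x s) $ 1))" for s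
  have d\<alpha>: "(\<alpha> has_real_derivative - (x s $ 2 * V (x s) $ 1)) (at s within {0..})" if "s \<ge> 0" for s
  proof -
    have "(\<alpha> has_real_derivative - (x s $ 2 * V (x s) $ 1)) (at s within {0..s+1})"
      unfolding \<alpha>_def has_real_derivative_iff_has_vector_derivative
      by (rule integral_has_vector_derivative) (use that in \<open>auto intro: continuous_on_subset[OF cf]\<close>)
    moreover have "at s within {0..s+1} = at s within {0..}"
      by (rule at_within_nhd[of _ "{..<s+1}"]) (use that in auto)
    ultimately show ?thesis by simp
  qed
  define c where "c = C * (norm p)\<^sup>2 / (2 * k)"
  have c: "c \<ge> 0" using C k by (simp add: c_def)
  have bd: "\<bar>x s $ 2 * V (x s) $ 1\<bar> \<le> 2 * k * c * exp (- (2 * k) * s)" if "s \<ge> 0" for s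
  proof -
    have "\<bar>x s $ 2 * V (x s) $ 1\<bar> \<le> norm (x s) * norm (V (x s))"
      unfolding abs_mult by (intro mult_mono component_le_norm_cart) auto
    also have "\<dots> \<le> norm (x s) * (C * norm (x s))" by (intro mult_left_mono C xin that) auto
    also have "\<dots> = C * (norm (x s))\<^sup>2" by (simp add: power2_eq_square)
    also have "\<dots> \<le> C * (norm p * exp (- k * s))\<^sup>2"
      by (intro mult_left_mono power_mono dec that C) auto
    also have "\<dots> = 2 * k * c * exp (- (2 * k) * s)"
      using k by (simp add: c_def power_mult_distrib flip: exp_double)
    finally show ?thesis .
  qed
  \<comment> \<open>The derivative of \<alpha> is bounded by
    \<open>2 * k * c * exp (- (2 * k) * s)\<close>, which is minus the derivative of
    \<open>c * exp (- (2 * k) * s)\<close>. So \<open>up\<close> does not increase,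
    \<open>lo\<close> does not decrease, and \<open>A\<close> lies between them at every time, which
    is the tail bound.\<close>
  define up where "up s = \<alpha> s + c * exp (- (2 * k) * s)" for s
  define lo where "lo s = \<alpha> s - c * exp (- (2 * k) * s)" for s
  have up: "up t \<le> up s" if "0 \<le> s" "s \<le> t" for s t
  proof (rule nonincreasing_from_derivative[OF _ _ that])
    fix s :: real assume s: "s \<ge> 0"
    show "(up has_real_derivative - (x s $ 2 * V (x s) $ 1) + c * (exp (- (2 * k) * s) * (- (2 * k)))) (at s within {0..})"
      unfolding up_def by (rule derivative_eq_intros d\<alpha>[OF s] refl)+ simp
    show "- (x s $ 2 * V (x s) $ 1) + c * (exp (- (2 * k) * s) * (- (2 * k))) \<le> 0"
      using bd[OF s] by (simp add: abs_le_iff mult_ac)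
  qed
  have lo: "- lo t \<le> - lo s" if "0 \<le> s" "s \<le> t" for s t
  proof (rule nonincreasing_from_derivative[OF _ _ that])
    fix s :: real assume s: "s \<ge> 0"
    show "((\<lambda>s. - lo s) has_real_derivative (x s $ 2 * V (x s) $ 1) + c * (exp (- (2 * k) * s) * (- (2 * k)))) (at s within {0..})"
      unfolding lo_def by (rule derivative_eq_intros d\<alpha>[OF s] refl)+ simp
    show "(x s $ 2 * V (x s) $ 1) + c * (exp (- (2 * k) * s) * (- (2 * k))) \<le> 0"
      using bd[OF s] by (simp add: abs_le_iff mult_ac)
  qed
  have loup: "lo t \<le> up s" if "0 \<le> s" "0 \<le> t" for s t
  proof -
    have le: "lo u \<le> up u" for u using c by (simp add: lo_def up_def)
    show ?thesis
    proof (cases "s \<le> t")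
      case True
      then show ?thesis using le[of t] up[of s t] that by linarith
    next
      case False
      then show ?thesis using le[of s] lo[of t s] that by linarith
    qed
  qed
  define A where "A = Sup (lo ` {0..})"
  have bdd: "bdd_above (lo ` {0..})" using loup[of 0] by (intro bdd_aboveI[of _ "up 0"]) auto
  have "\<bar>\<alpha> s - A\<bar> \<le> c * exp (- (2 * k) * s)" if s: "s \<ge> 0" for s
  proof -
    have "lo s \<le> A" unfolding A_def using s bdd by (intro cSup_upper) auto
    moreover have "A \<le> up s" unfolding A_def using loup[OF s] by (intro cSup_least) auto
    ultimately show ?thesis by (simp add: lo_def up_def abs_le_iff)
  qed
  then have "orbit k c V p x \<alpha> A"
    using x dec d\<alpha> by (simp add: orbit_def \<alpha>_def)
  then show thesis using that by (simp add: c_def)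
qed

text \<open>Along an orbit of \<open>U\<close> the excess \<open>\<bar>U\<bar>\<^sup>2 - V \<bullet> U = \<bar>U - V\<bar>\<^sup>2 / 2\<close> of the calibration by \<open>V\<close>
  has an explicit primitive.\<close>

lemma calibration_excess:
  assumes V: "calibrates W r k \<mu> G V" and U: "calibrates W r k \<nu> H U" and k: "k > 0" and p: "p \<in> cball 0 r"
    and y: "orbit k c U p y \<beta> B"
  defines "D \<equiv> \<lambda>s. 2 * (H (y s) - G (y s) - (H p - G p) + (\<nu> - \<mu>) * \<beta> s)"
  shows "D 0 = 0"
    and "\<And>s. s \<ge> 0 \<Longrightarrow> (D has_real_derivative (norm (U (y s) - V (y s)))\<^sup>2) (at s within {0..})"
    and "\<And>s. s \<ge> 0 \<Longrightarrow> 0 \<le> D s"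
    and "\<And>s. s \<ge> 0 \<Longrightarrow> D s \<le> 2 * (G p - H p + (\<nu> - \<mu>) * B)"
proof -
  note yD = orbitD[OF y] and yin = orbit_in_cball[OF y k p]
  show D0: "D 0 = 0" by (simp add: D_def yD(1,2))
  show dD: "(D has_real_derivative (norm (U (y s) - V (y s)))\<^sup>2) (at s within {0..})" if s: "s \<ge> 0" for s
  proof -
    have chain: "((\<lambda>s. F (y s)) has_real_derivative Z (y s) \<bullet> U (y s) + \<omega> * (y s $ 2 * U (y s) $ 1)) (at s within {0..})"
      if "calibrates W r k \<omega> F Z" for \<omega> F Z
    proof -
      have "(F has_derivative (\<lambda>h. Z (y s) \<bullet> h + \<omega> * (y s $ 2 * h $ 1))) (at (y s))"
        by (rule calibratesD(4)[OF that yin[OF s]])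
      from has_derivative_compose[OF yD(3)[OF s, unfolded has_vector_derivative_def] this]
      show ?thesis unfolding has_field_derivative_def
        by (rule has_derivative_eq_rhs) (auto simp: fun_eq_iff algebra_simps)
    qed
    have "(D has_real_derivative 2 * ((U (y s) \<bullet> U (y s) + \<nu> * (y s $ 2 * U (y s) $ 1))
        - (V (y s) \<bullet> U (y s) + \<mu> * (y s $ 2 * U (y s) $ 1)) - 0 + (\<nu> - \<mu>) * (- (y s $ 2 * U (y s) $ 1)))) (at s within {0..})"
      unfolding D_def
      by (rule derivative_eq_intros chain[OF V] chain[OF U] yD(5)[OF s] refl)+ simp
    \<comment> \<open>The area terms cancel: the two potentials contribute \<nu> and
      \<open>- \<mu>\<close>, the last summand minus their sum. Equal lengths of the fields complete
      the square.\<close>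
    moreover have "2 * ((U (y s) \<bullet> U (y s) + \<nu> * (y s $ 2 * U (y s) $ 1))
        - (V (y s) \<bullet> U (y s) + \<mu> * (y s $ 2 * U (y s) $ 1)) - 0 + (\<nu> - \<mu>) * (- (y s $ 2 * U (y s) $ 1)))
        = (norm (U (y s) - V (y s)))\<^sup>2"
    proof -
      have "U (y s) \<bullet> U (y s) = V (y s) \<bullet> V (y s)"
        using calibratesD(5)[OF V yin[OF s]] calibratesD(5)[OF U yin[OF s]] by (simp add: power2_norm_eq_inner)
      then show ?thesis by (simp add: power2_norm_eq_inner inner_simps inner_commute algebra_simps)
    qed
    ultimately show ?thesis by simp
  qed
  have mono: "D s \<le> D t" if "0 \<le> s" "s \<le> t" for s t
  proof -
    have "- D t \<le> - D s"
      by (rule nonincreasing_from_derivative[OF DERIV_minus[OF dD] _ that]) auto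
    then show ?thesis by simp
  qed
  show "0 \<le> D s" if "s \<ge> 0" for s using mono[of 0 s] D0 that by simp
  \<comment> \<open>By monotonicity \<open>D s\<close> is at most its limit, where the orbit has
    arrived at the origin and both potentials vanish.\<close>
  show "D s \<le> 2 * (G p - H p + (\<nu> - \<mu>) * B)" if s: "s \<ge> 0" for s
  proof (rule tendsto_lowerbound[where F=at_top])
    have y0: "(y \<longlongrightarrow> 0) at_top"
      by (rule Lim_null_comparison[OF _ tendsto_exp_decay[OF k, of "norm p"]])
         (use yD(4) in \<open>auto intro!: eventually_at_top_linorderI[of 0]\<close>)
    have "((\<lambda>s. \<beta> s - B) \<longlongrightarrow> 0) at_top"
      by (rule Lim_null_comparison[OF _ tendsto_exp_decay[of "2 * k" c]])
         (use yD(6) k in \<open>auto intro!: eventually_at_top_linorderI[of 0]\<close>)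
    then have \<beta>: "(\<beta> \<longlongrightarrow> B) at_top" by (simp add: LIM_zero_iff)
    have lim0: "((\<lambda>s. F (y s)) \<longlongrightarrow> 0) at_top" if "calibrates W r k \<omega> F Z" for \<omega> F Z
    proof -
      have "(0::plane) \<in> cball 0 r" using p norm_ge_zero[of p] by (simp del: norm_ge_zero)
      then have "isCont F 0" using calibratesD(4)[OF that] has_derivative_continuous by blast
      from isCont_tendsto_compose[OF this y0] show ?thesis using calibratesD(1)[OF that] by simp
    qed
    have "(D \<longlongrightarrow> 2 * (0 - 0 - (H p - G p) + (\<nu> - \<mu>) * B)) at_top"
      unfolding D_def by (intro tendsto_intros lim0[OF V] lim0[OF U] \<beta>)
    then show "(D \<longlongrightarrow> 2 * (G p - H p + (\<nu> - \<mu>) * B)) at_top" by simp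
    show "\<forall>\<^sub>F t in at_top. D s \<le> D t" using mono[OF s] by (rule eventually_at_top_linorderI)
  qed simp
qed

lemma calibration_excess_nonneg:
  assumes "calibrates W r k \<mu> G V" "calibrates W r k \<nu> H U" "k > 0" "p \<in> cball 0 r" "orbit k c U p y \<beta> B"
  shows "0 \<le> G p - H p + (\<nu> - \<mu>) * B"
  using order_trans[OF calibration_excess(3)[OF assms order_refl] calibration_excess(4)[OF assms order_refl]]
  by simp

text \<open>At a time when the fields differ the excess has positive derivative, so it is positive
  right afterwards; the limit of the excess is an upper bound for it.\<close>

lemma calibration_excess_pos:
  assumes V: "calibrates W r k \<mu> G V" and U: "calibrates W r k \<nu> H U" and k: "k > 0" and p: "p \<in> cball 0 r"
    and y: "orbit k c U p y \<beta> B" and ne: "s \<ge> 0" "U (y s) \<noteq> V (y s)"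
  shows "0 < G p - H p + (\<nu> - \<mu>) * B"
proof -
  note E = calibration_excess[OF V U k p y]
  have "0 < (norm (U (y s) - V (y s)))\<^sup>2" using ne(2) by simp
  from has_real_derivative_pos_inc_right[OF E(2)[OF ne(1)] this]
  obtain d where d: "d > 0" "\<forall>h>0. s + h \<in> {0..} \<longrightarrow> h < d \<longrightarrow>
    2 * (H (y s) - G (y s) - (H p - G p) + (\<nu> - \<mu>) * \<beta> s)
    < 2 * (H (y (s + h)) - G (y (s + h)) - (H p - G p) + (\<nu> - \<mu>) * \<beta> (s + h))"
    by blast
  have "s + d/2 \<ge> 0" using d(1) ne(1) by simp
  then show ?thesis using d(2)[rule_format, of "d/2"] d(1) E(3)[OF ne(1)] E(4)[of "s + d/2"] by simp
qed

text \<open>By \<open>exp_decay\<close> for minus the squared norm, the norm decays at most like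
  \<open>exp (- C * s)\<close>. An orbit thus passes through arbitrarily small nonzero points, where
  \<open>V \<mu>\<close> and \<open>V 0\<close> are known to differ for
  \<open>\<mu> \<noteq> 0\<close>.\<close>

lemma orbit_nonzero:
  assumes V: "calibrates W r k \<mu> G V" and k: "k > 0" and p: "p \<in> cball 0 r" "p \<noteq> 0" and y: "orbit k c V p y \<beta> B"
    and C: "\<And>q. q \<in> cball 0 r \<Longrightarrow> norm (V q) \<le> C * norm q" and s: "s \<ge> 0"
  shows "y s \<noteq> 0"
proof -
  have "- (norm (y s))\<^sup>2 \<le> - (norm (y 0))\<^sup>2 * exp (- (2 * C) * s)"
  proof (rule exp_decay[OF _ _ s])
    fix s :: real assume s: "s \<ge> 0"
    show "((\<lambda>s. - (norm (y s))\<^sup>2) has_real_derivative - (2 * (V (y s) \<bullet> y s))) (at s within {0..})"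
      by (intro DERIV_minus has_real_derivative_inner_self orbitD(3)[OF y s])
    have "- (V (y s) \<bullet> y s) \<le> norm (V (y s)) * norm (y s)" using Cauchy_Schwarz_ineq2[of "V (y s)" "y s"] by linarith
    also have "\<dots> \<le> C * norm (y s) * norm (y s)"
      by (intro mult_right_mono C orbit_in_cball[OF y k p(1) s]) auto
    finally show "- (2 * (V (y s) \<bullet> y s)) \<le> - (2 * C) * - (norm (y s))\<^sup>2" by (simp add: power2_eq_square)
  qed
  moreover have "0 < (norm p)\<^sup>2 * exp (- (2 * C) * s)" using p by simp
  ultimately show ?thesis using orbitD(1)[OF y] by auto
qed

text \<open>Gronwall for the squared distance of the orbits plus the squared difference of the
  running areas. \<open>U\<close> is compared with \<open>V\<close> at points of the orbit of
  \<open>U\<close>, where the squared difference is the derivative of the excess; its total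
  contribution is thus controlled by the final excess, and the only Lipschitz constant that occurs
  is that of \<open>V\<close>.\<close>

lemma orbit_area_difference:
  assumes V: "calibrates W r k \<mu> G V" and U: "calibrates W r k \<nu> H U" and k: "k > 0" and p: "p \<in> cball 0 r"
    and x: "orbit k c V p x \<alpha> A" and y: "orbit k c U p y \<beta> B"
    and L: "L-lipschitz_on (cball 0 r) V" and T: "T \<ge> 0"
  shows "(\<beta> T - \<alpha> T)\<^sup>2 \<le> exp ((1 + 2 * L + 2 * r * L) * T) * ((1 + r\<^sup>2) * (2 * (G p - H p + (\<nu> - \<mu>) * B)))"
proof -
  note xD = orbitD[OF x] and xin = orbit_in_cball[OF x k p] and yD = orbitD[OF y] and yin = orbit_in_cball[OF y k p]
  define D where "D = (\<lambda>s. 2 * (H (y s) - G (y s) - (H p - G p) + (\<nu> - \<mu>) * \<beta> s))"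
  have E: "D 0 = 0" "\<And>s. s \<ge> 0 \<Longrightarrow> (D has_real_derivative (norm (U (y s) - V (y s)))\<^sup>2) (at s within {0..})"
    "D T \<le> 2 * (G p - H p + (\<nu> - \<mu>) * B)"
    unfolding D_def using calibration_excess(1,2)[OF V U k p y] calibration_excess(4)[OF V U k p y T] by blast+
  have r: "r \<ge> 0" using p norm_ge_zero[of p] unfolding mem_cball_0 by linarith
  have L0: "L \<ge> 0" using L by (rule lipschitz_on_nonneg)
  \<comment> \<open>Both constants come from the estimate of \<open>u'\<close> below, where mixed
    products are split by \<open>2 * e * d \<le> e^2 + d^2\<close>; \<open>M\<close> collects the
    coefficients \<open>1\<close> and \<open>r^2\<close> of \<open>e^2\<close>.\<close>
  define K where "K = 1 + 2 * L + 2 * r * L"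
  have K: "K \<ge> 0" using r L0 by (simp add: K_def)
  define u where "u s = (norm (y s - x s))\<^sup>2 + (\<beta> s - \<alpha> s)\<^sup>2" for s
  define M where "M = 1 + r\<^sup>2"
  define u' where "u' s = 2 * ((U (y s) - V (x s)) \<bullet> (y s - x s))
      + 2 * (\<beta> s - \<alpha> s) * (- (y s $ 2 * U (y s) $ 1) + (x s $ 2 * V (x s) $ 1))" for s
  have du: "(u has_real_derivative u' s) (at s within {0..})" if s: "s \<ge> 0" for s
    unfolding u_def u'_def
    by (rule derivative_eq_intros has_real_derivative_inner_self has_vector_derivative_diff
        xD(3)[OF s] yD(3)[OF s] xD(5)[OF s] yD(5)[OF s] refl)+ simp
  have bound: "u' s \<le> K * u s + M * (norm (U (y s) - V (y s)))\<^sup>2" if s: "s \<ge> 0" for s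
  proof -
    define e where "e = norm (U (y s) - V (y s))"
    define d where "d = norm (y s - x s)"
    define \<Delta> where "\<Delta> = \<beta> s - \<alpha> s"
    have ed: "0 \<le> e" "0 \<le> d" by (simp_all add: e_def d_def)
    have Vd: "norm (V (y s) - V (x s)) \<le> L * d"
      using lipschitz_onD[OF L yin[OF s] xin[OF s]] by (simp add: d_def dist_norm)
    have "0 \<in> cball (0::plane) r" using r by simp
    from lipschitz_onD[OF L xin[OF s] this] have Vx: "norm (V (x s)) \<le> L * norm (x s)"
      by (simp add: calibratesD(2)[OF V])
    have "norm (V (x s)) \<le> L * r"
      using xin[OF s] L0 by (intro order_trans[OF Vx] mult_left_mono) auto
    have UV: "norm (U (y s) - V (x s)) \<le> e + L * d"
      using norm_triangle_ineq[of "U (y s) - V (y s)" "V (y s) - V (x s)"] Vd by (simp add: e_def)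
    have 1: "(U (y s) - V (x s)) \<bullet> (y s - x s) \<le> (e + L * d) * d"
      unfolding d_def by (rule order_trans[OF norm_cauchy_schwarz mult_right_mono]) (use UV in \<open>simp_all add: d_def\<close>)
    have "\<bar>- (y s $ 2 * U (y s) $ 1) + (x s $ 2 * V (x s) $ 1)\<bar>
       = \<bar>y s $ 2 * (U (y s) - V (x s)) $ 1 + (y s - x s) $ 2 * V (x s) $ 1\<bar>"
      by (simp add: algebra_simps abs_minus_commute)
    also have "\<dots> \<le> \<bar>y s $ 2\<bar> * \<bar>(U (y s) - V (x s)) $ 1\<bar> + \<bar>(y s - x s) $ 2\<bar> * \<bar>V (x s) $ 1\<bar>"
      by (rule order_trans[OF abs_triangle_ineq]) (simp add: abs_mult)
    also have "\<dots> \<le> r * (e + L * d) + d * (L * r)"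
    proof (intro add_mono mult_mono)
      show "\<bar>y s $ 2\<bar> \<le> r" using yin[OF s] component_le_norm_cart[of "y s" 2] by simp
      show "\<bar>(U (y s) - V (x s)) $ 1\<bar> \<le> e + L * d" using UV component_le_norm_cart[of "U (y s) - V (x s)" 1] by linarith
      show "\<bar>(y s - x s) $ 2\<bar> \<le> d" unfolding d_def by (rule component_le_norm_cart)
      show "\<bar>V (x s) $ 1\<bar> \<le> L * r" using \<open>norm (V (x s)) \<le> L * r\<close> component_le_norm_cart[of "V (x s)" 1] by linarith
    qed (use r ed in auto)
    also have "\<dots> = r * e + 2 * r * L * d" by (simp add: algebra_simps)
    finally have 2: "\<bar>- (y s $ 2 * U (y s) $ 1) + (x s $ 2 * V (x s) $ 1)\<bar> \<le> r * e + 2 * r * L * d" .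
    have "2 * \<Delta> * (- (y s $ 2 * U (y s) $ 1) + (x s $ 2 * V (x s) $ 1)) \<le> 2 * (\<bar>\<Delta>\<bar> * (r * e + 2 * r * L * d))"
    proof -
      have "\<Delta> * (- (y s $ 2 * U (y s) $ 1) + (x s $ 2 * V (x s) $ 1)) \<le> \<bar>\<Delta>\<bar> * \<bar>- (y s $ 2 * U (y s) $ 1) + (x s $ 2 * V (x s) $ 1)\<bar>"
        by (simp flip: abs_mult)
      also have "\<dots> \<le> \<bar>\<Delta>\<bar> * (r * e + 2 * r * L * d)" by (rule mult_left_mono[OF 2]) simp
      finally show ?thesis by simp
    qed
    then have "u' s \<le> 2 * ((e + L * d) * d) + 2 * (\<bar>\<Delta>\<bar> * (r * e + 2 * r * L * d))"
      using 1 by (simp add: u'_def \<Delta>_def)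
    also have "\<dots> = 2 * e * d + 2 * L * d\<^sup>2 + 2 * \<bar>\<Delta>\<bar> * (r * e) + 2 * r * L * (2 * \<bar>\<Delta>\<bar> * d)"
      by (simp add: power2_eq_square algebra_simps)
    also have "\<dots> \<le> (e\<^sup>2 + d\<^sup>2) + 2 * L * d\<^sup>2 + (\<Delta>\<^sup>2 + (r * e)\<^sup>2) + 2 * r * L * (\<Delta>\<^sup>2 + d\<^sup>2)"
      using sum_squares_bound[of e d] sum_squares_bound[of "\<bar>\<Delta>\<bar>" "r * e"] sum_squares_bound[of "\<bar>\<Delta>\<bar>" d] r L0
      by (intro add_mono mult_left_mono) auto
    also have "\<dots> = K * (d\<^sup>2 + \<Delta>\<^sup>2) + M * e\<^sup>2 - 2 * L * \<Delta>\<^sup>2"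
      by (simp add: K_def M_def power_mult_distrib algebra_simps)
    also have "\<dots> \<le> K * (d\<^sup>2 + \<Delta>\<^sup>2) + M * e\<^sup>2" using L0 by simp
    finally show ?thesis by (simp add: u_def d_def \<Delta>_def e_def)
  qed
  \<comment> \<open>Subtracting \<open>M * D\<close> absorbs the source term, as the damping factor
    is at most 1.\<close>
  have "exp (- K * T) * u T - M * D T \<le> exp (- K * 0) * u 0 - M * D 0"
  proof (rule nonincreasing_from_derivative[where a=0 and f="\<lambda>s. exp (- K * s) * u s - M * D s"
        and f'="\<lambda>s. exp (- K * s) * (u' s - K * u s) - M * (norm (U (y s) - V (y s)))\<^sup>2"])
    fix s :: real assume s: "0 \<le> s"
    show "((\<lambda>s. exp (- K * s) * u s - M * D s) has_real_derivative
        exp (- K * s) * (u' s - K * u s) - M * (norm (U (y s) - V (y s)))\<^sup>2) (at s within {0..})"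
      by (rule derivative_eq_intros du[OF s] E(2)[OF s] refl)+ (simp add: algebra_simps)
    have "exp (- K * s) * (u' s - K * u s) \<le> exp (- K * s) * (M * (norm (U (y s) - V (y s)))\<^sup>2)"
      using bound[OF s] by (intro mult_left_mono) auto
    also have "\<dots> \<le> 1 * (M * (norm (U (y s) - V (y s)))\<^sup>2)"
      using K s by (intro mult_right_mono) (auto simp: M_def)
    finally show "exp (- K * s) * (u' s - K * u s) - M * (norm (U (y s) - V (y s)))\<^sup>2 \<le> 0" by simp
  qed (use T in auto)
  then have "exp (- K * T) * u T \<le> M * D T"
    using E(1) xD(1,2) yD(1,2) by (simp add: u_def)
  then have "u T \<le> exp (K * T) * (M * D T)" by (simp add: exp_minus field_simps)
  also have "\<dots> \<le> exp (K * T) * (M * (2 * (G p - H p + (\<nu> - \<mu>) * B)))"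
    using E(3) by (intro mult_left_mono) (auto simp: M_def)
  finally have "u T \<le> exp (K * T) * (M * (2 * (G p - H p + (\<nu> - \<mu>) * B)))" .
  moreover have "(\<beta> T - \<alpha> T)\<^sup>2 \<le> u T" by (simp add: u_def)
  ultimately show ?thesis by (simp add: K_def M_def)
qed

text \<open>The excess of the \<nu> orbit against the \<mu> calibration and the one with the roles
  exchanged are both nonnegative and add up to \<open>(\<nu> - \<mu>) * (P \<nu> - P \<mu>)\<close>.
  This bounds each by the parameter gap times \<open>2 * c\<close>, although nothing is known on how
  \<open>G\<close> and \<open>V\<close> vary with the parameter.\<close>

lemma orbit_area_continuous:
  assumes cal: "\<And>\<mu>. \<bar>\<mu>\<bar> \<le> m \<Longrightarrow> calibrates W r k \<mu> (G \<mu>) (V \<mu>)" and k: "k > 0" and p: "p \<in> cball 0 r"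
    and orb: "\<And>\<mu>. \<bar>\<mu>\<bar> \<le> m \<Longrightarrow> orbit k c (V \<mu>) p (x \<mu>) (\<alpha> \<mu>) (P \<mu>)"
  shows "continuous_on {-m..m} P"
  unfolding continuous_on_iff
proof (intro ballI allI impI)
  fix \<mu> e :: real assume \<mu>: "\<mu> \<in> {-m..m}" and e: "e > 0"
  then have \<mu>m: "\<bar>\<mu>\<bar> \<le> m" by auto
  obtain L where L: "L-lipschitz_on (cball 0 r) (V \<mu>)" using calibratesD(3)[OF cal[OF \<mu>m]] by blast
  have c: "c \<ge> 0" using orbit_area_bound[OF orb[OF \<mu>m]] by simp
  \<comment> \<open>Beyond \<open>T\<close> the area tails are below \<open>e / 4\<close> for every
    parameter, as \<open>c\<close> is common; what remains is a comparison up to time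
    \<open>T\<close>.\<close>
  have "\<forall>\<^sub>F s in at_top. c * exp (- (2 * k) * s) < e / 4"
    using k e by (intro order_tendstoD(2)[OF tendsto_exp_decay]) auto
  then obtain T where T: "T \<ge> 0" "c * exp (- (2 * k) * T) < e / 4"
    unfolding eventually_at_top_linorder by (meson max.cobounded1 max.cobounded2)
  define Q where "Q = exp ((1 + 2 * L + 2 * r * L) * T) * (1 + r\<^sup>2)"
  have Q: "Q > 0" unfolding Q_def by (simp add: add_pos_nonneg)
  \<comment> \<open>Solves \<open>Q * (d * (4 * c + 1)) = (e / 2)^2\<close>; the summand 1 keeps the
    denominator positive for \<open>c = 0\<close> and the estimate strict.\<close>
  define d where "d = (e / 2)\<^sup>2 / (Q * (4 * c + 1))"
  have d: "d > 0" using e Q c by (simp add: d_def)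
  have "dist (P \<nu>) (P \<mu>) < e" if \<nu>: "\<nu> \<in> {-m..m}" "dist \<nu> \<mu> < d" for \<nu>
  proof -
    have \<nu>m: "\<bar>\<nu>\<bar> \<le> m" using \<nu> by auto
    define X where "X = G \<mu> p - G \<nu> p + (\<nu> - \<mu>) * P \<nu>"
    have "0 \<le> G \<nu> p - G \<mu> p + (\<mu> - \<nu>) * P \<mu>"
      by (rule calibration_excess_nonneg[OF cal[OF \<nu>m] cal[OF \<mu>m] k p orb[OF \<mu>m]])
    then have "X \<le> (\<nu> - \<mu>) * (P \<nu> - P \<mu>)" by (simp add: X_def algebra_simps)
    also have "\<dots> \<le> \<bar>\<nu> - \<mu>\<bar> * \<bar>P \<nu> - P \<mu>\<bar>" by (simp flip: abs_mult)
    also have "\<dots> \<le> d * (2 * c)"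
      using \<nu>(2) orbit_area_bound[OF orb[OF \<mu>m]] orbit_area_bound[OF orb[OF \<nu>m]]
      by (intro mult_mono) (auto simp: dist_real_def)
    finally have X: "X \<le> d * (2 * c)" .
    have "(\<alpha> \<nu> T - \<alpha> \<mu> T)\<^sup>2 \<le> Q * (2 * X)"
      using orbit_area_difference[OF cal[OF \<mu>m] cal[OF \<nu>m] k p orb[OF \<mu>m] orb[OF \<nu>m] L T(1)]
      by (simp add: Q_def X_def mult_ac)
    also have "\<dots> \<le> Q * (d * (4 * c))" using X Q by (intro mult_left_mono) linarith+
    also have "\<dots> < Q * (d * (4 * c + 1))" using Q d by simp
    also have "\<dots> = (e / 2)\<^sup>2" using Q c by (simp add: d_def)
    finally have "\<bar>\<alpha> \<nu> T - \<alpha> \<mu> T\<bar>\<^sup>2 < (e / 2)\<^sup>2" by simp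
    then have "\<bar>\<alpha> \<nu> T - \<alpha> \<mu> T\<bar> < e / 2" by (rule power2_less_imp_less) (use e in simp)
    moreover have "\<bar>\<alpha> \<nu> T - P \<nu>\<bar> < e / 4" "\<bar>\<alpha> \<mu> T - P \<mu>\<bar> < e / 4"
      using orbitD(6)[OF orb[OF \<nu>m] T(1)] orbitD(6)[OF orb[OF \<mu>m] T(1)] T(2) by linarith+
    ultimately show ?thesis unfolding dist_real_def by linarith
  qed
  then show "\<exists>d>0. \<forall>\<nu>\<in>{-m..m}. dist \<nu> \<mu> < d \<longrightarrow> dist (P \<nu>) (P \<mu>) < e" using d by blast
qed

section \<open>Lipschitz curves\<close>

lemma locally_lipschitz_on_compact:
  fixes f :: "'a::metric_space \<Rightarrow> 'b::metric_space"
  assumes "locally_lipschitz_on S f" "compact S"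
  obtains L where "L-lipschitz_on S f"
proof -
  \<comment> \<open>The compactness result concerns families of maps indexed by time; here the
    family is constant over the single time 0.\<close>
  have ll: "local_lipschitz {0::real} S (\<lambda>_. f)"
    unfolding local_lipschitz_def
  proof (intro ballI)
    fix x t assume "x \<in> S"
    then obtain e L where e: "e > 0" "L-lipschitz_on (S \<inter> ball x e) f"
      using assms(1) unfolding locally_lipschitz_on_def by blast
    have "L-lipschitz_on (cball x (e/2) \<inter> S) f"
      using e by (intro lipschitz_on_subset[OF e(2)]) auto
    then show "\<exists>u>0. \<exists>L. \<forall>t\<in>cball t u \<inter> {0::real}. L-lipschitz_on (cball x u \<inter> S) f"
      using e(1) by (intro exI[of _ "e/2"]) auto
  qed
  obtain L where "\<And>t. t \<in> {0::real} \<Longrightarrow> L-lipschitz_on S f"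
    by (rule local_lipschitz_compact_implies_lipschitz[OF ll assms(2)]) auto
  then show thesis using that by simp
qed

lemma lipschitz_imp_locally_lipschitz_on:
  "L-lipschitz_on S f \<Longrightarrow> locally_lipschitz_on S f"
  unfolding locally_lipschitz_on_def by (meson inf_le1 lipschitz_on_subset zero_less_one)

section \<open>Velocity, energy and area of Lipschitz curves\<close>

definition velocity :: "(real \<Rightarrow> plane) \<Rightarrow> real \<Rightarrow> plane" where
  "velocity \<gamma> t = vector_derivative \<gamma> (at t within {0..1})"

lemma has_vector_derivative_plane:
  fixes f :: "real \<Rightarrow> plane"
  assumes "((\<lambda>t. f t $ 1) has_real_derivative v1) F" "((\<lambda>t. f t $ 2) has_real_derivative v2) F"
  shows "(f has_vector_derivative vector [v1, v2]) F"
proof -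
  have e: "v = v $ 1 *\<^sub>R axis 1 1 + v $ 2 *\<^sub>R axis 2 1" for v :: plane
    by (simp add: plane_eq_iff axis_def)
  have "((\<lambda>t. f t $ 1 *\<^sub>R axis 1 1 + f t $ 2 *\<^sub>R axis 2 1 :: plane) has_derivative
     (\<lambda>h. (v1 * h) *\<^sub>R axis 1 1 + (v2 * h) *\<^sub>R axis 2 1)) F"
    using assms unfolding has_field_derivative_def
    by (intro has_derivative_add has_derivative_scaleR_left)
  moreover have "(\<lambda>h. (v1 * h) *\<^sub>R axis 1 1 + (v2 * h) *\<^sub>R axis 2 1 :: plane) = (\<lambda>h. h *\<^sub>R vector [v1, v2])"
    by (auto simp: plane_eq_iff axis_def)
  ultimately show ?thesis unfolding has_vector_derivative_def by (simp flip: e)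
qed

lemma velocity_eqI:
  assumes "(\<gamma> has_vector_derivative v) (at t within {0..1})" "t \<in> {0..1}"
  shows "velocity \<gamma> t = v"
  unfolding velocity_def using assms by (intro vector_derivative_within_closed_interval) auto

text \<open>One exceptional set serves all claims. The last claim is there because
  \<open>area\<close> differentiates a coordinate function, whereas the estimates use the velocity
  of the curve.\<close>

lemma lipschitz_curve_velocity:
  assumes lip: "L-lipschitz_on {0..1} \<gamma>"
  obtains N where "negligible N"
    "\<And>t. t \<in> {0..1} - N \<Longrightarrow> (\<gamma> has_vector_derivative velocity \<gamma> t) (at t within {0..1})"
    "\<And>t. t \<in> {0..1} - N \<Longrightarrow> norm (velocity \<gamma> t) \<le> L"
    "\<And>t i. t \<in> {0..1} - N \<Longrightarrow> vector_derivative (\<lambda>s. \<gamma> s $ i) (at t within {0..1}) = velocity \<gamma> t $ i"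
proof -
  have comp: "L-lipschitz_on {0..1} (\<lambda>t. \<gamma> t $ i)" for i
  proof (rule lipschitz_onI)
    fix x y :: real assume "x \<in> {0..1}" "y \<in> {0..1}"
    have "dist (\<gamma> x $ i) (\<gamma> y $ i) \<le> dist (\<gamma> x) (\<gamma> y)" by (rule dist_vec_nth_le)
    also have "\<dots> \<le> L * dist x y" by (rule lipschitz_onD[OF lip]) fact+
    finally show "dist (\<gamma> x $ i) (\<gamma> y $ i) \<le> L * dist x y" .
  qed (rule lipschitz_on_nonneg[OF lip])
  obtain N1 where N1: "negligible N1" "\<And>t. t \<in> {0..1} - N1 \<Longrightarrow> (\<lambda>t. \<gamma> t $ 1) differentiable (at t within {0..1})"
    using lipschitz_differentiable_ae[OF comp[of 1]] by blast
  obtain N2 where N2: "negligible N2" "\<And>t. t \<in> {0..1} - N2 \<Longrightarrow> (\<lambda>t. \<gamma> t $ 2) differentiable (at t within {0..1})"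
    using lipschitz_differentiable_ae[OF comp[of 2]] by blast
  have d: "(\<gamma> has_vector_derivative velocity \<gamma> t) (at t within {0..1})" if "t \<in> {0..1} - (N1 \<union> N2)" for t
  proof -
    have t: "t \<in> {0..1} - N1" "t \<in> {0..1} - N2" using that by auto
    obtain v1 v2 where "((\<lambda>t. \<gamma> t $ 1) has_real_derivative v1) (at t within {0..1})"
      "((\<lambda>t. \<gamma> t $ 2) has_real_derivative v2) (at t within {0..1})"
      using N1(2)[OF t(1)] N2(2)[OF t(2)] unfolding real_differentiable_def by blast
    then have "(\<gamma> has_vector_derivative vector [v1, v2]) (at t within {0..1})"
      by (rule has_vector_derivative_plane)
    with velocity_eqI[OF this] that show ?thesis by simp
  qed
  show thesis
  proof
    show "negligible (N1 \<union> N2)" using N1(1) N2(1) by simp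
    fix t assume t: "t \<in> {0..1} - (N1 \<union> N2)"
    show "(\<gamma> has_vector_derivative velocity \<gamma> t) (at t within {0..1})" by (rule d[OF t])
    show "norm (velocity \<gamma> t) \<le> L"
    proof (rule field_le_epsilon)
      fix e :: real assume "e > 0"
      from d[OF t, unfolded has_vector_derivative_def has_derivative_within_alt, THEN conjunct2, rule_format, OF this]
      obtain d where d: "d > 0" "\<And>s. s \<in> {0..1} \<Longrightarrow> norm (s - t) < d \<Longrightarrow>
          norm (\<gamma> s - \<gamma> t - (s - t) *\<^sub>R velocity \<gamma> t) \<le> e * norm (s - t)"
        by blast
      define h where "h = min d 1 / 2"
      \<comment> \<open>A step of length \<open>h \<le> 1/2\<close> away from the nearer endpoint
        stays in the interval.\<close>
      define s where "s = (if t \<le> 1/2 then t + h else t - h)"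
      have h: "0 < h" "h < d" "h \<le> 1/2" using d(1) by (auto simp: h_def)
      have s: "s \<in> {0..1}" "norm (s - t) = h" using h t by (auto simp: s_def)
      have "h * norm (velocity \<gamma> t) = norm ((s - t) *\<^sub>R velocity \<gamma> t)" using s(2) by simp
      also have "\<dots> \<le> norm (\<gamma> s - \<gamma> t) + norm (\<gamma> s - \<gamma> t - (s - t) *\<^sub>R velocity \<gamma> t)"
        using norm_triangle_ineq4[of "\<gamma> s - \<gamma> t" "\<gamma> s - \<gamma> t - (s - t) *\<^sub>R velocity \<gamma> t"] by simp
      also have "\<dots> \<le> L * h + e * h"
        using lipschitz_onD[OF lip s(1), of t] d(2)[OF s(1)] s(2) h t
        by (intro add_mono) (auto simp: dist_norm)
      finally have "h * norm (velocity \<gamma> t) \<le> h * (L + e)" by (simp add: algebra_simps)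
      then show "norm (velocity \<gamma> t) \<le> L + e" using h(1) by simp
    qed
    fix i
    show "vector_derivative (\<lambda>s. \<gamma> s $ i) (at t within {0..1}) = velocity \<gamma> t $ i"
      using t by (intro vector_derivative_within_closed_interval
          bounded_linear.has_vector_derivative[OF bounded_linear_vec_nth d]) auto
  qed
qed

text \<open>Measurability comes from integrability: the fundamental theorem for Lipschitz functions
  makes the velocity integrable.\<close>

lemma velocity_measurable:
  assumes lip: "L-lipschitz_on {0..1} \<gamma>"
  shows "velocity \<gamma> \<in> borel_measurable (lebesgue_on {0..1})"
proof -
  obtain N where N: "negligible N"
    "\<And>t. t \<in> {0..1} - N \<Longrightarrow> (\<gamma> has_vector_derivative velocity \<gamma> t) (at t within {0..1})"
    using lipschitz_curve_velocity[OF lip] by metis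
  have "(velocity \<gamma> has_integral \<gamma> 1 - \<gamma> 0) {0..1}"
    by (rule has_integral_lipschitz_derivative[OF _ lip N]) simp
  then show ?thesis by (intro integrable_imp_measurable) (auto simp: integrable_on_def)
qed

lemma absolutely_integrable_along_curve:
  fixes \<Phi> :: "real \<Rightarrow> plane \<Rightarrow> real"
  assumes lip: "L-lipschitz_on {0..1} \<gamma>"
    and meas: "(\<lambda>t. \<Phi> t (velocity \<gamma> t)) \<in> borel_measurable (lebesgue_on {0..1})"
    and bd: "\<And>t v. t \<in> {0..1} \<Longrightarrow> \<bar>\<Phi> t v\<bar> \<le> M * norm v"
  shows "(\<lambda>t. \<Phi> t (velocity \<gamma> t)) absolutely_integrable_on {0..1}"
proof -
  obtain N where N: "negligible N" "\<And>t. t \<in> {0..1} - N \<Longrightarrow> norm (velocity \<gamma> t) \<le> L"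
    using lipschitz_curve_velocity[OF lip] by metis
  \<comment> \<open>On \<open>N\<close> nothing is known of the velocity, so there the dominating
    function copies the integrand; elsewhere it is constant, hence it is integrable.\<close>
  define g where "g t = (if t \<in> N then \<bar>\<Phi> t (velocity \<gamma> t)\<bar> else \<bar>M\<bar> * L)" for t
  have "(\<lambda>_. \<bar>M\<bar> * L) integrable_on {0..1::real}" by (intro integrable_continuous_interval continuous_intros)
  then have "g integrable_on {0..1}"
    by (rule integrable_spike[OF _ N(1)]) (auto simp: g_def)
  then show ?thesis
  proof (rule measurable_bounded_by_integrable_imp_absolutely_integrable[OF meas, rotated])
    fix t :: real assume t: "t \<in> {0..1}"
    show "norm (\<Phi> t (velocity \<gamma> t)) \<le> g t"
    proof (cases "t \<in> N")
      case False
      have "\<bar>\<Phi> t (velocity \<gamma> t)\<bar> \<le> \<bar>M\<bar> * norm (velocity \<gamma> t)"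
        using bd[OF t, of "velocity \<gamma> t"] mult_right_mono[OF abs_ge_self[of M] norm_ge_zero[of "velocity \<gamma> t"]] by linarith
      also have "\<dots> \<le> \<bar>M\<bar> * L" using N(2)[of t] t False by (intro mult_left_mono) auto
      finally show ?thesis using False by (simp add: g_def)
    qed (simp add: g_def)
  qed simp
qed

lemma continuous_on_bounded_Icc:
  fixes w :: "real \<Rightarrow> real"
  assumes "continuous_on {0..1} w"
  obtains M where "\<And>t. t \<in> {0..1} \<Longrightarrow> \<bar>w t\<bar> \<le> M"
proof -
  have "bounded (w ` {0..1})" using assms by (intro compact_imp_bounded compact_continuous_image) auto
  then show thesis using that unfolding bounded_iff by (metis imageI real_norm_def)
qed

lemma absolutely_integrable_curve_norm:
  assumes lip: "L-lipschitz_on {0..1} \<gamma>" and w: "continuous_on {0..1} w"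
  shows "(\<lambda>t. w t * norm (velocity \<gamma> t)) absolutely_integrable_on {0..1}"
proof -
  obtain M where M: "\<And>t. t \<in> {0..1} \<Longrightarrow> \<bar>w t\<bar> \<le> M" using continuous_on_bounded_Icc[OF w] by blast
  have wm: "w \<in> borel_measurable (lebesgue_on {0..1})"
    using w by (intro continuous_imp_measurable_on_sets_lebesgue) auto
  show ?thesis
    by (rule absolutely_integrable_along_curve[OF lip, where \<Phi>="\<lambda>t v. w t * norm v" and M=M])
       (use M in \<open>auto intro!: borel_measurable_times wm measurable_compose[OF velocity_measurable[OF lip] borel_measurable_norm] mult_right_mono simp: abs_mult\<close>)
qed

lemma absolutely_integrable_curve_component:
  assumes lip: "L-lipschitz_on {0..1} \<gamma>" and w: "continuous_on {0..1} w"
  shows "(\<lambda>t. w t * velocity \<gamma> t $ i) absolutely_integrable_on {0..1}"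
proof -
  obtain M where M: "\<And>t. t \<in> {0..1} \<Longrightarrow> \<bar>w t\<bar> \<le> M" using continuous_on_bounded_Icc[OF w] by blast
  have wm: "w \<in> borel_measurable (lebesgue_on {0..1})"
    using w by (intro continuous_imp_measurable_on_sets_lebesgue) auto
  have vm: "(\<lambda>t. velocity \<gamma> t $ i) \<in> borel_measurable (lebesgue_on {0..1})"
    by (rule measurable_compose[OF velocity_measurable[OF lip] borel_measurable_continuous_onI])
       (intro continuous_intros)
  show ?thesis
  proof (rule absolutely_integrable_along_curve[OF lip, where \<Phi>="\<lambda>t v. w t * v $ i" and M=M])
    show "(\<lambda>t. w t * velocity \<gamma> t $ i) \<in> borel_measurable (lebesgue_on {0..1})"
      by (intro borel_measurable_times wm vm)
    show "\<bar>w t * v $ i\<bar> \<le> M * norm v" if "t \<in> {0..1}" for t v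
      unfolding abs_mult using M[OF that] by (intro mult_mono component_le_norm_cart) auto
  qed
qed

lemma absolutely_integrable_curve_inner:
  assumes lip: "L-lipschitz_on {0..1} \<gamma>" and Z: "continuous_on {0..1} Z"
  shows "(\<lambda>t. Z t \<bullet> velocity \<gamma> t) absolutely_integrable_on {0..1}"
  unfolding inner_plane
  by (intro set_integral_add(1) absolutely_integrable_curve_component[OF lip] continuous_intros Z)

lemma energy_eq_integral:
  assumes lip: "L-lipschitz_on {0..1} \<gamma>" and W: "continuous_on UNIV W"
  shows "(\<lambda>t. sqrt (W (\<gamma> t)) * norm (velocity \<gamma> t)) absolutely_integrable_on {0..1}"
    and "energy W \<gamma> = integral {0..1} (\<lambda>t. sqrt (W (\<gamma> t)) * norm (velocity \<gamma> t))"
proof -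
  have "continuous_on {0..1} (\<lambda>t. sqrt (W (\<gamma> t)))"
    by (intro continuous_on_real_sqrt continuous_on_compose2[OF W lipschitz_on_continuous_on[OF lip]]) auto
  then show *: "(\<lambda>t. sqrt (W (\<gamma> t)) * norm (velocity \<gamma> t)) absolutely_integrable_on {0..1}"
    by (rule absolutely_integrable_curve_norm[OF lip])
  show "energy W \<gamma> = integral {0..1} (\<lambda>t. sqrt (W (\<gamma> t)) * norm (velocity \<gamma> t))"
    using set_lebesgue_integral_eq_integral(2)[OF *] by (simp add: energy_def velocity_def)
qed

lemma area_eq_integral:
  assumes lip: "L-lipschitz_on {0..1} \<gamma>"
  shows "area \<gamma> = - integral {0..1} (\<lambda>t. \<gamma> t $ 2 * velocity \<gamma> t $ 1)"
proof -
  obtain N where N: "negligible N"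
    "\<And>t i. t \<in> {0..1} - N \<Longrightarrow> vector_derivative (\<lambda>s. \<gamma> s $ i) (at t within {0..1}) = velocity \<gamma> t $ i"
    using lipschitz_curve_velocity[OF lip] by metis
  have "continuous_on {0..1} (\<lambda>t. \<gamma> t $ 2)"
    using lipschitz_on_continuous_on[OF lip] by (intro continuous_intros)
  from absolutely_integrable_curve_component[OF lip this, of 1]
  have "(\<lambda>t. \<gamma> t $ 2 * velocity \<gamma> t $ 1) absolutely_integrable_on {0..1}" .
  then have "(\<lambda>t. \<gamma> t $ 2 * vector_derivative (\<lambda>s. \<gamma> s $ 1) (at t within {0..1})) absolutely_integrable_on {0..1}"
    by (rule absolutely_integrable_spike[OF _ N(1)]) (simp add: N(2))
  from set_lebesgue_integral_eq_integral(2)[OF this]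
  have "area \<gamma> = - integral {0..1} (\<lambda>t. \<gamma> t $ 2 * vector_derivative (\<lambda>s. \<gamma> s $ 1) (at t within {0..1}))"
    by (simp add: area_def)
  also have "\<dots> = - integral {0..1} (\<lambda>t. \<gamma> t $ 2 * velocity \<gamma> t $ 1)"
    by (rule arg_cong[where f=uminus], rule integral_spike[OF N(1)]) (simp add: N(2))
  finally show ?thesis .
qed

section \<open>The calibration inequality\<close>

lemma calibration_vector_bound:
  assumes cal: "calibrates W r k \<mu> G V"
  obtains C where "C \<ge> 0" "\<And>p. p \<in> cball 0 r \<Longrightarrow> norm (V p) \<le> C * norm p"
proof -
  obtain L where L: "L-lipschitz_on (cball 0 r) V" using calibratesD(3)[OF cal] by blast
  have "norm (V p) \<le> L * norm p" if "p \<in> cball 0 r" for p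
  proof -
    have "norm p \<le> r" using that by simp
    then have "0 \<le> r" using norm_ge_zero[of p] by linarith
    then show ?thesis using lipschitz_onD[OF L that, of 0] calibratesD(2)[OF cal] by simp
  qed
  with lipschitz_on_nonneg[OF L] show thesis by (rule that)
qed

lemma calibration_norm:
  assumes cal: "calibrates W r k \<mu> G V" and p: "p \<in> cball 0 r"
  shows "norm (V p) = sqrt (W p)"
  using calibratesD(5)[OF cal p] by (metis norm_ge_zero real_sqrt_unique)

lemma calibration_norm_lower:
  assumes cal: "calibrates W r k \<mu> G V" and p: "p \<in> cball 0 r"
  shows "k * norm p \<le> norm (V p)"
proof (cases "p = 0")
  case False
  have "k * (norm p)\<^sup>2 \<le> \<bar>V p \<bullet> p\<bar>" using calibratesD(6)[OF cal p] by simp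
  also have "\<dots> \<le> norm (V p) * norm p" by (rule Cauchy_Schwarz_ineq2)
  finally show ?thesis using False by (simp add: power2_eq_square)
qed simp

text \<open>Makes the potential Lipschitz along Lipschitz curves, so that the fundamental theorem
  applies to it.\<close>

lemma calibration_potential_lipschitz:
  assumes cal: "calibrates W r k \<mu> G V"
  obtains B where "B-lipschitz_on (cball 0 r) G"
proof -
  obtain C where C: "C \<ge> 0" "\<And>p. p \<in> cball 0 r \<Longrightarrow> norm (V p) \<le> C * norm p"
    using calibration_vector_bound[OF cal] by blast
  define B where "B = (C + \<bar>\<mu>\<bar>) * \<bar>r\<bar>"
  have B: "0 \<le> B" using C by (simp add: B_def)
  have "norm (G x - G y) \<le> B * norm (x - y)" if "x \<in> cball 0 r" "y \<in> cball 0 r" for x y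
  proof (rule differentiable_bound[OF convex_cball, where f'="\<lambda>p h. V p \<bullet> h + \<mu> * (p $ 2 * h $ 1)"])
    fix p :: plane assume p: "p \<in> cball 0 r"
    then have pr: "norm p \<le> \<bar>r\<bar>" by simp
    show "(G has_derivative (\<lambda>h. V p \<bullet> h + \<mu> * (p $ 2 * h $ 1))) (at p within cball 0 r)"
      using calibratesD(4)[OF cal p] by (rule has_derivative_at_withinI)
    show "onorm (\<lambda>h. V p \<bullet> h + \<mu> * (p $ 2 * h $ 1)) \<le> B"
    proof (rule onorm_le)
      fix h :: plane
      have "norm (V p \<bullet> h + \<mu> * (p $ 2 * h $ 1)) \<le> \<bar>V p \<bullet> h\<bar> + \<bar>\<mu>\<bar> * (\<bar>p $ 2\<bar> * \<bar>h $ 1\<bar>)"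
        by (simp add: abs_mult[symmetric])
      also have "\<dots> \<le> (C * \<bar>r\<bar>) * norm h + \<bar>\<mu>\<bar> * (\<bar>r\<bar> * norm h)"
      proof (intro add_mono mult_left_mono mult_mono)
        have "\<bar>V p \<bullet> h\<bar> \<le> norm (V p) * norm h" by (rule Cauchy_Schwarz_ineq2)
        also have "\<dots> \<le> (C * \<bar>r\<bar>) * norm h"
          using C p pr by (intro mult_right_mono order_trans[OF C(2) mult_left_mono]) auto
        finally show "\<bar>V p \<bullet> h\<bar> \<le> (C * \<bar>r\<bar>) * norm h" .
        show "\<bar>p $ 2\<bar> \<le> \<bar>r\<bar>" using pr component_le_norm_cart[of p 2] by linarith
        show "\<bar>h $ 1\<bar> \<le> norm h" by (rule component_le_norm_cart)
      qed auto
      finally show "norm (V p \<bullet> h + \<mu> * (p $ 2 * h $ 1)) \<le> B * norm h" by (simp add: B_def algebra_simps)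
    qed
  qed (use that in auto)
  then have "B-lipschitz_on (cball 0 r) G" using B by (intro lipschitz_onI) (auto simp: dist_norm)
  then show thesis by (rule that)
qed

lemma calibration_continuous:
  assumes cal: "calibrates W r k \<mu> G V"
  shows "continuous_on (cball 0 r) V" "continuous_on (cball 0 r) G"
  using calibratesD(3)[OF cal] calibration_potential_lipschitz[OF cal] lipschitz_on_continuous_on by blast+

lemma potential_along_curve_derivative:
  assumes cal: "calibrates W r k \<mu> G V" and d: "(\<gamma> has_vector_derivative v) (at t within S)"
    and in_ball: "\<gamma> t \<in> cball 0 r"
  shows "((\<lambda>t. G (\<gamma> t)) has_real_derivative V (\<gamma> t) \<bullet> v + \<mu> * (\<gamma> t $ 2 * v $ 1)) (at t within S)"
  using has_derivative_compose[OF d[unfolded has_vector_derivative_def] calibratesD(4)[OF cal in_ball]]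
  unfolding has_field_derivative_def
  by (rule has_derivative_eq_rhs) (auto simp: fun_eq_iff algebra_simps)

text \<open>Stated on subintervals because uniqueness uses the growth of \<open>G\<close> between
  any two times.\<close>

lemma calibration_line_integral:
  assumes cal: "calibrates W r k \<mu> G V" and lip: "L-lipschitz_on {0..1} \<gamma>"
    and ab: "0 \<le> a" "a \<le> b" "b \<le> 1" and in_ball: "\<And>t. t \<in> {a..b} \<Longrightarrow> \<gamma> t \<in> cball 0 r"
  shows "((\<lambda>t. V (\<gamma> t) \<bullet> velocity \<gamma> t + \<mu> * (\<gamma> t $ 2 * velocity \<gamma> t $ 1)) has_integral G (\<gamma> b) - G (\<gamma> a)) {a..b}"
proof -
  obtain N where N: "negligible N"
    "\<And>t. t \<in> {0..1} - N \<Longrightarrow> (\<gamma> has_vector_derivative velocity \<gamma> t) (at t within {0..1})"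
    using lipschitz_curve_velocity[OF lip] by metis
  obtain B where B: "B-lipschitz_on (cball 0 r) G" using calibration_potential_lipschitz[OF cal] by blast
  have sub: "{a..b} \<subseteq> {0..1}" using ab by auto
  have "(B * L)-lipschitz_on {a..b} (\<lambda>t. G (\<gamma> t))"
    using in_ball by (intro lipschitz_on_compose2 lipschitz_on_subset[OF lip sub] lipschitz_on_subset[OF B]) auto
  then show ?thesis
  proof (rule has_integral_lipschitz_derivative[OF ab(2) _ N(1)])
    fix t assume t: "t \<in> {a..b} - N"
    then have "(\<gamma> has_vector_derivative velocity \<gamma> t) (at t within {a..b})"
      using N(2)[of t] sub by (intro has_vector_derivative_within_subset[OF N(2) sub]) auto
    from potential_along_curve_derivative[OF cal this] in_ball[of t] t
    show "((\<lambda>t. G (\<gamma> t)) has_vector_derivative V (\<gamma> t) \<bullet> velocity \<gamma> t + \<mu> * (\<gamma> t $ 2 * velocity \<gamma> t $ 1)) (at t within {a..b})"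
      by (simp add: has_real_derivative_iff_has_vector_derivative)
  qed
qed

lemma calibration_integral:
  assumes cal: "calibrates W r k \<mu> G V" and lip: "L-lipschitz_on {0..1} \<gamma>"
    and in_ball: "\<And>t. t \<in> {0..1} \<Longrightarrow> \<gamma> t \<in> cball 0 r"
  shows "(\<lambda>t. V (\<gamma> t) \<bullet> velocity \<gamma> t) absolutely_integrable_on {0..1}"
    and "integral {0..1} (\<lambda>t. V (\<gamma> t) \<bullet> velocity \<gamma> t) = G (\<gamma> 1) - G (\<gamma> 0) + \<mu> * area \<gamma>"
proof -
  have c: "continuous_on {0..1} \<gamma>" using lip by (rule lipschitz_on_continuous_on)
  have cV: "continuous_on {0..1} (\<lambda>t. V (\<gamma> t))"
    using in_ball by (intro continuous_on_compose2[OF calibration_continuous(1)[OF cal] c]) blast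
  show i: "(\<lambda>t. V (\<gamma> t) \<bullet> velocity \<gamma> t) absolutely_integrable_on {0..1}"
    by (rule absolutely_integrable_curve_inner[OF lip cV])
  have "continuous_on {0..1} (\<lambda>t. \<gamma> t $ 2)" using c by (intro continuous_intros)
  from absolutely_integrable_curve_component[OF lip this, of 1]
  have j: "(\<lambda>t. \<gamma> t $ 2 * velocity \<gamma> t $ 1) integrable_on {0..1}"
    by (rule set_lebesgue_integral_eq_integral(1))
  have "integral {0..1} (\<lambda>t. V (\<gamma> t) \<bullet> velocity \<gamma> t + \<mu> * (\<gamma> t $ 2 * velocity \<gamma> t $ 1)) = G (\<gamma> 1) - G (\<gamma> 0)"
    by (rule integral_unique[OF calibration_line_integral[OF cal lip _ _ _ in_ball]]) auto
  then show "integral {0..1} (\<lambda>t. V (\<gamma> t) \<bullet> velocity \<gamma> t) = G (\<gamma> 1) - G (\<gamma> 0) + \<mu> * area \<gamma>"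
    using integral_add[OF set_lebesgue_integral_eq_integral(1)[OF i] integrable_cmul[OF j, of \<mu>]]
    by (simp add: area_eq_integral[OF lip])
qed

lemma calibration_inequality:
  assumes cal: "calibrates W r k \<mu> G V" and W: "continuous_on UNIV W" and lip: "L-lipschitz_on {0..1} \<gamma>"
    and in_ball: "\<And>t. t \<in> {0..1} \<Longrightarrow> \<gamma> t \<in> cball 0 r"
  shows "G (\<gamma> 1) - G (\<gamma> 0) + \<mu> * area \<gamma> \<le> energy W \<gamma>"
proof -
  note C = calibration_integral[OF cal lip in_ball] and E = energy_eq_integral[OF lip W]
  have "integral {0..1} (\<lambda>t. V (\<gamma> t) \<bullet> velocity \<gamma> t) \<le> integral {0..1} (\<lambda>t. sqrt (W (\<gamma> t)) * norm (velocity \<gamma> t))"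
  proof (rule integral_le)
    fix t :: real assume "t \<in> {0..1}"
    then show "V (\<gamma> t) \<bullet> velocity \<gamma> t \<le> sqrt (W (\<gamma> t)) * norm (velocity \<gamma> t)"
      using norm_cauchy_schwarz[of "V (\<gamma> t)" "velocity \<gamma> t"] calibration_norm[OF cal in_ball] by simp
  qed (use C(1) E(1) in \<open>auto intro: set_lebesgue_integral_eq_integral(1)\<close>)
  then show ?thesis using C(2) E(2) by simp
qed

text \<open>Up to the first time \<open>b\<close> on the circle of radius \<open>r\<close>,
  \<open>sqrt W\<close> is at least \<open>k\<close> times the norm. The energy therefore dominates
  the integral of \<open>k * (velocity \<gamma> t \<bullet> \<gamma> t)\<close>, which is
  \<open>k / 2\<close> times the gain of the squared norm.\<close>

lemma energy_of_escaping_curve: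
  assumes cal: "calibrates W r k \<mu> G V" and k: "k > 0" and W: "continuous_on UNIV W" "\<And>p. W p \<ge> 0"
    and lip: "L-lipschitz_on {0..1} \<gamma>" and out: "t \<in> {0..1}" "r \<le> norm (\<gamma> t)" and start: "norm (\<gamma> 0) < r"
  shows "k / 2 * (r\<^sup>2 - (norm (\<gamma> 0))\<^sup>2) \<le> energy W \<gamma>"
proof -
  have c: "continuous_on {0..1} \<gamma>" using lip by (rule lipschitz_on_continuous_on)
  have r0: "0 \<le> r" using start norm_ge_zero[of "\<gamma> 0"] by linarith
  define S where "S = {t \<in> {0..1}. r \<le> norm (\<gamma> t)}"
  have "closed S" unfolding S_def using c by (intro continuous_on_closed_Collect_le continuous_intros) auto
  moreover have bS: "bdd_below S" unfolding S_def by (auto intro: bdd_belowI[of _ 0])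
  moreover have "S \<noteq> {}" using out by (auto simp: S_def)
  ultimately have "Inf S \<in> S" by (intro closed_contains_Inf)
  define b where "b = Inf S"
  have b: "0 \<le> b" "b \<le> 1" "r \<le> norm (\<gamma> b)" using \<open>Inf S \<in> S\<close> by (auto simp: b_def S_def)
  have before: "norm (\<gamma> s) < r" if "0 \<le> s" "s < b" for s
  proof (rule ccontr)
    assume "\<not> ?thesis"
    then have "s \<in> S" using that b by (auto simp: S_def)
    then have "b \<le> s" unfolding b_def using bS by (rule cInf_lower)
    then show False using that by simp
  qed
  have b0: "0 < b" using b start by (cases "b = 0") auto
  have "norm (\<gamma> b) \<le> r"
  proof (rule continuous_le_on_closure[where S="{0..<b}" and f="\<lambda>s. norm (\<gamma> s)"])
    have "closure {0..<b} = {0..b}" using b0 by simp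
    then show "continuous_on (closure {0..<b}) (\<lambda>s. norm (\<gamma> s))" "b \<in> closure {0..<b}"
      using b c b0 by (auto intro!: continuous_intros intro: continuous_on_subset)
  qed (use before in \<open>auto intro: less_imp_le\<close>)
  then have nb: "norm (\<gamma> b) = r" using b by simp
  have in_ball: "\<gamma> s \<in> cball 0 r" if "s \<in> {0..b}" for s
    using before[of s] nb that by (cases "s = b") auto
  have sub: "{0..b} \<subseteq> {0..1}" using b by auto
  obtain N where N: "negligible N"
    "\<And>t. t \<in> {0..1} - N \<Longrightarrow> (\<gamma> has_vector_derivative velocity \<gamma> t) (at t within {0..1})"
    using lipschitz_curve_velocity[OF lip] by metis
  have "((\<lambda>t. 2 * (velocity \<gamma> t \<bullet> \<gamma> t)) has_integral (norm (\<gamma> b))\<^sup>2 - (norm (\<gamma> 0))\<^sup>2) {0..b}"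
  proof (rule has_integral_lipschitz_derivative[OF _ _ N(1)])
    show "(2 * r * L)-lipschitz_on {0..b} (\<lambda>t. (norm (\<gamma> t))\<^sup>2)"
    proof (rule lipschitz_onI)
      fix s t assume st: "s \<in> {0..b}" "t \<in> {0..b}"
      have "norm (\<gamma> s) \<le> r" "norm (\<gamma> t) \<le> r" using in_ball st by auto
      then have sum: "\<bar>norm (\<gamma> s) + norm (\<gamma> t)\<bar> \<le> 2 * r" by simp
      have "dist ((norm (\<gamma> s))\<^sup>2) ((norm (\<gamma> t))\<^sup>2) = \<bar>norm (\<gamma> s) + norm (\<gamma> t)\<bar> * \<bar>norm (\<gamma> s) - norm (\<gamma> t)\<bar>"
        by (simp add: dist_real_def power2_eq_square square_diff_square_factored abs_mult)
      also have "\<dots> \<le> (2 * r) * dist (\<gamma> s) (\<gamma> t)"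
        using sum r0 by (intro mult_mono) (auto simp: dist_norm norm_triangle_ineq3)
      also have "\<dots> \<le> (2 * r) * (L * dist s t)"
        using r0 st sub by (intro mult_left_mono lipschitz_onD[OF lip]) auto
      finally show "dist ((norm (\<gamma> s))\<^sup>2) ((norm (\<gamma> t))\<^sup>2) \<le> 2 * r * L * dist s t" by simp
    qed (use lipschitz_on_nonneg[OF lip] r0 in auto)
    fix t assume "t \<in> {0..b} - N"
    then have "(\<gamma> has_vector_derivative velocity \<gamma> t) (at t within {0..b})"
      using sub by (intro has_vector_derivative_within_subset[OF N(2) sub]) auto
    from has_real_derivative_inner_self[OF this]
    show "((\<lambda>t. (norm (\<gamma> t))\<^sup>2) has_vector_derivative 2 * (velocity \<gamma> t \<bullet> \<gamma> t)) (at t within {0..b})"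
      by (simp add: has_real_derivative_iff_has_vector_derivative)
  qed (use b in auto)
  from has_integral_mult_right[OF this, of "k / 2"]
  have I: "((\<lambda>t. k * (velocity \<gamma> t \<bullet> \<gamma> t)) has_integral k / 2 * (r\<^sup>2 - (norm (\<gamma> 0))\<^sup>2)) {0..b}"
    by (simp add: nb)
  note E = energy_eq_integral[OF lip W(1)]
  have EI: "(\<lambda>t. sqrt (W (\<gamma> t)) * norm (velocity \<gamma> t)) integrable_on {0..1}"
    using E(1) by (rule set_lebesgue_integral_eq_integral(1))
  have EI': "(\<lambda>t. sqrt (W (\<gamma> t)) * norm (velocity \<gamma> t)) integrable_on {0..b}"
    using integrable_on_subinterval[OF EI sub] .
  have "k / 2 * (r\<^sup>2 - (norm (\<gamma> 0))\<^sup>2) \<le> integral {0..b} (\<lambda>t. sqrt (W (\<gamma> t)) * norm (velocity \<gamma> t))"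
  proof (rule has_integral_le[OF I integrable_integral[OF EI']])
    fix t assume t: "t \<in> {0..b}"
    have "k * (velocity \<gamma> t \<bullet> \<gamma> t) \<le> k * (norm (velocity \<gamma> t) * norm (\<gamma> t))"
      using k by (intro mult_left_mono norm_cauchy_schwarz) auto
    also have "\<dots> = (k * norm (\<gamma> t)) * norm (velocity \<gamma> t)" by simp
    also have "\<dots> \<le> sqrt (W (\<gamma> t)) * norm (velocity \<gamma> t)"
      using calibration_norm_lower[OF cal in_ball[OF t]] calibration_norm[OF cal in_ball[OF t]]
      by (intro mult_right_mono) auto
    finally show "k * (velocity \<gamma> t \<bullet> \<gamma> t) \<le> sqrt (W (\<gamma> t)) * norm (velocity \<gamma> t)" .
  qed
  also have "\<dots> \<le> integral {0..1} (\<lambda>t. sqrt (W (\<gamma> t)) * norm (velocity \<gamma> t))"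
    by (rule integral_subset_le[OF sub EI' EI]) (simp add: W(2))
  finally show ?thesis using E(2) by simp
qed

section \<open>Orbits as curves on the unit interval\<close>

text \<open>The substitution \<open>1 - t = exp (- k s)\<close> compresses the half line to the unit interval; by the
  exponential decay of the orbit the resulting curve is Lipschitz up to its endpoint.\<close>

definition orbit_curve :: "real \<Rightarrow> (real \<Rightarrow> plane) \<Rightarrow> real \<Rightarrow> plane" where
  "orbit_curve k x t = (if t < 1 then x (- ln (1 - t) / k) else 0)"

lemma has_vector_derivative_compress:
  fixes f :: "real \<Rightarrow> 'a::real_normed_vector"
  assumes k: "k > 0" and t: "t \<in> {0..<1}"
    and f: "(f has_vector_derivative v) (at (- ln (1 - t) / k) within {0..})"
  shows "((\<lambda>t. f (- ln (1 - t) / k)) has_vector_derivative (1 / (k * (1 - t))) *\<^sub>R v) (at t within {0..1})"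
proof -
  have "((\<lambda>t. - ln (1 - t) / k) has_real_derivative 1 / (k * (1 - t))) (at t within {0..<1})"
    using t k by (auto intro!: derivative_eq_intros simp: field_simps)
  then have s: "((\<lambda>t. - ln (1 - t) / k) has_vector_derivative 1 / (k * (1 - t))) (at t within {0..<1})"
    by (simp add: has_real_derivative_iff_has_vector_derivative)
  have "(\<lambda>t. - ln (1 - t) / k) ` {0..<1} \<subseteq> {0..}" using k by (auto simp: field_simps)
  from vector_diff_chain_within[OF s has_vector_derivative_within_subset[OF f this]]
  have "((\<lambda>t. f (- ln (1 - t) / k)) has_vector_derivative (1 / (k * (1 - t))) *\<^sub>R v) (at t within {0..<1})"
    by (simp add: o_def)
  moreover have "at t within {0..<1} = at t within {0..1}"
    by (rule at_within_nhd[of _ "{..<1}"]) (use t in auto)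
  ultimately show ?thesis by simp
qed

section \<open>The compressed orbit: endpoints, regularity, area and energy\<close>

context
  fixes W r k \<mu> G V p c x \<alpha> A C
  assumes cal: "calibrates W r k \<mu> G V" and k: "k > 0" and p: "p \<in> cball 0 r"
    and orb: "orbit k c V p x \<alpha> A"
    and C: "C \<ge> 0" "\<forall>q\<in>cball 0 r. norm (V q) \<le> C * norm q"
begin

lemma time_nonneg: "t \<in> {0..<1} \<Longrightarrow> 0 \<le> - ln (1 - t) / k"
  using k by (auto simp: field_simps)

lemma time_exp: "t < 1 \<Longrightarrow> exp (- k * (- ln (1 - t) / k)) = 1 - t"
  using k by simp

lemma orbit_curve_ends: "orbit_curve k x 0 = p" "orbit_curve k x 1 = 0"
  using orbitD(1)[OF orb] by (simp_all add: orbit_curve_def)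

lemma orbit_curve_decay:
  assumes "t \<in> {0..1}"
  shows "norm (orbit_curve k x t) \<le> norm p * (1 - t)"
proof (cases "t < 1")
  case True
  have "norm (x (- ln (1 - t) / k)) \<le> norm p * exp (- k * (- ln (1 - t) / k))"
    by (rule orbitD(4)[OF orb time_nonneg]) (use assms True in auto)
  then show ?thesis using True by (simp only: orbit_curve_def time_exp) simp
qed (use assms in \<open>auto simp: orbit_curve_def\<close>)

lemma orbit_curve_in_cball: "t \<in> {0..1} \<Longrightarrow> orbit_curve k x t \<in> cball 0 r"
  using orbit_curve_decay[of t] p mult_left_le[of "1 - t" "norm p"] by auto

lemma orbit_curve_derivative:
  assumes t: "t \<in> {0..<1}"
  shows "(orbit_curve k x has_vector_derivative (1 / (k * (1 - t))) *\<^sub>R V (orbit_curve k x t)) (at t within {0..1})"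
proof -
  have e: "at t within {0..<1} = at t within {0..1}"
    by (rule at_within_nhd[of _ "{..<1}"]) (use t in auto)
  have "((\<lambda>t. x (- ln (1 - t) / k)) has_vector_derivative (1 / (k * (1 - t))) *\<^sub>R V (x (- ln (1 - t) / k))) (at t within {0..1})"
    by (rule has_vector_derivative_compress[OF k t orbitD(3)[OF orb time_nonneg[OF t]]])
  then have "(orbit_curve k x has_vector_derivative (1 / (k * (1 - t))) *\<^sub>R V (x (- ln (1 - t) / k))) (at t within {0..<1})"
    unfolding e[symmetric] by (rule has_vector_derivative_transform[OF t, rotated]) (simp add: orbit_curve_def)
  then show ?thesis using t by (simp add: e orbit_curve_def)
qed

text \<open>The substitution speeds the orbit up by \<open>1 / (k * (1 - t))\<close>; the linear
  bound on \<open>V\<close> together with the decay \<open>norm p * (1 - t)\<close> cancels the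
  singularity.\<close>

lemma orbit_curve_velocity_bound:
  assumes t: "t \<in> {0..<1}"
  shows "norm ((1 / (k * (1 - t))) *\<^sub>R V (orbit_curve k x t)) \<le> C * norm p / k"
proof -
  have t': "t \<in> {0..1}" using t by auto
  have "norm (V (orbit_curve k x t)) \<le> C * (norm p * (1 - t))"
    by (rule order_trans[OF C(2)[rule_format, OF orbit_curve_in_cball[OF t']]]) (intro mult_left_mono orbit_curve_decay t' C)
  then have "(1 / (k * (1 - t))) * norm (V (orbit_curve k x t)) \<le> (1 / (k * (1 - t))) * (C * (norm p * (1 - t)))"
    using t k by (intro mult_left_mono) auto
  also have "\<dots> = C * norm p / k" using t k by (simp add: field_simps)
  finally show ?thesis using t k by simp
qed

lemma orbit_curve_lipschitz:
  obtains L where "L-lipschitz_on {0..1} (orbit_curve k x)"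
proof -
  define B where "B = C * norm p / k"
  have B: "0 \<le> B" using C k by (simp add: B_def)
  have sm: "norm (orbit_curve k x s - orbit_curve k x t) \<le> B * norm (s - t)" if "s \<in> {0..<1}" "t \<in> {0..<1}" for s t
  proof (rule differentiable_bound[where S="{0..<1::real}"
        and f'="\<lambda>t h. h *\<^sub>R ((1 / (k * (1 - t))) *\<^sub>R V (orbit_curve k x t))"])
    fix t :: real assume t: "t \<in> {0..<1}"
    have "{0..<1} \<subseteq> {0..1::real}" by auto
    from has_vector_derivative_within_subset[OF orbit_curve_derivative[OF t] this]
    show "(orbit_curve k x has_derivative (\<lambda>h. h *\<^sub>R ((1 / (k * (1 - t))) *\<^sub>R V (orbit_curve k x t)))) (at t within {0..<1})"
      by (simp only: has_vector_derivative_def)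
    show "onorm (\<lambda>h. h *\<^sub>R ((1 / (k * (1 - t))) *\<^sub>R V (orbit_curve k x t))) \<le> B"
    proof (rule onorm_le)
      fix h :: real
      have "norm (h *\<^sub>R ((1 / (k * (1 - t))) *\<^sub>R V (orbit_curve k x t))) = \<bar>h\<bar> * norm ((1 / (k * (1 - t))) *\<^sub>R V (orbit_curve k x t))"
        by (rule norm_scaleR)
      also have "\<dots> \<le> \<bar>h\<bar> * B" unfolding B_def by (intro mult_left_mono orbit_curve_velocity_bound t) auto
      finally show "norm (h *\<^sub>R ((1 / (k * (1 - t))) *\<^sub>R V (orbit_curve k x t))) \<le> B * norm h" by (simp add: mult.commute)
    qed
  qed (use that in auto)
  \<comment> \<open>At the endpoint the decay itself is a Lipschitz estimate; the mean value
    argument covers the half-open interval.\<close>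
  have one: "norm (orbit_curve k x s - orbit_curve k x 1) \<le> norm p * norm (s - 1)" if "s \<in> {0..1}" for s
    using orbit_curve_decay[OF that] that by (simp add: orbit_curve_ends)
  have "(B + norm p)-lipschitz_on {0..1} (orbit_curve k x)"
  proof (rule lipschitz_onI)
    fix s t :: real assume st: "s \<in> {0..1}" "t \<in> {0..1}"
    have le: "B * norm (s - t) \<le> (B + norm p) * norm (s - t)" "norm p * norm (s - t) \<le> (B + norm p) * norm (s - t)"
      using B by (intro mult_right_mono; simp)+
    show "dist (orbit_curve k x s) (orbit_curve k x t) \<le> (B + norm p) * dist s t"
    proof (cases "s = 1 \<or> t = 1")
      case True
      have "norm (orbit_curve k x s - orbit_curve k x t) \<le> norm p * norm (s - t)"
      proof (cases "t = 1")
        case False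
        then have "s = 1" using True by simp
        then show ?thesis using one[OF st(2)] by (simp only: norm_minus_commute)
      qed (use one[OF st(1)] in simp)
      then show ?thesis unfolding dist_norm using le(2) by (rule order_trans)
    next
      case False
      then have "s \<in> {0..<1}" "t \<in> {0..<1}" using st by auto
      from order_trans[OF sm[OF this] le(1)] show ?thesis unfolding dist_norm .
    qed
  qed (use B in simp)
  then show thesis by (rule that)
qed

lemma orbit_curve_velocity:
  assumes t: "t \<in> {0..<1}"
  shows "velocity (orbit_curve k x) t = (1 / (k * (1 - t))) *\<^sub>R V (orbit_curve k x t)"
  using orbit_curve_derivative[OF t] by (rule velocity_eqI) (use t in auto)

text \<open>The running area \<alpha> in the new time, completed by \<open>A\<close> at the end, is
  a primitive of the area integrand. Its derivative is computed for \<open>t < 1\<close>; at 1 the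
  tail bound gives continuity, which is what the fundamental theorem asks of an endpoint.\<close>

lemma orbit_curve_area: "area (orbit_curve k x) = A"
proof -
  obtain L where lip: "L-lipschitz_on {0..1} (orbit_curve k x)" by (rule orbit_curve_lipschitz)
  define a where "a t = (if t < 1 then \<alpha> (- ln (1 - t) / k) else A)" for t
  define f where "f t = - (orbit_curve k x t $ 2 * velocity (orbit_curve k x) t $ 1)" for t
  have da: "(a has_vector_derivative f t) (at t within {0..1})" if t: "t \<in> {0..<1}" for t
  proof -
    have e: "at t within {0..<1} = at t within {0..1}"
      by (rule at_within_nhd[of _ "{..<1}"]) (use t in auto)
    have "(\<alpha> has_vector_derivative - (orbit_curve k x t $ 2 * V (orbit_curve k x t) $ 1)) (at (- ln (1 - t) / k) within {0..})"
      using orbitD(5)[OF orb time_nonneg[OF t]] t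
      by (simp add: orbit_curve_def has_real_derivative_iff_has_vector_derivative)
    from has_vector_derivative_compress[OF k t this]
    have "((\<lambda>t. \<alpha> (- ln (1 - t) / k)) has_vector_derivative f t) (at t within {0..1})"
      by (simp add: f_def orbit_curve_velocity[OF t])
    then have "(a has_vector_derivative f t) (at t within {0..<1})"
      unfolding e[symmetric] by (rule has_vector_derivative_transform[OF t, rotated]) (simp add: a_def)
    then show ?thesis by (simp add: e)
  qed
  have c: "c \<ge> 0" using orbit_area_bound[OF orb] by linarith
  have tail: "\<bar>a t - A\<bar> \<le> c * (1 - t)" if "t \<in> {0..1}" for t
  proof (cases "t < 1")
    case True
    have "\<bar>\<alpha> (- ln (1 - t) / k) - A\<bar> \<le> c * exp (- (2 * k) * (- ln (1 - t) / k))"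
      by (rule orbitD(6)[OF orb time_nonneg]) (use that True in auto)
    also have "exp (- (2 * k) * (- ln (1 - t) / k)) = (1 - t) * (1 - t)"
    proof -
      have "- (2 * k) * (- ln (1 - t) / k) = ln (1 - t) + ln (1 - t)"
        using k by (simp add: field_simps)
      then show ?thesis unfolding exp_add using True by (simp only: exp_add) simp
    qed
    also have "c * ((1 - t) * (1 - t)) \<le> c * (1 - t)"
      using c that by (intro mult_left_mono mult_left_le) auto
    finally show ?thesis using True by (simp add: a_def)
  qed (use that in \<open>auto simp: a_def\<close>)
  have "continuous_on {0..1} a"
    unfolding continuous_on_eq_continuous_within
  proof
    fix t :: real assume t: "t \<in> {0..1}"
    show "continuous (at t within {0..1}) a"
    proof (cases "t < 1")
      case True
      then show ?thesis using da[of t] t by (auto intro: has_vector_derivative_continuous)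
    next
      case False
      have "((\<lambda>s. c * (1 - s)) \<longlongrightarrow> c * (1 - 1)) (at 1 within {0..1})" by (intro tendsto_intros)
      then have "((\<lambda>s. c * (1 - s)) \<longlongrightarrow> 0) (at 1 within {0..1})" by simp
      then have "((\<lambda>s. a s - A) \<longlongrightarrow> 0) (at 1 within {0..1})"
        by (rule Lim_null_comparison[rotated]) (use tail in \<open>auto simp: eventually_at_filter\<close>)
      then have "(a \<longlongrightarrow> A) (at 1 within {0..1})" by (simp add: LIM_zero_iff)
      moreover have "t = 1" "a 1 = A" using False t by (auto simp: a_def)
      ultimately show ?thesis by (simp add: continuous_within)
    qed
  qed
  then have "(f has_integral a 1 - a 0) {0..1}"
  proof (rule fundamental_theorem_of_calculus_interior[rotated])
    fix t :: real assume t: "t \<in> {0<..<1}"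
    then have "(a has_vector_derivative f t) (at t within {0..1})" by (intro da) auto
    moreover have "at t within {0..1} = at t" using t by (intro at_within_interior) auto
    ultimately show "(a has_vector_derivative f t) (at t)" by simp
  qed simp
  moreover have "a 1 - a 0 = A" using orbitD(2)[OF orb] by (simp add: a_def)
  ultimately have "integral {0..1} f = A" by (simp add: integral_unique)
  then show ?thesis using area_eq_integral[OF lip] by (simp add: f_def[abs_def] integral_neg)
qed

text \<open>The velocity is a nonnegative multiple of \<open>V\<close>, so Cauchy-Schwarz is an
  equality and the energy is the line integral of the calibration. The second, cruder bound is the
  one compared with the cost of escaping.\<close>

lemma orbit_curve_energy:
  assumes W: "continuous_on UNIV W"
  shows "energy W (orbit_curve k x) = - G p + \<mu> * A"
    and "energy W (orbit_curve k x) \<le> C\<^sup>2 * (norm p)\<^sup>2 / k"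
proof -
  obtain L where lip: "L-lipschitz_on {0..1} (orbit_curve k x)" by (rule orbit_curve_lipschitz)
  note E = energy_eq_integral[OF lip W]
  note I = calibration_integral[OF cal lip orbit_curve_in_cball]
  have "integral {0..1} (\<lambda>t. sqrt (W (orbit_curve k x t)) * norm (velocity (orbit_curve k x) t))
      = integral {0..1} (\<lambda>t. V (orbit_curve k x t) \<bullet> velocity (orbit_curve k x) t)"
  proof (rule integral_spike[where S="{1}"])
    fix t :: real assume "t \<in> {0..1} - {1}"
    then have t: "t \<in> {0..<1}" "t \<in> {0..1}" by auto
    show "V (orbit_curve k x t) \<bullet> velocity (orbit_curve k x) t
        = sqrt (W (orbit_curve k x t)) * norm (velocity (orbit_curve k x) t)"
      using t k by (simp add: orbit_curve_velocity power2_norm_eq_inner[symmetric] power2_eq_square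
          calibration_norm[OF cal orbit_curve_in_cball, symmetric])
  qed simp
  then show "energy W (orbit_curve k x) = - G p + \<mu> * A"
    using E(2) I(2) by (simp add: orbit_curve_ends calibratesD(1)[OF cal] orbit_curve_area)
  \<comment> \<open>The velocity bound is available for \<open>t < 1\<close>, so the integrand is
    set to 0 at the endpoint.\<close>
  have "integral {0..1} (\<lambda>t. sqrt (W (orbit_curve k x t)) * norm (velocity (orbit_curve k x) t))
      = integral {0..1} (\<lambda>t. if t = 1 then 0 else sqrt (W (orbit_curve k x t)) * norm (velocity (orbit_curve k x) t))"
    by (rule integral_spike[where S="{1}"]) auto
  also have "\<dots> \<le> integral {0..1} (\<lambda>t::real. (C * norm p) * (C * norm p / k))"
  proof (rule integral_le)
    show "(\<lambda>t. if t = 1 then 0 else sqrt (W (orbit_curve k x t)) * norm (velocity (orbit_curve k x) t)) integrable_on {0..1}"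
      by (rule integrable_spike[OF set_lebesgue_integral_eq_integral(1)[OF E(1)], where S="{1}"]) auto
    fix t :: real assume t: "t \<in> {0..1}"
    show "(if t = 1 then 0 else sqrt (W (orbit_curve k x t)) * norm (velocity (orbit_curve k x) t)) \<le> (C * norm p) * (C * norm p / k)"
    proof (cases "t = 1")
      case False
      then have t': "t \<in> {0..<1}" using t by auto
      have "sqrt (W (orbit_curve k x t)) = norm (V (orbit_curve k x t))"
        using calibration_norm[OF cal orbit_curve_in_cball[OF t]] by simp
      also have "\<dots> \<le> C * norm (orbit_curve k x t)" by (rule C(2)[rule_format, OF orbit_curve_in_cball[OF t]])
      also have "\<dots> \<le> C * norm p"
        using orbit_curve_decay[OF t] t mult_left_le[of "1 - t" "norm p"] by (intro mult_left_mono C) auto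
      finally have "sqrt (W (orbit_curve k x t)) \<le> C * norm p" .
      moreover have "norm (velocity (orbit_curve k x) t) \<le> C * norm p / k"
        using orbit_curve_velocity_bound[OF t'] by (simp only: orbit_curve_velocity[OF t'])
      ultimately have "sqrt (W (orbit_curve k x t)) * norm (velocity (orbit_curve k x) t) \<le> (C * norm p) * (C * norm p / k)"
        using C by (intro mult_mono) auto
      then show ?thesis using False by (simp only: if_False)
    qed (use C k in auto)
  qed (intro integrable_continuous_interval continuous_intros)
  also have "\<dots> = C\<^sup>2 * (norm p)\<^sup>2 / k" by (simp add: power2_eq_square)
  finally show "energy W (orbit_curve k x) \<le> C\<^sup>2 * (norm p)\<^sup>2 / k" using E(2) by simp
qed

lemma orbit_curve_admissible: "orbit_curve k x \<in> curves_to_origin p"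
proof -
  obtain L where "L-lipschitz_on {0..1} (orbit_curve k x)" by (rule orbit_curve_lipschitz)
  then show ?thesis
    by (simp add: curves_to_origin_def lipschitz_imp_locally_lipschitz_on orbit_curve_ends)
qed

end

section \<open>Uniqueness of the minimizing geodesic\<close>

lemma nonneg_integral_zero_ae:
  fixes f :: "real \<Rightarrow> real"
  assumes f: "f absolutely_integrable_on S" and nn: "\<And>t. t \<in> S \<Longrightarrow> 0 \<le> f t" and z: "integral S f = 0"
  obtains N where "negligible N" "\<And>t. t \<in> S - N \<Longrightarrow> f t = 0"
proof -
  have I: "integrable lebesgue (\<lambda>t. indicator S t *\<^sub>R f t)" using f by (simp add: set_integrable_def)
  have "integral\<^sup>L lebesgue (\<lambda>t. indicator S t *\<^sub>R f t) = 0"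
    using set_lebesgue_integral_eq_integral(2)[OF f] z by (simp add: set_lebesgue_integral_def)
  then have "AE t in lebesgue. indicator S t *\<^sub>R f t = 0"
    by (subst (asm) integral_nonneg_eq_0_iff_AE[OF I]) (auto simp: indicator_def nn)
  then obtain N where N: "{t \<in> space lebesgue. \<not> (indicator S t *\<^sub>R f t = 0)} \<subseteq> N" "emeasure lebesgue N = 0" "N \<in> sets lebesgue"
    by (rule AE_E)
  show thesis
  proof
    show "negligible N" using N(2,3) by (simp add: negligible_iff_null_sets null_setsI)
    show "f t = 0" if "t \<in> S - N" for t using N(1) that by (auto simp: indicator_def)
  qed
qed

text \<open>The differential inequality holds almost everywhere only, so it is first integrated to
  \<open>v t \<le> K * I t\<close>. The integral \<open>I\<close> is differentiable everywhere, and
  \<open>exp (- K * t) * I t\<close> starts at 0 and does not increase.\<close>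

lemma lipschitz_gronwall_zero:
  fixes v v' :: "real \<Rightarrow> real"
  assumes lip: "L-lipschitz_on {0..T} v" and v0: "v 0 = 0" "\<And>t. 0 \<le> v t" and N: "negligible N" and K: "0 \<le> K"
    and d: "\<And>t. t \<in> {0..T} - N \<Longrightarrow> (v has_real_derivative v' t) (at t within {0..T}) \<and> v' t \<le> K * v t"
    and t: "t \<in> {0..T}"
  shows "v t = 0"
proof -
  have cv: "continuous_on {0..T} v" using lip by (rule lipschitz_on_continuous_on)
  define I where "I t = integral {0..t} v" for t
  have iv: "v integrable_on {0..t}" if "t \<in> {0..T}" for t
    using that by (intro integrable_continuous_interval continuous_on_subset[OF cv]) auto
  have vI: "v t \<le> K * I t" if t: "t \<in> {0..T}" for t
  proof -
    have sub: "{0..t} \<subseteq> {0..T}" using t by auto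
    \<comment> \<open>On \<open>N\<close>, where \<open>v'\<close> is unknown, the value
      \<open>K * v s\<close> keeps the inequality true at every point.\<close>
    define w where "w s = (if s \<in> N then K * v s else v' s)" for s
    have "(w has_integral v t - v 0) {0..t}"
    proof (rule has_integral_lipschitz_derivative[OF _ lipschitz_on_subset[OF lip sub] N])
      fix s assume s: "s \<in> {0..t} - N"
      then have "s \<in> {0..T} - N" using sub by auto
      from has_field_derivative_subset[OF d[OF this, THEN conjunct1] sub] s
      show "(v has_vector_derivative w s) (at s within {0..t})"
        by (simp add: w_def has_real_derivative_iff_has_vector_derivative)
    qed (use t in auto)
    moreover have "((\<lambda>s. K * v s) has_integral K * I t) {0..t}"
      unfolding I_def by (intro has_integral_mult_right integrable_integral iv t)
    ultimately have "v t - v 0 \<le> K * I t"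
      by (rule has_integral_le) (use d sub in \<open>auto simp: w_def\<close>)
    then show ?thesis using v0 by simp
  qed
  define J where "J s = exp (- K * s) * I s" for s
  have dJ: "(J has_real_derivative exp (- K * s) * (v s - K * I s)) (at s within {0..T})" if s: "s \<in> {0..T}" for s
  proof -
    have "(I has_real_derivative v s) (at s within {0..T})"
      unfolding I_def has_real_derivative_iff_has_vector_derivative
      by (rule integral_has_vector_derivative[OF cv s])
    then show ?thesis unfolding J_def
      by (auto intro!: derivative_eq_intros simp: algebra_simps)
  qed
  have "((\<lambda>s. exp (- K * s) * (v s - K * I s)) has_integral J t - J 0) {0..t}"
  proof (rule fundamental_theorem_of_calculus)
    fix s assume "s \<in> {0..t}"
    then have "(J has_real_derivative exp (- K * s) * (v s - K * I s)) (at s within {0..t})"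
      using t by (intro has_field_derivative_subset[OF dJ]) auto
    then show "(J has_vector_derivative exp (- K * s) * (v s - K * I s)) (at s within {0..t})"
      by (simp add: has_real_derivative_iff_has_vector_derivative)
  qed (use t in auto)
  from has_integral_neg[OF this] have "0 \<le> - (J t - J 0)"
    by (rule has_integral_nonneg) (use vI t in \<open>auto simp: mult_le_0_iff\<close>)
  then have "exp (- K * t) * I t \<le> 0" by (simp add: J_def I_def)
  then have "I t \<le> 0" by (simp add: mult_le_0_iff)
  then have "K * I t \<le> 0" using K by (simp add: mult_nonneg_nonpos)
  then show ?thesis using vI[OF t] v0(2)[of t] by simp
qed

text \<open>Continuity of \<phi> lets the difference quotients of \<open>h\<close> be read at
  \<open>\<phi> y\<close>, where they are the reciprocals of those of \<phi>. Working within
  \<open>S\<close> covers endpoints, where derivatives are one-sided.\<close>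

lemma has_real_derivative_inverse_within:
  fixes h \<phi> :: "real \<Rightarrow> real"
  assumes h: "(h has_real_derivative D) (at u within S)" and D: "D \<noteq> 0" and u: "u \<in> S"
    and inv: "\<And>s. s \<in> S \<Longrightarrow> \<phi> (h s) = s" and cont: "continuous_on (h ` S) \<phi>"
  shows "(\<phi> has_real_derivative 1 / D) (at (h u) within h ` S)"
  unfolding has_field_derivative_iff
proof -
  have lim: "((\<lambda>s. (h s - h u) / (s - u)) \<longlongrightarrow> D) (at u within S)"
    using h by (simp add: has_field_derivative_iff)
  have "(\<phi> \<longlongrightarrow> \<phi> (h u)) (at (h u) within h ` S)"
    using cont u by (simp add: continuous_on_def)
  then have \<phi>: "filterlim \<phi> (at u within S) (at (h u) within h ` S)"
    unfolding filterlim_at using inv u by (auto simp: eventually_at_filter intro!: always_eventually)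
  have "((\<lambda>y. (h (\<phi> y) - h u) / (\<phi> y - u)) \<longlongrightarrow> D) (at (h u) within h ` S)"
    by (rule filterlim_compose[OF lim \<phi>])
  from tendsto_inverse[OF this D]
  have "((\<lambda>y. (\<phi> y - u) / (h (\<phi> y) - h u)) \<longlongrightarrow> 1 / D) (at (h u) within h ` S)"
    by (simp add: inverse_eq_divide)
  then show "((\<lambda>y. (\<phi> y - \<phi> (h u)) / (y - h u)) \<longlongrightarrow> 1 / D) (at (h u) within h ` S)"
    by (rule Lim_transform_eventually) (use inv u in \<open>auto simp: eventually_at_filter intro!: always_eventually\<close>)
qed

text \<open>Along the ray towards \<open>p\<close> the derivative of \<open>G\<close> is negative
  for positive times by the inward bound, and \<open>G 0 = 0\<close>. So \<open>G\<close> tells the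
  origin from the other points of the disc.\<close>

lemma calibration_potential_negative:
  assumes cal: "calibrates W r k 0 G V" and k: "k > 0" and p: "p \<in> cball 0 r" "p \<noteq> 0"
  shows "G p < 0"
proof -
  have in_ball: "t *\<^sub>R p \<in> cball 0 r" if "0 \<le> t" "t \<le> 1" for t
    using that p order_trans[OF mult_left_le_one_le[of "norm p" t], of r] by auto
  have d: "((\<lambda>t. G (t *\<^sub>R p)) has_real_derivative V (t *\<^sub>R p) \<bullet> p) (at t)" if "0 \<le> t" "t \<le> 1" for t
  proof -
    have "((\<lambda>t. t *\<^sub>R p) has_vector_derivative p) (at t)" by (auto intro!: derivative_eq_intros simp: has_vector_derivative_def)
    from potential_along_curve_derivative[OF cal this in_ball[OF that]] show ?thesis by simp
  qed
  have "G (1 *\<^sub>R p) < G (0 *\<^sub>R p)"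
  proof (rule DERIV_neg_imp_decreasing_open[where f="\<lambda>t. G (t *\<^sub>R p)" and a=0 and b=1])
    fix t :: real assume t: "0 < t" "t < 1"
    have "V (t *\<^sub>R p) \<bullet> (t *\<^sub>R p) \<le> - k * (norm (t *\<^sub>R p))\<^sup>2"
      using t by (intro calibratesD(6)[OF cal in_ball]) auto
    also have "\<dots> < 0" using k t p by simp
    finally have "V (t *\<^sub>R p) \<bullet> p < 0" using t by (simp add: mult_less_0_iff)
    then show "\<exists>y. ((\<lambda>t. G (t *\<^sub>R p)) has_real_derivative y) (at t) \<and> y < 0"
      using d[of t] t by auto
  next
    show "continuous_on {0..1} (\<lambda>t. G (t *\<^sub>R p))"
      by (rule continuous_at_imp_continuous_on) (use DERIV_isCont[OF d] in auto)
  qed simp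
  then show ?thesis using calibratesD(1)[OF cal] by simp
qed

text \<open>\<open>a\<close> stands for the field at the minimizer and \<open>b\<close> for the
  field at the orbit. Scaling \<open>b\<close> by the quotient of the squared lengths makes the
  potential grow equally fast on both curves; the remaining defect is of the order of
  \<open>norm (a - b)\<close>, as Gronwall requires.\<close>

lemma direction_defect:
  fixes a b :: plane
  assumes "a \<noteq> 0" "b \<noteq> 0"
  shows "norm (a - ((norm a)\<^sup>2 / (norm b)\<^sup>2) *\<^sub>R b) \<le> norm (a - b) * (1 + (norm a + norm b) / norm b)"
proof -
  have "a - ((norm a)\<^sup>2 / (norm b)\<^sup>2) *\<^sub>R b = (a - b) + (((norm b)\<^sup>2 - (norm a)\<^sup>2) / (norm b)\<^sup>2) *\<^sub>R b"
    using assms by (simp add: diff_divide_distrib scaleR_diff_left)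
  also have "norm \<dots> \<le> norm (a - b) + \<bar>(norm b)\<^sup>2 - (norm a)\<^sup>2\<bar> / (norm b)\<^sup>2 * norm b"
    by (rule order_trans[OF norm_triangle_ineq]) simp
  also have "\<bar>(norm b)\<^sup>2 - (norm a)\<^sup>2\<bar> / (norm b)\<^sup>2 * norm b = \<bar>norm b - norm a\<bar> * (norm a + norm b) / norm b"
  proof -
    have "\<bar>(norm b)\<^sup>2 - (norm a)\<^sup>2\<bar> = \<bar>(norm b - norm a) * (norm a + norm b)\<bar>"
      by (simp add: power2_eq_square algebra_simps)
    also have "\<dots> = \<bar>norm b - norm a\<bar> * (norm a + norm b)" by (simp add: abs_mult)
    finally show ?thesis using assms by (simp add: power2_eq_square)
  qed
  also have "\<dots> \<le> norm (a - b) * (norm a + norm b) / norm b"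
    using norm_triangle_ineq3[of b a] by (intro divide_right_mono mult_right_mono) (auto simp: norm_minus_commute)
  finally show ?thesis by (simp add: algebra_simps)
qed

text \<open>\<open>G\<close> serves as a common clock. Zero excess aligns the velocity of \<eta>
  with \<open>V\<close> almost everywhere, so \<open>G\<close> does not decrease along \<eta>, while
  along the orbit curve it increases strictly between the same two values. Reading the orbit at the
  moment when \<open>G\<close> agrees defines \<tau>, and Gronwall shows that the curves coincide up
  to any time at which \<eta> has not yet reached the origin.\<close>

lemma minimizer_reparametrizes_orbit:
  assumes cal: "calibrates W r k 0 G V" and k: "k > 0" and p: "p \<in> cball 0 r" "p \<noteq> 0"
    and orb: "orbit k c V p x \<alpha> A" and W: "continuous_on UNIV W"
    and lip: "L-lipschitz_on {0..1} \<eta>" and ends: "\<eta> 0 = p" "\<eta> 1 = 0"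
    and in_ball: "\<And>t. t \<in> {0..1} \<Longrightarrow> \<eta> t \<in> cball 0 r" and en: "energy W \<eta> = - G p"
  shows "\<exists>\<tau>. time_change \<tau> \<and> (\<forall>t\<in>{0..1}. \<eta> t = orbit_curve k x (\<tau> t))"
proof -
  obtain C where C: "C \<ge> 0" "\<And>q. q \<in> cball 0 r \<Longrightarrow> norm (V q) \<le> C * norm q"
    using calibration_vector_bound[OF cal] by blast
  have Cb: "\<forall>q\<in>cball 0 r. norm (V q) \<le> C * norm q" using C(2) by blast
  obtain M where M: "M-lipschitz_on (cball 0 r) V" using calibratesD(3)[OF cal] by blast
  obtain B where B: "B-lipschitz_on (cball 0 r) G" using calibration_potential_lipschitz[OF cal] by blast
  have r0: "0 \<le> r" using p norm_ge_zero[of p] unfolding mem_cball_0 by linarith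
  define \<Gamma> where "\<Gamma> = orbit_curve k x"
  note \<Gamma>_in = orbit_curve_in_cball[OF cal k p(1) orb C(1) Cb, folded \<Gamma>_def]
  note \<Gamma>_d = orbit_curve_derivative[OF cal k p(1) orb C(1) Cb, folded \<Gamma>_def]
  note \<Gamma>_ends = orbit_curve_ends[OF cal k p(1) orb C(1) Cb, folded \<Gamma>_def]
  obtain L' where L': "L'-lipschitz_on {0..1} \<Gamma>"
    using orbit_curve_lipschitz[OF cal k p(1) orb C(1) Cb] unfolding \<Gamma>_def by blast
  have c\<eta>: "continuous_on {0..1} \<eta>" using lip by (rule lipschitz_on_continuous_on)
  have cG: "continuous_on {0..1} (\<lambda>t. G (f t))" if "continuous_on {0..1} f" "\<And>t. t \<in> {0..1} \<Longrightarrow> f t \<in> cball 0 r" for f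
    using that by (intro continuous_on_compose2[OF calibration_continuous(2)[OF cal] that(1)]) blast
  have \<Gamma>_nz: "\<Gamma> t \<noteq> 0" if "t \<in> {0..<1}" for t
    using orbit_nonzero[OF cal k p orb C(2) time_nonneg[OF cal k p(1) orb C(1) Cb that]] that by (auto simp: \<Gamma>_def orbit_curve_def)
  have V_nz: "V q \<noteq> 0" if "q \<in> cball 0 r" "q \<noteq> 0" for q
    using calibration_norm_lower[OF cal that(1)] k that(2) by (auto simp: mult_le_0_iff)

  note E = energy_eq_integral[OF lip W] and I = calibration_integral[OF cal lip in_ball]
  \<comment> \<open>The Cauchy-Schwarz defect of the calibration: nonnegative, and of integral 0 by
    the assumption on the energy.\<close>
  define f where "f t = sqrt (W (\<eta> t)) * norm (velocity \<eta> t) - V (\<eta> t) \<bullet> velocity \<eta> t" for t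
  have fi: "f absolutely_integrable_on {0..1}" unfolding f_def by (rule set_integral_diff(1)[OF E(1) I(1)])
  have f0: "0 \<le> f t" if "t \<in> {0..1}" for t
    using norm_cauchy_schwarz[of "V (\<eta> t)" "velocity \<eta> t"] calibration_norm[OF cal in_ball[OF that]]
    by (simp add: f_def)
  have "integral {0..1} f = integral {0..1} (\<lambda>t. sqrt (W (\<eta> t)) * norm (velocity \<eta> t))
      - integral {0..1} (\<lambda>t. V (\<eta> t) \<bullet> velocity \<eta> t)"
    unfolding f_def by (intro integral_diff set_lebesgue_integral_eq_integral(1) E(1) I(1))
  then have "integral {0..1} f = 0" using E(2) I(2) en ends calibratesD(1)[OF cal] by simp
  from nonneg_integral_zero_ae[OF fi f0 this]
  obtain N1 where N1: "negligible N1" "\<And>t. t \<in> {0..1} - N1 \<Longrightarrow> f t = 0" by blast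
  obtain N2 where N2: "negligible N2"
    "\<And>t. t \<in> {0..1} - N2 \<Longrightarrow> (\<eta> has_vector_derivative velocity \<eta> t) (at t within {0..1})"
    "\<And>t. t \<in> {0..1} - N2 \<Longrightarrow> norm (velocity \<eta> t) \<le> L"
    using lipschitz_curve_velocity[OF lip] by metis
  define N where "N = N1 \<union> N2"
  have N: "negligible N" using N1(1) N2(1) by (simp add: N_def)

  define g where "g t = G (\<eta> t)" for t
  have g_mono: "g a \<le> g b" if ab: "0 \<le> a" "a \<le> b" "b \<le> 1" for a b
  proof -
    have "((\<lambda>t. V (\<eta> t) \<bullet> velocity \<eta> t + 0 * (\<eta> t $ 2 * velocity \<eta> t $ 1)) has_integral g b - g a) {a..b}"
      unfolding g_def by (rule calibration_line_integral[OF cal lip ab in_ball]) (use ab in auto)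
    then have "((\<lambda>t. \<bar>V (\<eta> t) \<bullet> velocity \<eta> t\<bar>) has_integral g b - g a) {a..b}"
    proof (rule has_integral_spike[OF N1(1), rotated])
      fix t assume "t \<in> {a..b} - N1"
      then have t: "t \<in> {0..1} - N1" "t \<in> {0..1}" using ab by auto
      have "V (\<eta> t) \<bullet> velocity \<eta> t = norm (V (\<eta> t)) * norm (velocity \<eta> t)"
        using N1(2)[OF t(1)] calibration_norm[OF cal in_ball[OF t(2)]] by (simp add: f_def)
      then show "\<bar>V (\<eta> t) \<bullet> velocity \<eta> t\<bar> = V (\<eta> t) \<bullet> velocity \<eta> t + 0 * (\<eta> t $ 2 * velocity \<eta> t $ 1)" by simp
    qed
    then have "0 \<le> g b - g a" by (rule has_integral_nonneg) simp
    then show ?thesis by simp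
  qed
  have g_ends: "g 0 = G p" "g 1 = 0" using ends calibratesD(1)[OF cal] by (simp_all add: g_def)

  define h where "h t = G (\<Gamma> t)" for t
  have ch: "continuous_on {0..1} h"
    unfolding h_def by (rule cG[OF lipschitz_on_continuous_on[OF L'] \<Gamma>_in])
  have h_ends: "h 0 = G p" "h 1 = 0" using \<Gamma>_ends calibratesD(1)[OF cal] by (simp_all add: h_def)
  have hd: "(h has_real_derivative (norm (V (\<Gamma> u)))\<^sup>2 / (k * (1 - u))) (at u within {0..1})" if u: "u \<in> {0..<1}" for u
  proof -
    have u': "u \<in> {0..1}" using u by auto
    show ?thesis
      using potential_along_curve_derivative[OF cal \<Gamma>_d[OF u] \<Gamma>_in[OF u']]
      by (simp add: h_def[abs_def] power2_norm_eq_inner)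
  qed
  have h_strict: "h s < h t" if st: "0 \<le> s" "s < t" "t \<le> 1" for s t
  proof (rule DERIV_pos_imp_increasing_open[OF st(2)])
    fix u assume u: "s < u" "u < t"
    then have u': "u \<in> {0..<1}" "u \<in> {0..1}" using st by auto
    have "at u within {0..1} = at u" using u st by (intro at_within_interior) auto
    then have "(h has_real_derivative (norm (V (\<Gamma> u)))\<^sup>2 / (k * (1 - u))) (at u)" using hd[OF u'(1)] by simp
    moreover have "0 < (norm (V (\<Gamma> u)))\<^sup>2 / (k * (1 - u))"
      using V_nz[OF \<Gamma>_in[OF u'(2)] \<Gamma>_nz[OF u'(1)]] k u' by simp
    ultimately show "\<exists>y. (h has_real_derivative y) (at u) \<and> 0 < y" by blast
  qed (use st in \<open>auto intro: continuous_on_subset[OF ch]\<close>)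
  have h_inj: "inj_on h {0..1}"
    using h_strict by (intro linorder_inj_onI) fastforce+
  have h_le: "s \<le> t" if "s \<in> {0..1}" "t \<in> {0..1}" "h s \<le> h t" for s t
    using h_strict[of t s] that by force
  have g_range: "g t \<in> h ` {0..1}" if t: "t \<in> {0..1}" for t
  proof -
    have "h 0 \<le> g t" "g t \<le> h 1" using g_mono[of 0 t] g_mono[of t 1] t g_ends h_ends by auto
    from IVT'[OF this _ ch] show ?thesis by force
  qed
  define \<phi> where "\<phi> = inv_into {0..1} h"
  have \<phi>h: "\<phi> (h s) = s" if "s \<in> {0..1}" for s unfolding \<phi>_def by (rule inv_into_f_f[OF h_inj that])
  have c\<phi>: "continuous_on (h ` {0..1}) \<phi>" using \<phi>h by (intro continuous_on_inv[OF ch]) auto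
  define \<tau> where "\<tau> t = \<phi> (g t)" for t
  have \<tau>_in: "\<tau> t \<in> {0..1}" and h\<tau>: "h (\<tau> t) = g t" if "t \<in> {0..1}" for t
    using inv_into_into[OF g_range[OF that]] f_inv_into_f[OF g_range[OF that]] by (simp_all add: \<tau>_def \<phi>_def)
  have c\<tau>: "continuous_on {0..1} \<tau>"
    unfolding \<tau>_def by (rule continuous_on_compose2[OF c\<phi>]) (use g_range in \<open>auto simp: g_def intro!: cG[OF c\<eta> in_ball]\<close>)
  have tc: "time_change \<tau>"
    unfolding time_change_def
  proof (intro conjI c\<tau>)
    show "mono_on {0..1} \<tau>"
    proof (rule mono_onI)
      fix s t :: real assume st: "s \<in> {0..1}" "t \<in> {0..1}" "s \<le> t"
      show "\<tau> s \<le> \<tau> t"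
        by (rule h_le[OF \<tau>_in \<tau>_in]) (use st g_mono[of s t] in \<open>auto simp: h\<tau>\<close>)
    qed
    show "\<tau> 0 = 0" using \<phi>h[of 0] g_ends h_ends by (simp add: \<tau>_def)
    show "\<tau> 1 = 1" using \<phi>h[of 1] g_ends h_ends by (simp add: \<tau>_def)
  qed
  have "\<eta> T = \<Gamma> (\<tau> T)" if T: "T \<in> {0..1}" for T
  proof (cases "\<eta> T = 0")
    case True
    then have "g T = h 1" using h_ends calibratesD(1)[OF cal] by (simp add: g_def)
    then have "\<tau> T = 1" using \<phi>h[of 1] by (simp add: \<tau>_def)
    then show ?thesis using True \<Gamma>_ends by simp
  next
    case False
    have sub: "{0..T} \<subseteq> {0..1}" using T by auto
    have gT: "g T < 0" unfolding g_def by (rule calibration_potential_negative[OF cal k in_ball[OF T] False])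
    have \<eta>_nz: "\<eta> t \<noteq> 0" if "t \<in> {0..T}" for t
    proof
      assume "\<eta> t = 0"
      then have "g t = 0" using calibratesD(1)[OF cal] by (simp add: g_def)
      moreover have "g t \<le> g T" using that T by (intro g_mono) auto
      ultimately show False using gT by simp
    qed
    have \<tau>_le: "\<tau> t \<in> {0..\<tau> T}" if "t \<in> {0..T}" for t
    proof -
      have t: "t \<in> {0..1}" "t \<le> T" using that T by auto
      have "\<tau> t \<le> \<tau> T" using tc t T by (auto simp: time_change_def mono_on_def)
      then show ?thesis using \<tau>_in[OF t(1)] by simp
    qed
    have \<tau>T: "\<tau> T < 1"
    proof (rule ccontr)
      assume "\<not> ?thesis"
      then have "\<tau> T = 1" using \<tau>_in[OF T] by simp
      then show False using h\<tau>[OF T] h_ends gT by simp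
    qed
    \<comment> \<open>On \<open>{0..T}\<close> and \<open>{0..\<tau> T}\<close> the respective
      curves keep a positive distance from the origin, which bounds the fields from below and makes
      \<tau> Lipschitz.\<close>
    have lower: "\<exists>\<delta>>0. \<forall>t\<in>{0..b}. \<delta> \<le> norm (f t)"
      if "0 \<le> b" "b \<le> 1" "continuous_on {0..1} f" "\<And>t. t \<in> {0..b} \<Longrightarrow> f t \<noteq> 0" for b and f :: "real \<Rightarrow> plane"
    proof -
      have "continuous_on {0..b} (\<lambda>t. norm (f t))"
        using that by (intro continuous_on_norm continuous_on_subset[OF that(3)]) auto
      moreover have "{0..b} \<noteq> {}" using that by simp
      ultimately obtain s where "s \<in> {0..b}" "\<forall>t\<in>{0..b}. norm (f s) \<le> norm (f t)"
        using continuous_attains_inf[of "{0..b}" "\<lambda>t. norm (f t)"] by (auto simp del: atLeastAtMost_iff)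
      then show ?thesis using that(4)[of s] by (intro exI[of _ "norm (f s)"]) auto
    qed
    have "\<exists>\<delta>>0. \<forall>t\<in>{0..T}. \<delta> \<le> norm (\<eta> t)"
      by (rule lower[OF _ _ c\<eta> \<eta>_nz]) (use T in auto)
    then obtain \<delta>1 where \<delta>1: "\<delta>1 > 0" "\<And>t. t \<in> {0..T} \<Longrightarrow> \<delta>1 \<le> norm (\<eta> t)" by blast
    have \<Gamma>_nz': "\<Gamma> u \<noteq> 0" if "u \<in> {0..\<tau> T}" for u using that \<tau>T by (intro \<Gamma>_nz) auto
    have "\<exists>\<delta>>0. \<forall>u\<in>{0..\<tau> T}. \<delta> \<le> norm (\<Gamma> u)"
      by (rule lower[OF _ _ lipschitz_on_continuous_on[OF L'] \<Gamma>_nz']) (use \<tau>_in[OF T] in auto)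
    then obtain \<delta>2 where \<delta>2: "\<delta>2 > 0" "\<And>u. u \<in> {0..\<tau> T} \<Longrightarrow> \<delta>2 \<le> norm (\<Gamma> u)" by blast
    \<comment> \<open>Lower bound for the derivative
      \<open>(norm (V (\<Gamma> u)))^2 / (k * (1 - u))\<close> of \<open>h\<close>, from
      \<open>norm V \<ge> k * \<delta>2\<close> and \<open>1 - u \<le> 1\<close>.\<close>
    define w0 where "w0 = (k * \<delta>2)\<^sup>2 / k"
    have w0: "w0 > 0" using k \<delta>2 by (simp add: w0_def)
    have h_exp: "w0 * (t - s) \<le> h t - h s" if st: "0 \<le> s" "s \<le> t" "t \<le> \<tau> T" for s t
    proof -
      have "((\<lambda>u. (norm (V (\<Gamma> u)))\<^sup>2 / (k * (1 - u))) has_integral h t - h s) {s..t}"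
      proof (rule fundamental_theorem_of_calculus[OF st(2)])
        fix u assume "u \<in> {s..t}"
        then have "u \<in> {0..<1}" using st \<tau>T by auto
        from has_field_derivative_subset[OF hd[OF this], of "{s..t}"] st \<tau>T
        show "(h has_vector_derivative (norm (V (\<Gamma> u)))\<^sup>2 / (k * (1 - u))) (at u within {s..t})"
          by (simp add: has_real_derivative_iff_has_vector_derivative)
      qed
      moreover have "((\<lambda>u. w0) has_integral w0 * (t - s)) {s..t}"
        using has_integral_const_real[of w0 s t] st by (simp add: mult.commute)
      ultimately have le: "(\<And>u. u \<in> {s..t} \<Longrightarrow> w0 \<le> (norm (V (\<Gamma> u)))\<^sup>2 / (k * (1 - u))) \<Longrightarrow> w0 * (t - s) \<le> h t - h s"
        using has_integral_le by blast
      show ?thesis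
      proof (rule le)
        fix u assume "u \<in> {s..t}"
        then have u: "u \<in> {0..\<tau> T}" "u \<in> {0..1}" "0 \<le> u" "u < 1" using st \<tau>T by auto
        have "k * \<delta>2 \<le> k * norm (\<Gamma> u)" using \<delta>2(2)[OF u(1)] k by simp
        also have "\<dots> \<le> norm (V (\<Gamma> u))" by (rule calibration_norm_lower[OF cal \<Gamma>_in[OF u(2)]])
        finally have "(k * \<delta>2)\<^sup>2 \<le> (norm (V (\<Gamma> u)))\<^sup>2" using k \<delta>2 by (intro power_mono) auto
        moreover have "k * (1 - u) \<le> k" "0 < k * (1 - u)" using u k by (auto simp: mult_le_cancel_left1)
        ultimately show "w0 \<le> (norm (V (\<Gamma> u)))\<^sup>2 / (k * (1 - u))"
          unfolding w0_def by (intro frac_le) auto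
      qed
    qed
    have \<tau>_lip: "(B * L / w0)-lipschitz_on {0..T} \<tau>"
    proof (rule lipschitz_onI)
      have key: "\<tau> t - \<tau> s \<le> B * L / w0 * (t - s)" if st: "s \<in> {0..T}" "t \<in> {0..T}" "s \<le> t" for s t
      proof -
        have st1: "s \<in> {0..1}" "t \<in> {0..1}" using st sub by auto
        have "\<tau> s \<le> \<tau> t" using tc st1 st(3) by (auto simp: time_change_def mono_on_def)
        then have "w0 * (\<tau> t - \<tau> s) \<le> g t - g s"
          using h_exp[of "\<tau> s" "\<tau> t"] \<tau>_le[OF st(1)] \<tau>_le[OF st(2)] h\<tau>[OF st1(1)] h\<tau>[OF st1(2)] by simp
        also have "\<dots> \<le> dist (g t) (g s)" by (simp add: dist_real_def)
        also have "\<dots> \<le> B * dist (\<eta> t) (\<eta> s)" unfolding g_def by (intro lipschitz_onD[OF B] in_ball st1)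
        also have "\<dots> \<le> B * (L * dist t s)"
          using lipschitz_on_nonneg[OF B] by (intro mult_left_mono lipschitz_onD[OF lip] st1)
        finally show ?thesis using w0 st(3) by (simp add: dist_real_def field_simps)
      qed
      fix s t assume st: "s \<in> {0..T}" "t \<in> {0..T}"
      show "dist (\<tau> s) (\<tau> t) \<le> B * L / w0 * dist s t"
      proof (cases "s \<le> t")
        case True
        then have "\<tau> s \<le> \<tau> t" using tc st sub by (auto simp: time_change_def mono_on_def)
        then show ?thesis using key[OF st True] True by (simp add: dist_real_def)
      next
        case False
        then have "\<tau> t \<le> \<tau> s" using tc st sub by (auto simp: time_change_def mono_on_def)
        then show ?thesis using key[OF st(2,1)] False by (simp add: dist_real_def)
      qed
    qed (use lipschitz_on_nonneg[OF B] lipschitz_on_nonneg[OF lip] w0 in simp)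
    define z where "z t = \<eta> t - \<Gamma> (\<tau> t)" for t
    have z_bd: "norm (z t) \<le> 2 * r" if "t \<in> {0..T}" for t
    proof -
      have t: "t \<in> {0..1}" using that sub by auto
      have "norm (\<eta> t) \<le> r" "norm (\<Gamma> (\<tau> t)) \<le> r" using in_ball[OF t] \<Gamma>_in[OF \<tau>_in[OF t]] by auto
      then show ?thesis using norm_triangle_ineq4[of "\<eta> t" "\<Gamma> (\<tau> t)"] by (simp add: z_def)
    qed
    have "(L' * (B * L / w0))-lipschitz_on {0..T} (\<lambda>t. \<Gamma> (\<tau> t))"
      using \<tau>_in sub by (intro lipschitz_on_compose2[OF \<tau>_lip] lipschitz_on_subset[OF L']) auto
    from lipschitz_on_diff[OF lipschitz_on_subset[OF lip sub] this]
    obtain Lz where Lz: "Lz-lipschitz_on {0..T} z" unfolding z_def by blast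
    have v_lip: "(4 * r * Lz)-lipschitz_on {0..T} (\<lambda>t. (norm (z t))\<^sup>2)"
    proof (rule lipschitz_onI)
      fix s t assume st: "s \<in> {0..T}" "t \<in> {0..T}"
      have "dist ((norm (z s))\<^sup>2) ((norm (z t))\<^sup>2) = \<bar>norm (z s) + norm (z t)\<bar> * \<bar>norm (z s) - norm (z t)\<bar>"
        by (simp add: dist_real_def power2_eq_square square_diff_square_factored abs_mult)
      also have "\<dots> \<le> (4 * r) * dist (z s) (z t)"
        using z_bd[OF st(1)] z_bd[OF st(2)] r0 by (intro mult_mono) (auto simp: dist_norm norm_triangle_ineq3)
      also have "\<dots> \<le> (4 * r) * (Lz * dist s t)" using r0 by (intro mult_left_mono lipschitz_onD[OF Lz] st) auto
      finally show "dist ((norm (z s))\<^sup>2) ((norm (z t))\<^sup>2) \<le> 4 * r * Lz * dist s t" by simp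
    qed (use r0 lipschitz_on_nonneg[OF Lz] in simp)
    \<comment> \<open>Twice the product of the bounds found below:
      \<open>L / (k * \<delta>1)\<close> for the speed factor \<kappa>, \<open>M\<close> for the
      variation of \<open>V\<close>, and the factor of \<open>direction_defect\<close> with
      \<open>norm a + norm b \<le> 2 * C * r\<close> and
      \<open>norm b \<ge> k * \<delta>2\<close>.\<close>
    define K where "K = 2 * (L / (k * \<delta>1)) * (M * (1 + 2 * C * r / (k * \<delta>2)))"
    have LM: "0 \<le> L" "0 \<le> M" using lip M lipschitz_on_nonneg by blast+
    have K0: "0 \<le> K" using LM k \<delta>1 \<delta>2 C r0 by (simp add: K_def)
    \<comment> \<open>The derivative of \<open>z\<close> by the chain rule: \<tau> moves at the rate
      of \<open>G\<close> along \<eta> divided by the derivative of \<open>h\<close>, and the factor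
      \<open>k * (1 - \<tau> t)\<close> of the orbit curve cancels.\<close>
    define z' where "z' t = velocity \<eta> t - (V (\<eta> t) \<bullet> velocity \<eta> t / (norm (V (\<Gamma> (\<tau> t))))\<^sup>2) *\<^sub>R V (\<Gamma> (\<tau> t))" for t
    have "(norm (z T))\<^sup>2 = 0"
    proof (rule lipschitz_gronwall_zero[OF v_lip _ _ N K0, where v'="\<lambda>t. 2 * (z' t \<bullet> z t)"])
      show "(norm (z 0))\<^sup>2 = 0" using ends \<Gamma>_ends tc by (simp add: z_def time_change_def)
      fix t assume t: "t \<in> {0..T} - N"
      then have t1: "t \<in> {0..1}" "t \<in> {0..T}" "t \<in> {0..1} - N1" "t \<in> {0..1} - N2" using sub by (auto simp: N_def)
      define q where "q = \<Gamma> (\<tau> t)"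
      define a where "a = V (\<eta> t)"
      define b where "b = V q"
      have \<tau>t: "\<tau> t \<in> {0..<1}" "\<tau> t \<in> {0..1}" using \<tau>_le[OF t1(2)] \<tau>T by auto
      have q: "q \<in> cball 0 r" "q \<noteq> 0" unfolding q_def by (rule \<Gamma>_in[OF \<tau>t(2)], rule \<Gamma>_nz[OF \<tau>t(1)])
      have ab: "a \<noteq> 0" "b \<noteq> 0" unfolding a_def b_def using V_nz q in_ball[OF t1(1)] \<eta>_nz[OF t1(2)] by auto
      have d\<eta>: "(\<eta> has_vector_derivative velocity \<eta> t) (at t within {0..1})" by (rule N2(2)[OF t1(4)])
      have dg: "(g has_real_derivative a \<bullet> velocity \<eta> t) (at t within {0..1})"
        using potential_along_curve_derivative[OF cal d\<eta> in_ball[OF t1(1)]] by (simp add: g_def[abs_def] a_def)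
      define D where "D = (norm b)\<^sup>2 / (k * (1 - \<tau> t))"
      have D: "D > 0" using ab k \<tau>t by (simp add: D_def)
      have "(h has_real_derivative D) (at (\<tau> t) within {0..1})"
        using hd[OF \<tau>t(1)] by (simp add: D_def b_def q_def)
      from has_real_derivative_inverse_within[OF this _ \<tau>t(2) \<phi>h c\<phi>] D
      have "(\<phi> has_real_derivative 1 / D) (at (g t) within h ` {0..1})" by (simp add: h\<tau>[OF t1(1)])
      from has_field_derivative_subset[OF this, of "g ` {0..1}"] g_range
      have "(\<phi> has_real_derivative 1 / D) (at (g t) within g ` {0..1})" by blast
      from DERIV_image_chain[OF this dg]
      have d\<tau>: "(\<tau> has_real_derivative 1 / D * (a \<bullet> velocity \<eta> t)) (at t within {0..1})"
        by (simp add: o_def \<tau>_def[abs_def])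
      have "\<tau> ` {0..1} \<subseteq> {0..1}" using \<tau>_in by auto
      from vector_diff_chain_within[OF d\<tau>[unfolded has_real_derivative_iff_has_vector_derivative]
          has_vector_derivative_within_subset[OF \<Gamma>_d[OF \<tau>t(1)] this]]
      have "((\<lambda>t. \<Gamma> (\<tau> t)) has_vector_derivative
          (1 / D * (a \<bullet> velocity \<eta> t)) *\<^sub>R ((1 / (k * (1 - \<tau> t))) *\<^sub>R b)) (at t within {0..1})"
        by (simp add: o_def b_def q_def)
      moreover have "(1 / D * (a \<bullet> velocity \<eta> t)) *\<^sub>R ((1 / (k * (1 - \<tau> t))) *\<^sub>R b) = (a \<bullet> velocity \<eta> t / (norm b)\<^sup>2) *\<^sub>R b"
        using k \<tau>t ab by (simp add: D_def)
      ultimately have "((\<lambda>t. \<Gamma> (\<tau> t)) has_vector_derivative (a \<bullet> velocity \<eta> t / (norm b)\<^sup>2) *\<^sub>R b) (at t within {0..1})"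
        by (simp only:)
      from has_vector_derivative_diff[OF d\<eta> this]
      have "(z has_vector_derivative z' t) (at t within {0..1})"
        by (simp add: z_def[abs_def] z'_def a_def b_def q_def)
      from has_real_derivative_inner_self[OF has_vector_derivative_within_subset[OF this sub]]
      have dv: "((\<lambda>t. (norm (z t))\<^sup>2) has_real_derivative 2 * (z' t \<bullet> z t)) (at t within {0..T})" .
      \<comment> \<open>Equality in Cauchy-Schwarz makes the velocity of \<eta> this multiple of the
        field.\<close>
      define \<kappa> where "\<kappa> = norm (velocity \<eta> t) / norm a"
      have eq: "a \<bullet> velocity \<eta> t = norm a * norm (velocity \<eta> t)"
        using N1(2)[OF t1(3)] calibration_norm[OF cal in_ball[OF t1(1)]] by (simp add: f_def a_def)
      then have "norm a *\<^sub>R velocity \<eta> t = norm (velocity \<eta> t) *\<^sub>R a"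
        by (simp add: norm_cauchy_schwarz_eq)
      then have "(1 / norm a) *\<^sub>R (norm a *\<^sub>R velocity \<eta> t) = (1 / norm a) *\<^sub>R (norm (velocity \<eta> t) *\<^sub>R a)" by simp
      then have vel: "velocity \<eta> t = \<kappa> *\<^sub>R a" using ab by (simp add: \<kappa>_def)
      have "z' t = \<kappa> *\<^sub>R (a - ((norm a)\<^sup>2 / (norm b)\<^sup>2) *\<^sub>R b)"
      proof -
        have "z' t = velocity \<eta> t - (a \<bullet> velocity \<eta> t / (norm b)\<^sup>2) *\<^sub>R b" by (simp add: z'_def a_def b_def q_def)
        also have "\<dots> = \<kappa> *\<^sub>R a - (\<kappa> * (norm a)\<^sup>2 / (norm b)\<^sup>2) *\<^sub>R b"
          unfolding vel by (simp add: power2_norm_eq_inner)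
        finally show ?thesis by (simp add: scaleR_diff_right)
      qed
      then have "norm (z' t) = \<bar>\<kappa>\<bar> * norm (a - ((norm a)\<^sup>2 / (norm b)\<^sup>2) *\<^sub>R b)" by simp
      also have "\<dots> \<le> L / (k * \<delta>1) * (M * norm (z t) * (1 + 2 * C * r / (k * \<delta>2)))"
      proof (intro mult_mono)
        have "k * \<delta>1 \<le> norm a"
          using calibration_norm_lower[OF cal in_ball[OF t1(1)]] mult_left_mono[OF \<delta>1(2)[OF t1(2)], of k] k
          unfolding a_def by linarith
        moreover have "norm (velocity \<eta> t) \<le> L" by (rule N2(3)[OF t1(4)])
        ultimately show "\<bar>\<kappa>\<bar> \<le> L / (k * \<delta>1)"
          using k \<delta>1 LM ab by (simp add: \<kappa>_def) (intro frac_le, auto)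
        have "norm (a - ((norm a)\<^sup>2 / (norm b)\<^sup>2) *\<^sub>R b) \<le> norm (a - b) * (1 + (norm a + norm b) / norm b)"
          by (rule direction_defect[OF ab])
        also have "\<dots> \<le> (M * norm (z t)) * (1 + 2 * C * r / (k * \<delta>2))"
        proof (intro mult_mono add_mono frac_le)
          show "norm (a - b) \<le> M * norm (z t)"
            using lipschitz_onD[OF M in_ball[OF t1(1)] q(1)] by (simp add: a_def b_def z_def q_def dist_norm)
          have "norm y \<le> C * r" if "y = V s" "s \<in> cball 0 r" for y s
            using C(2)[OF that(2)] that mult_left_mono[of "norm s" r C] C(1) by simp
          from this[OF a_def in_ball[OF t1(1)]] this[OF b_def q(1)]
          show "norm a + norm b \<le> 2 * C * r" by simp
          have "\<delta>2 \<le> norm q" using \<delta>2(2)[OF \<tau>_le[OF t1(2)]] by (simp add: q_def)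
          then show "k * \<delta>2 \<le> norm b"
            using calibration_norm_lower[OF cal q(1)] mult_left_mono[of \<delta>2 "norm q" k] k unfolding b_def by linarith
        qed (use C r0 k \<delta>2 LM in auto)
        finally show "norm (a - ((norm a)\<^sup>2 / (norm b)\<^sup>2) *\<^sub>R b) \<le> (M * norm (z t)) * (1 + 2 * C * r / (k * \<delta>2))" .
      qed (use LM k \<delta>1 in auto)
      also have "\<dots> = K / 2 * norm (z t)"
      proof -
        have "X * (M * n * Y) = 2 * X * (M * Y) / 2 * n" for X Y n :: real by simp
        then show ?thesis unfolding K_def .
      qed
      finally have z'_le: "norm (z' t) \<le> K / 2 * norm (z t)" .
      have "2 * (z' t \<bullet> z t) \<le> 2 * (norm (z' t) * norm (z t))" by (intro mult_left_mono norm_cauchy_schwarz) auto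
      also have "\<dots> \<le> 2 * (K / 2 * norm (z t) * norm (z t))"
        by (intro mult_left_mono mult_right_mono z'_le) auto
      finally have "2 * (z' t \<bullet> z t) \<le> K * (norm (z t))\<^sup>2" by (simp add: power2_eq_square)
      with dv show "((\<lambda>t. (norm (z t))\<^sup>2) has_real_derivative 2 * (z' t \<bullet> z t)) (at t within {0..T}) \<and>
          2 * (z' t \<bullet> z t) \<le> K * (norm (z t))\<^sup>2" by blast
    qed (use T in auto)
    then show ?thesis by (simp add: z_def)
  qed
  then show ?thesis using tc unfolding \<Gamma>_def by blast
qed

section \<open>Constrained minimizers\<close>

lemma curves_to_originD:
  assumes "\<eta> \<in> curves_to_origin p"
  obtains L where "L-lipschitz_on {0..1} \<eta>" "\<eta> 0 = p" "\<eta> 1 = 0"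
  using assms locally_lipschitz_on_compact[of "{0..1}" \<eta>] unfolding curves_to_origin_def by auto

text \<open>A competitor that reaches the circle of radius \<open>r\<close> pays at least
  \<open>k / 2 * (3 / 4 * r^2)\<close>, because it starts within \<open>r / 2\<close>; by smallness
  this exceeds the energy of the orbit. All others stay in the disc, where the calibration
  inequality holds.\<close>

lemma orbit_curve_competitor:
  assumes cal: "calibrates W r k \<mu> G V" and k: "k > 0" and W: "continuous_on UNIV W" "\<And>q. W q \<ge> 0"
    and p: "norm p \<le> r / 2" "p \<noteq> 0" and C: "C \<ge> 0" "\<forall>q\<in>cball 0 r. norm (V q) \<le> C * norm q"
    and small: "C\<^sup>2 * (norm p)\<^sup>2 / k < 3 * k * r\<^sup>2 / 8"
    and orb: "orbit k c V p x \<alpha> A" and \<eta>: "\<eta> \<in> curves_to_origin p"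
  shows "energy W (orbit_curve k x) < energy W \<eta> \<or>
     ((\<forall>t\<in>{0..1}. \<eta> t \<in> cball 0 r) \<and> - G p + \<mu> * area \<eta> \<le> energy W \<eta>)"
proof -
  obtain L where \<eta>: "L-lipschitz_on {0..1} \<eta>" "\<eta> 0 = p" "\<eta> 1 = 0" using curves_to_originD[OF \<eta>] .
  have np: "0 < norm p" using p by simp
  then have pr: "p \<in> cball 0 r" "norm p < r" using p(1) unfolding mem_cball_0 by linarith+
  show ?thesis
  proof (cases "\<exists>t\<in>{0..1}. r \<le> norm (\<eta> t)")
    case True
    then obtain t where t: "t \<in> {0..1}" "r \<le> norm (\<eta> t)" by blast
    have "energy W (orbit_curve k x) \<le> C\<^sup>2 * (norm p)\<^sup>2 / k"
      by (rule orbit_curve_energy(2)[OF cal k pr(1) orb C W(1)])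
    also have "\<dots> < k / 2 * (3 / 4 * r\<^sup>2)" using small by simp
    also have "\<dots> \<le> k / 2 * (r\<^sup>2 - (norm (\<eta> 0))\<^sup>2)"
    proof -
      have "(norm p)\<^sup>2 \<le> (r / 2)\<^sup>2" using p by (intro power_mono) auto
      then have "3 / 4 * r\<^sup>2 \<le> r\<^sup>2 - (norm (\<eta> 0))\<^sup>2" by (simp add: \<eta>(2) power_divide)
      then show ?thesis using k by (intro mult_left_mono) auto
    qed
    also have "\<dots> \<le> energy W \<eta>"
      by (rule energy_of_escaping_curve[OF cal k W \<eta>(1) t]) (simp add: \<eta>(2) pr)
    finally show ?thesis ..
  next
    case False
    then have in_ball: "\<eta> t \<in> cball 0 r" if "t \<in> {0..1}" for t using that by (auto simp: not_le less_imp_le)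
    have "- G p + \<mu> * area \<eta> \<le> energy W \<eta>"
      using calibration_inequality[OF cal W(1) \<eta>(1) in_ball] calibratesD(1)[OF cal] by (simp add: \<eta>)
    with in_ball show ?thesis by blast
  qed
qed

theorem theorem2p8:
  fixes l1 l2 \<rho> :: real and W :: "real ^ 2 \<Rightarrow> real"
  assumes "l1 > 0" and "l2 > 0" and "\<rho> > 0"
    and "\<And>p. W p \<ge> 0"
    and "continuous_on UNIV W"
    and "real_analytic_on W (ball 0 \<rho>)"
    and "\<forall>\<beta>\<in>{0<..<pi}. \<exists>g.
           real_analytic_on g (ball 0 \<rho>) \<and>
           (\<exists>a. has_taylor_series g 0 a \<and> (\<forall>\<alpha>. multi_order \<alpha> < 3 \<longrightarrow> a \<alpha> = 0)) \<and>
           (\<forall>p\<in>ball 0 \<rho>. W p = (norm (gradient g p + Lambda l1 l2 \<beta> p))\<^sup>2)"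
  shows "\<exists>R>0. ball (0 :: real ^ 2) R \<subseteq> ball 0 \<rho> \<and>
           (\<forall>p0 \<in> ball 0 R - {0}.
              (\<exists>\<gamma>0. minimizing_geodesic W p0 \<gamma>0) \<and>
              (\<forall>\<gamma>0 \<eta>0. minimizing_geodesic W p0 \<gamma>0 \<longrightarrow> minimizing_geodesic W p0 \<eta>0 \<longrightarrow>
                  same_up_to_reparam \<gamma>0 \<eta>0) \<and>
              (\<exists>a b. (\<forall>\<gamma>0. minimizing_geodesic W p0 \<gamma>0 \<longrightarrow> area \<gamma>0 \<in> {a<..<b}) \<and>
                     (\<forall>A\<in>{a<..<b}. \<exists>\<gamma>. constrained_minimizer W A p0 \<gamma>)))"
proof -
  note Wnn = assms(4) and Wc = assms(5)
  from calibration_family[OF assms(1,2,3,7)]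
  obtain r k m G V where r: "0 < r" "r < \<rho>" and k: "0 < k" and m: "0 < m"
    and cal': "\<forall>\<mu>. \<bar>\<mu>\<bar> \<le> m \<longrightarrow> calibrates W r k \<mu> (G \<mu>) (V \<mu>)"
    and ne: "\<forall>\<mu>. \<bar>\<mu>\<bar> \<le> m \<longrightarrow> \<mu> \<noteq> 0 \<longrightarrow> (\<exists>d>0. \<forall>p. 0 < norm p \<and> norm p < d \<longrightarrow> V \<mu> p \<noteq> V 0 p)"
    by (elim exE conjE)
  have cal: "calibrates W r k \<mu> (G \<mu>) (V \<mu>)" if "\<bar>\<mu>\<bar> \<le> m" for \<mu> using cal' that by simp
  have cal0: "calibrates W r k 0 (G 0) (V 0)" using m by (intro cal) simp
  obtain C where C: "C \<ge> 0" and C0: "\<And>q. q \<in> cball 0 r \<Longrightarrow> norm (V 0 q) \<le> C * norm q"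
    using calibration_vector_bound[OF cal0] by blast
  \<comment> \<open>All fields have length \<open>sqrt W\<close>, so the linear bound of
    \<open>V 0\<close> holds for the whole family, and the constant \<open>c\<close> of the orbits
    below does not depend on \<mu>.\<close>
  have Cb: "\<forall>q\<in>cball 0 r. norm (V \<mu> q) \<le> C * norm q" if "\<bar>\<mu>\<bar> \<le> m" for \<mu>
    using C0 calibration_norm[OF cal[OF that]] calibration_norm[OF cal0] by simp
  \<comment> \<open>The second entry gives \<open>C * R \<le> k * r / 2\<close>, hence orbit
    energies of at most \<open>k * r^2 / 4\<close>, below the escape cost
    \<open>3 * k * r^2 / 8\<close>. The \<open>+ 1\<close> covers \<open>C = 0\<close>.\<close>
  define R where "R = min (r / 2) (k * r / (2 * (C + 1)))"
  have R: "0 < R" "R \<le> r / 2" using r k C unfolding R_def by (simp, intro min.cobounded1)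
  have CR: "C\<^sup>2 * R\<^sup>2 / k < 3 * k * r\<^sup>2 / 8"
  proof -
    have "C * R \<le> C * (k * r / (2 * (C + 1)))" using C by (intro mult_left_mono) (auto simp: R_def)
    also have "\<dots> \<le> k * r / 2" using C k r by (simp add: field_simps)
    finally have "(C * R)\<^sup>2 \<le> (k * r / 2)\<^sup>2" using C R by (intro power_mono) auto
    then have "C\<^sup>2 * R\<^sup>2 / k \<le> k * r\<^sup>2 / 4"
      using k by (simp add: power_mult_distrib power_divide power2_eq_square field_simps)
    also have "\<dots> < 3 * k * r\<^sup>2 / 8" using k r by simp
    finally show ?thesis .
  qed
  have main: "(\<exists>\<gamma>0. minimizing_geodesic W p0 \<gamma>0) \<and>
              (\<forall>\<gamma>0 \<eta>0. minimizing_geodesic W p0 \<gamma>0 \<longrightarrow> minimizing_geodesic W p0 \<eta>0 \<longrightarrow>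
                  same_up_to_reparam \<gamma>0 \<eta>0) \<and>
              (\<exists>a b. (\<forall>\<gamma>0. minimizing_geodesic W p0 \<gamma>0 \<longrightarrow> area \<gamma>0 \<in> {a<..<b}) \<and>
                     (\<forall>A\<in>{a<..<b}. \<exists>\<gamma>. constrained_minimizer W A p0 \<gamma>))"
    if p0: "p0 \<in> ball 0 R - {0}" for p0
  proof -
    have p: "norm p0 \<le> r / 2" "p0 \<noteq> 0" "p0 \<in> cball 0 r" using p0 R r by auto
    have "C\<^sup>2 * (norm p0)\<^sup>2 / k \<le> C\<^sup>2 * R\<^sup>2 / k"
      using p0 k by (intro divide_right_mono mult_left_mono power_mono) auto
    with CR have small: "C\<^sup>2 * (norm p0)\<^sup>2 / k < 3 * k * r\<^sup>2 / 8" by linarith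
    define c where "c = C * (norm p0)\<^sup>2 / (2 * k)"
    have "\<exists>x \<alpha> A. orbit k c (V \<mu>) p0 x \<alpha> A" if "\<bar>\<mu>\<bar> \<le> m" for \<mu>
      using orbit_exists[OF cal[OF that] r(1) k p(3) C] Cb[OF that] unfolding c_def by metis
    then have "\<forall>\<mu>\<in>{\<mu>. \<bar>\<mu>\<bar> \<le> m}. \<exists>x \<alpha> A. orbit k c (V \<mu>) p0 x \<alpha> A" by simp
    then obtain x \<alpha> P where "\<forall>\<mu>\<in>{\<mu>. \<bar>\<mu>\<bar> \<le> m}. orbit k c (V \<mu>) p0 (x \<mu>) (\<alpha> \<mu>) (P \<mu>)"
      unfolding bchoice_iff by (elim exE)
    then have orb: "orbit k c (V \<mu>) p0 (x \<mu>) (\<alpha> \<mu>) (P \<mu>)" if "\<bar>\<mu>\<bar> \<le> m" for \<mu> using that by simp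
    define \<Gamma> where "\<Gamma> \<mu> = orbit_curve k (x \<mu>)" for \<mu>
    have \<Gamma>: "\<Gamma> \<mu> \<in> curves_to_origin p0" "area (\<Gamma> \<mu>) = P \<mu>" "energy W (\<Gamma> \<mu>) = - G \<mu> p0 + \<mu> * P \<mu>"
      if "\<bar>\<mu>\<bar> \<le> m" for \<mu>
      unfolding \<Gamma>_def
      by (rule orbit_curve_admissible[OF cal[OF that] k p(3) orb[OF that] C Cb[OF that]]
          orbit_curve_area[OF cal[OF that] k p(3) orb[OF that] C Cb[OF that]]
          orbit_curve_energy(1)[OF cal[OF that] k p(3) orb[OF that] C Cb[OF that] Wc])+
    have comp: "energy W (\<Gamma> \<mu>) < energy W \<eta> \<or>
       ((\<forall>t\<in>{0..1}. \<eta> t \<in> cball 0 r) \<and> - G \<mu> p0 + \<mu> * area \<eta> \<le> energy W \<eta>)"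
      if "\<bar>\<mu>\<bar> \<le> m" "\<eta> \<in> curves_to_origin p0" for \<mu> \<eta>
      unfolding \<Gamma>_def
      by (rule orbit_curve_competitor[OF cal[OF that(1)] k Wc Wnn p(1,2) C Cb[OF that(1)] small orb[OF that(1)] that(2)])
    have m0: "\<bar>0\<bar> \<le> m" using m by simp
    have E0: "energy W (\<Gamma> 0) = - G 0 p0" using \<Gamma>(3)[OF m0] by simp

    \<comment> \<open>For \<open>\<mu> = 0\<close> the area drops out of the calibration bound,
      which then compares curves of all areas.\<close>
    have geo: "minimizing_geodesic W p0 (\<Gamma> 0)"
      unfolding minimizing_geodesic_def is_arg_min_def
      using \<Gamma>(1)[OF m0] comp[OF m0] E0 by force
    have min: "energy W \<eta> = - G 0 p0" "\<eta> \<in> curves_to_origin p0" "\<And>t. t \<in> {0..1} \<Longrightarrow> \<eta> t \<in> cball 0 r"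
      if "minimizing_geodesic W p0 \<eta>" for \<eta>
    proof -
      show \<eta>: "\<eta> \<in> curves_to_origin p0" using that by (simp add: minimizing_geodesic_def is_arg_min_def)
      have "\<not> energy W \<eta> < energy W (\<Gamma> 0)" "\<not> energy W (\<Gamma> 0) < energy W \<eta>"
        using that geo by (auto simp: minimizing_geodesic_def is_arg_min_def)
      then have "energy W \<eta> = - G 0 p0 \<and> (\<forall>t\<in>{0..1}. \<eta> t \<in> cball 0 r)"
        using comp[OF m0 \<eta>] E0 by auto
      then show "energy W \<eta> = - G 0 p0" and "\<And>t. t \<in> {0..1} \<Longrightarrow> \<eta> t \<in> cball 0 r" by blast+
    qed
    have rep: "\<exists>\<tau>. time_change \<tau> \<and> (\<forall>t\<in>{0..1}. \<eta> t = \<Gamma> 0 (\<tau> t))" if g: "minimizing_geodesic W p0 \<eta>" for \<eta>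
    proof -
      obtain L where \<eta>: "L-lipschitz_on {0..1} \<eta>" "\<eta> 0 = p0" "\<eta> 1 = 0"
        using curves_to_originD[OF min(2)[OF g]] .
      show ?thesis unfolding \<Gamma>_def
        by (rule minimizer_reparametrizes_orbit[OF cal0 k p(3,2) orb[OF m0] Wc \<eta> min(3)[OF g] min(1)[OF g]])
    qed
    have uniq: "same_up_to_reparam \<gamma> \<eta>"
      if g: "minimizing_geodesic W p0 \<gamma>" "minimizing_geodesic W p0 \<eta>" for \<gamma> \<eta>
    proof -
      obtain \<sigma> \<tau> where "time_change \<sigma>" "\<forall>t\<in>{0..1}. \<gamma> t = \<Gamma> 0 (\<sigma> t)" "time_change \<tau>" "\<forall>t\<in>{0..1}. \<eta> t = \<Gamma> 0 (\<tau> t)"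
        using rep[OF g(1)] rep[OF g(2)] by blast
      moreover have "locally_lipschitz_on {0..1} (\<Gamma> 0)" using \<Gamma>(1)[OF m0] by (simp add: curves_to_origin_def)
      ultimately show ?thesis unfolding same_up_to_reparam_def by blast
    qed

    \<comment> \<open>The \<mu> orbit has positive excess over the gradient calibration, since it
      comes close to 0, where the two fields differ. It thus costs more than the geodesic, which
      rules out the first case of \<open>comp\<close>. The second gives
      \<open>- G \<mu> p0 + \<mu> * area \<eta> \<le> - G 0 p0\<close>, and the positive excess says
      that the right side is below \<open>- G \<mu> p0 + \<mu> * P \<mu>\<close>.\<close>
    have gap: "\<mu> * area \<eta> < \<mu> * P \<mu>" if \<mu>: "\<bar>\<mu>\<bar> \<le> m" "\<mu> \<noteq> 0" and g: "minimizing_geodesic W p0 \<eta>" for \<mu> \<eta>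
    proof -
      from ne \<mu> obtain d where d: "d > 0" "\<And>q. 0 < norm q \<and> norm q < d \<Longrightarrow> V \<mu> q \<noteq> V 0 q" by blast
      have "\<forall>\<^sub>F s in at_top. norm p0 * exp (- k * s) < d"
        using k d(1) by (intro order_tendstoD(2)[OF tendsto_exp_decay])
      then obtain s where s: "s \<ge> 0" "norm p0 * exp (- k * s) < d"
        unfolding eventually_at_top_linorder by (meson max.cobounded1 max.cobounded2)
      have "norm (x \<mu> s) < d" using orbitD(4)[OF orb[OF \<mu>(1)] s(1)] s(2) by linarith
      moreover have "x \<mu> s \<noteq> 0"
        using orbit_nonzero[OF cal[OF \<mu>(1)] k p(3,2) orb[OF \<mu>(1)] _ s(1)] Cb[OF \<mu>(1)] by blast
      ultimately have "V \<mu> (x \<mu> s) \<noteq> V 0 (x \<mu> s)" by (intro d(2)) simp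
      from calibration_excess_pos[OF cal0 cal[OF \<mu>(1)] k p(3) orb[OF \<mu>(1)] s(1) this]
      have pos: "0 < G 0 p0 - G \<mu> p0 + \<mu> * P \<mu>" by simp
      then have "energy W \<eta> < energy W (\<Gamma> \<mu>)" using min(1)[OF g] \<Gamma>(3)[OF \<mu>(1)] by simp
      then have "- G \<mu> p0 + \<mu> * area \<eta> \<le> - G 0 p0" using comp[OF \<mu>(1) min(2)[OF g]] min(1)[OF g] by auto
      with pos show ?thesis by linarith
    qed
    \<comment> \<open>The gap at \<open>\<mu> = m\<close> and at \<open>\<mu> = - m\<close>; the
      same interval serves all minimizers.\<close>
    have area: "area \<eta> \<in> {P (- m)<..<P m}" if g: "minimizing_geodesic W p0 \<eta>" for \<eta>
      using gap[OF _ _ g, of m] gap[OF _ _ g, of "- m"] m by simp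
    have con: "\<exists>\<gamma>. constrained_minimizer W A p0 \<gamma>" if A: "A \<in> {P (- m)<..<P m}" for A
    proof -
      have "continuous_on {- m..m} P" by (rule orbit_area_continuous[OF cal k p(3) orb])
      then obtain \<mu> where \<mu>: "- m \<le> \<mu>" "\<mu> \<le> m" "P \<mu> = A" using IVT'[of P "- m" A m] A m by auto
      then have \<mu>m: "\<bar>\<mu>\<bar> \<le> m" by simp
      have "constrained_minimizer W A p0 (\<Gamma> \<mu>)"
        unfolding constrained_minimizer_def is_arg_min_def curves_with_area_def
      proof (intro conjI notI)
        show "\<Gamma> \<mu> \<in> {\<gamma> \<in> curves_to_origin p0. area \<gamma> = A}" using \<Gamma>(1,2)[OF \<mu>m] \<mu>(3) by simp
        assume "\<exists>\<eta>. \<eta> \<in> {\<gamma> \<in> curves_to_origin p0. area \<gamma> = A} \<and> energy W \<eta> < energy W (\<Gamma> \<mu>)"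
        then obtain \<eta> where \<eta>: "\<eta> \<in> curves_to_origin p0" "area \<eta> = A" "energy W \<eta> < energy W (\<Gamma> \<mu>)" by blast
        \<comment> \<open>With equal areas the calibration bound for the competitor is exactly the
          energy of the orbit.\<close>
        show False using comp[OF \<mu>m \<eta>(1)] \<eta>(2,3) \<Gamma>(3)[OF \<mu>m] \<mu>(3) by auto
      qed
      then show ?thesis by blast
    qed
    show ?thesis using geo uniq area con by blast
  qed
  have "ball (0 :: real ^ 2) R \<subseteq> ball 0 \<rho>" using R r by auto
  then show ?thesis using R(1) main by blast
qed

end
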